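(* Let $\alpha<\omega_1^{\mathrm{ck}}$ be a computable ordinal. There are continuum-many reals $f\in\mathbb{N}^{\mathbb{N}}$ which are $\Delta^0_{1+\alpha}$-dominated. Hence, there are continuum-many reals which strongly relativize $\Delta^0_{1+\alpha}$ at $\mathbb{N}$.
   Context: $\omega_1^{\mathrm{ck}}$ is the least ordinal that is not the order type of a computable wellordering on $\mathbb{N}$; ordinals below it are called computable. "Reals" are elements of $\mathbb{N}^{\mathbb{N}}$. Effective Borel classes on a product $\mathcal{X}$ of copies of $\mathbb{N}$ and $\mathbb{N}^{\mathbb{N}}$, with effectively enumerated basic open sets $N_s(\mathcal{X})$: $P\subseteq\mathcal{X}$ is $\Sigma^0_\alpha$ ($1\le\alpha<\omega_1^{\mathrm{ck}}$) if it has a computable Borel code of rank at most $\alpha$. Here a code of rank $1$ is a $c\in\mathbb{N}^{\mathbb{N}}$ with $c(0)=0$, coding the open set $\bigcup\{N_s(\mathcal{X}):(\exists n)\,c(n+1)=s+1\}$; a code of rank at most $\alpha>1$ is either a code of rank at most some $\beta<\alpha$, or a $c$ with $c(0)=1$ such that each $(c)_n:=(m\mapsto c(1+\langle n,m\rangle))$ is a code of rank at most some $\beta_n<\alpha$ (with $\langle\cdot,\cdot\rangle$ a computable pairing bijection), coding $\bigcup_n(\mathcal{X}\setminus P_n)$ where $P_n$ is coded by $(c)_n$. $\Pi^0_\alpha$ sets are complements of $\Sigma^0_\alpha$ sets and $\Delta^0_\alpha=\Sigma^0_\alpha\cap\Pi^0_\alpha$. For $f\in\mathbb{N}^{\mathbb{N}}$,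 $\Sigma^0_\alpha(f)$ (resp. $\Pi^0_\alpha(f)$) consists of the $f$-sections $Q_f=\{x:Q(f,x)\}$ of $\Sigma^0_\alpha$ (resp. $\Pi^0_\alpha$) sets $Q\subseteq\mathbb{N}^{\mathbb{N}}\times\mathcal{X}$, and $\Delta^0_\alpha(f)=\Sigma^0_\alpha(f)\cap\Pi^0_\alpha(f)$. $f$ strongly relativizes $\Delta^0_\alpha$ at $\mathbb{N}$ if every $\Delta^0_\alpha(f)$ set $P\subseteq\mathbb{N}$ equals $Q_f$ for some $\Delta^0_\alpha$ set $Q\subseteq\mathbb{N}^{\mathbb{N}}\times\mathbb{N}$. A total function $g:\mathbb{N}\to\mathbb{N}$ is a $\Gamma$ function if its graph is in $\Gamma$. $f\in\mathbb{N}^{\mathbb{N}}$ is $\Delta^0_{1+\alpha}$-dominated if for every total $\Delta^0_{1+\alpha}(f)$ function $g:\mathbb{N}\to\mathbb{N}$ there is a total $\Delta^0_{1+\alpha}$ function $h:\mathbb{N}\to\mathbb{N}$ with $g(n)\le h(n)$ for all $n\in\mathbb{N}$. *)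

theory Defs
  imports Complex_Main "HOL-Library.Nat_Bijection" "HOL-Library.Equipollence"
begin

unbundle cardinal_syntax

section \<open>Computable functions\<close>

datatype recf =
    Zero
  | Succ
  | Proj nat
  | Comp recf "recf list"
  | PRec recf recf
  | Mu recf

lemma list_all2_monoI [mono]:
  "(\<And>x y. P x y \<longrightarrow> Q x y) \<Longrightarrow> list_all2 P xs ys \<longrightarrow> list_all2 Q xs ys"
  by (simp add: list_all2_mono)

text \<open>\<open>computes p xs y\<close>: the partial recursive function described by \<open>p\<close> is defined at the
  argument tuple \<open>xs\<close> and has value \<open>y\<close> there. Recursion and minimization act on the first argument.\<close>

inductive computes :: "recf \<Rightarrow> nat list \<Rightarrow> nat \<Rightarrow> bool" where
  Zero: "computes Zero xs 0"
| Succ: "computes Succ (x # xs) (Suc x)"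
| Proj: "i < length xs \<Longrightarrow> computes (Proj i) xs (xs ! i)"
| Comp: "list_all2 (\<lambda>q y. computes q xs y) qs ys \<Longrightarrow> computes p ys z
    \<Longrightarrow> computes (Comp p qs) xs z"
| PRec_0: "computes p xs y \<Longrightarrow> computes (PRec p q) (0 # xs) y"
| PRec_Suc: "computes (PRec p q) (n # xs) y \<Longrightarrow> computes q (n # y # xs) z
    \<Longrightarrow> computes (PRec p q) (Suc n # xs) z"
| Mu: "computes p (n # xs) 0 \<Longrightarrow> (\<forall>m<n. \<exists>y. computes p (m # xs) (Suc y))
    \<Longrightarrow> computes (Mu p) xs n"

definition computable :: "(nat \<Rightarrow> nat) \<Rightarrow> bool" where
  "computable g \<longleftrightarrow> (\<exists>p. \<forall>n. computes p [n] (g n))"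

definition computable_rel :: "(nat \<times> nat) set \<Rightarrow> bool" where
  "computable_rel R \<longleftrightarrow> (\<exists>p. \<forall>m n. computes p [m, n] (if (m, n) \<in> R then 1 else 0))"

section \<open>Ordinals\<close>

text \<open>Countable ordinals are represented by (reflexive) well-orders \<open>r :: nat rel\<close> of arbitrary
  sets of natural numbers, and compared up to isomorphism by the library relations
  \<open>=o\<close>, \<open><o\<close>, \<open>\<le>o\<close>. They entail that both sides are well-orders.

  A computable well-order may have any field, so that finite ordinals are order types of
  computable well-orders; by reflexivity its field is computable.
  An ordinal is below the least ordinal which is not the order type of a computable
  well-order iff it and all smaller ordinals are such order types.\<close>

definition computable_ordinal :: "nat rel \<Rightarrow> bool" where
  "computable_ordinal \<alpha> \<longleftrightarrow> Well_order \<alpha> \<and>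
     (\<forall>\<beta> :: nat rel. \<beta> \<le>o \<alpha> \<longrightarrow> (\<exists>R. computable_rel R \<and> R =o \<beta>))"

definition ord_one :: "nat rel" where
  "ord_one = {(0, 0)}"

text \<open>The ordinal sum \<open>1 + \<alpha>\<close>: a new least element is added.\<close>

definition one_plus :: "nat rel \<Rightarrow> nat rel" where
  "one_plus \<alpha> = {(0, 0)} \<union> {(0, Suc y) | y. y \<in> Field \<alpha>} \<union> {(Suc x, Suc y) | x y. (x, y) \<in> \<alpha>}"

section \<open>Effective Borel classes\<close>

text \<open>A space \<open>\<X>\<close> is a type \<open>'a\<close> together with an enumeration \<open>N :: nat \<Rightarrow> 'a set\<close> of its basic
  open sets.\<close>

definition nat_basis :: "nat \<Rightarrow> nat set" where
  "nat_basis s = {s}"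

definition baire_basis :: "nat \<Rightarrow> (nat \<Rightarrow> nat) set" where
  "baire_basis s = {f. \<forall>i < length (list_decode s). f i = list_decode s ! i}"

definition prod_basis :: "(nat \<Rightarrow> 'a set) \<Rightarrow> (nat \<Rightarrow> 'b set) \<Rightarrow> nat \<Rightarrow> ('a \<times> 'b) set" where
  "prod_basis N M s = N (fst (prod_decode s)) \<times> M (snd (prod_decode s))"

definition code_section :: "(nat \<Rightarrow> nat) \<Rightarrow> nat \<Rightarrow> nat \<Rightarrow> nat" where
  "code_section c n m = c (1 + prod_encode (n, m))"

text \<open>\<open>borel_code N \<alpha> c P\<close>: \<open>c\<close> is a Borel code of rank at most \<open>\<alpha>\<close> and codes the set \<open>P\<close>.
  No code has rank at most \<open>0\<close>; hence the ordinals \<open>\<beta>\<close> below are at least \<open>1\<close>, and \<open>\<alpha> > 1\<close> in the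
  last two rules.\<close>

inductive borel_code :: "(nat \<Rightarrow> 'a set) \<Rightarrow> nat rel \<Rightarrow> (nat \<Rightarrow> nat) \<Rightarrow> 'a set \<Rightarrow> bool"
  for N :: "nat \<Rightarrow> 'a set" where
  open_code: "\<alpha> =o ord_one \<Longrightarrow> c 0 = 0
    \<Longrightarrow> borel_code N \<alpha> c (\<Union>{N s | s. \<exists>n. c (n + 1) = s + 1})"
| smaller_rank: "\<beta> <o \<alpha> \<Longrightarrow> borel_code N \<beta> c P \<Longrightarrow> borel_code N \<alpha> c P"
| union_code: "c 0 = 1
    \<Longrightarrow> (\<forall>n. \<exists>\<beta>. \<beta> <o \<alpha> \<and> borel_code N \<beta> (code_section c n) (P n))
    \<Longrightarrow> borel_code N \<alpha> c (\<Union>n. UNIV - P n)"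

definition Sigma0 :: "(nat \<Rightarrow> 'a set) \<Rightarrow> nat rel \<Rightarrow> 'a set \<Rightarrow> bool" where
  "Sigma0 N \<alpha> P \<longleftrightarrow> (\<exists>c. computable c \<and> borel_code N \<alpha> c P)"

definition Pi0 :: "(nat \<Rightarrow> 'a set) \<Rightarrow> nat rel \<Rightarrow> 'a set \<Rightarrow> bool" where
  "Pi0 N \<alpha> P \<longleftrightarrow> Sigma0 N \<alpha> (UNIV - P)"

definition Delta0 :: "(nat \<Rightarrow> 'a set) \<Rightarrow> nat rel \<Rightarrow> 'a set \<Rightarrow> bool" where
  "Delta0 N \<alpha> P \<longleftrightarrow> Sigma0 N \<alpha> P \<and> Pi0 N \<alpha> P"

definition real_section :: "((nat \<Rightarrow> nat) \<times> 'a) set \<Rightarrow> (nat \<Rightarrow> nat) \<Rightarrow> 'a set" where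
  "real_section Q f = {x. (f, x) \<in> Q}"

definition Sigma0_rel :: "(nat \<Rightarrow> 'a set) \<Rightarrow> nat rel \<Rightarrow> (nat \<Rightarrow> nat) \<Rightarrow> 'a set \<Rightarrow> bool" where
  "Sigma0_rel N \<alpha> f P \<longleftrightarrow> (\<exists>Q. Sigma0 (prod_basis baire_basis N) \<alpha> Q \<and> P = real_section Q f)"

definition Pi0_rel :: "(nat \<Rightarrow> 'a set) \<Rightarrow> nat rel \<Rightarrow> (nat \<Rightarrow> nat) \<Rightarrow> 'a set \<Rightarrow> bool" where
  "Pi0_rel N \<alpha> f P \<longleftrightarrow> (\<exists>Q. Pi0 (prod_basis baire_basis N) \<alpha> Q \<and> P = real_section Q f)"

definition Delta0_rel :: "(nat \<Rightarrow> 'a set) \<Rightarrow> nat rel \<Rightarrow> (nat \<Rightarrow> nat) \<Rightarrow> 'a set \<Rightarrow> bool" where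
  "Delta0_rel N \<alpha> f P \<longleftrightarrow> Sigma0_rel N \<alpha> f P \<and> Pi0_rel N \<alpha> f P"

section \<open>Strong relativization and domination\<close>

definition strongly_relativizes_Delta0_at_nat :: "nat rel \<Rightarrow> (nat \<Rightarrow> nat) \<Rightarrow> bool" where
  "strongly_relativizes_Delta0_at_nat \<alpha> f \<longleftrightarrow>
     (\<forall>P. Delta0_rel nat_basis \<alpha> f P \<longrightarrow>
        (\<exists>Q. Delta0 (prod_basis baire_basis nat_basis) \<alpha> Q \<and> P = real_section Q f))"

definition fun_graph :: "(nat \<Rightarrow> nat) \<Rightarrow> (nat \<times> nat) set" where
  "fun_graph g = {(n, g n) | n. True}"

definition Delta0_dominated :: "nat rel \<Rightarrow> (nat \<Rightarrow> nat) \<Rightarrow> bool" where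
  "Delta0_dominated \<alpha> f \<longleftrightarrow>
     (\<forall>g. Delta0_rel (prod_basis nat_basis nat_basis) \<alpha> f (fun_graph g) \<longrightarrow>
        (\<exists>h. Delta0 (prod_basis nat_basis nat_basis) \<alpha> (fun_graph h) \<and> (\<forall>n. g n \<le> h n)))"

end

theory Submission
  imports Defs "HOL-Analysis.Abstract_Topology_2"
begin

text \<open>
  For \<open>\<alpha> = 0\<close> this is the Miller--Martin construction of perfectly many reals of hyperimmune-free degree:
  given a computable perfect tree and a \<open>\<Sigma>\<^sup>0\<^sub>1\<close> set which is meant to be the graph of a function \<open>g\<close>, either
  some node has no extension in the tree deciding some value of \<open>g\<close>, and one passes to the tree above that
  node, or one thins the tree so that every node at level \<open>n + 1\<close> decides \<open>g n\<close>, and the maximum over the finite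
  level bounds \<open>g n\<close>. The same argument works relative to the functions with \<open>\<Delta>\<^sup>0\<close> graph at level \<open>1 + \<alpha>\<close>, which
  are closed under recursion and minimization, as soon as membership of \<open>f\<close> in a set of that level is decided
  by a finite part of \<open>f\<close>, with a decision relation of that level. This holds for
  the branches \<open>f\<close> of a tree all of which are generic for Cohen forcing with respect to all sets of smaller rank,
  because the forcing relation for a code has a code of the same rank. To obtain such a tree the
  sets of smaller rank are enumerated uniformly up to equality of their forcing relations; only here the
  computability of \<open>\<alpha>\<close> is used. Fusion along all \<open>X \<in> 2\<^sup>\<omega>\<close> yields continuum many dominated reals, and a
  dominated real strongly relativizes because searches can be bounded by a function independent of it.
\<close>

section \<open>Pairing and sequence numbers\<close>

text \<open>For \<open>\<alpha> = 0\<close> a finite part of \<open>f\<close> settles each true open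
  statement about \<open>f\<close>; at higher ranks this fails, and the failure shapes the proof. It
  is repaired by branches that decide all computable codes of rank strictly below \<open>x\<close>,
  the ordinal of \<open>one_plus \<alpha>\<close>: the truth lemma for rank \<open>x\<close> needs
  decisions only below \<open>x\<close>. The forcing relation must stay inside the class, since the
  thinned trees have to be functions of the class; this works because \<open>compat\<close>, unlike
  \<open>forces\<close>, obeys the recursion of Borel codes and so keeps ranks. The obstacle lies at
  limits, where the rank of a subcode is not computable from the code; approximations from both
  sides along a computable well-order replace it. Successor steps are free, so only limits up to
  \<open>1 + \<alpha>\<close> need computable presentations, and these are limits up to \<alpha>.
  Fusion is not effective: only each bound \<open>h\<close> must lie in the class, not the sequence
  of trees.\<close>

definition pr :: "nat \<Rightarrow> nat \<Rightarrow> nat" where "pr a b = prod_encode (a, b)"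
definition p1 :: "nat \<Rightarrow> nat" where "p1 z = fst (prod_decode z)"
definition p2 :: "nat \<Rightarrow> nat" where "p2 z = snd (prod_decode z)"

lemma p1_pr [simp]: "p1 (pr a b) = a" and p2_pr [simp]: "p2 (pr a b) = b"
  and pr_p1_p2 [simp]: "pr (p1 z) (p2 z) = z"
  and pr_eq_iff [simp]: "pr a b = pr c d \<longleftrightarrow> a = c \<and> b = d"
  by (auto simp: pr_def p1_def p2_def)

lemma prod_decode_eq_p: "prod_decode z = (p1 z, p2 z)"
  by (simp add: p1_def p2_def)

lemma p2_le: "p2 z \<le> z"
  by (metis le_prod_encode_2 pr_def pr_p1_p2)

lemma p_0 [simp]: "p1 0 = 0" "p2 0 = 0"
  by (simp_all add: p1_def p2_def prod_decode_def prod_decode_aux.simps)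

definition hdc :: "nat \<Rightarrow> nat" where "hdc s = p1 (s - 1)"
definition tlc :: "nat \<Rightarrow> nat" where "tlc s = p2 (s - 1)"
definition cons :: "nat \<Rightarrow> nat \<Rightarrow> nat" where "cons x s = Suc (pr x s)"
definition sl :: "nat \<Rightarrow> nat" where "sl s = length (list_decode s)"
definition sn :: "nat \<Rightarrow> nat \<Rightarrow> nat" where
  "sn s k = (if k < sl s then list_decode s ! k else 0)"

lemma hdc_cons [simp]: "hdc (cons x s) = x" and tlc_cons [simp]: "tlc (cons x s) = s"
  and tlc_0 [simp]: "tlc 0 = 0" and hdc_0 [simp]: "hdc 0 = 0" and cons_neq_0 [simp]: "cons x s \<noteq> 0"
  and cons_eq_iff [simp]: "cons x s = cons y t \<longleftrightarrow> x = y \<and> s = t"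
  by (auto simp: hdc_def tlc_def cons_def)

lemma cons_hdc_tlc: "s \<noteq> 0 \<Longrightarrow> cons (hdc s) (tlc s) = s"
  by (simp add: hdc_def tlc_def cons_def)

lemma list_encode_Cons: "list_encode (x # xs) = cons x (list_encode xs)"
  by (simp add: cons_def pr_def)

lemma list_decode_cons: "list_decode (cons x s) = x # list_decode s"
  by (simp add: cons_def pr_def)

lemma sl_0 [simp]: "sl 0 = 0" and sl_cons [simp]: "sl (cons x s) = Suc (sl s)"
  and sl_list_encode [simp]: "sl (list_encode l) = length l"
  by (auto simp: sl_def list_decode_cons)

lemma sn_list_encode: "k < length l \<Longrightarrow> sn (list_encode l) k = l ! k"
  by (simp add: sn_def)

lemma sn_cons_0 [simp]: "sn (cons x s) 0 = x" and sn_cons_Suc [simp]: "sn (cons x s) (Suc k) = sn s k"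
  and sn_0 [simp]: "sn 0 k = 0"
  by (auto simp: sn_def list_decode_cons)

lemma sl_eq_0_iff: "sl s = 0 \<longleftrightarrow> s = 0"
  by (metis cons_hdc_tlc nat.simps(3) sl_0 sl_cons)

text \<open>Iterating \<open>tlc\<close> ends in 0, and \<open>hdc 0 = 0\<close> agrees with the
  default value of \<open>sn\<close>; this form puts \<open>sn\<close> into every
  \<open>fclass\<close>.\<close>

lemma sn_eq_funpow: "sn s k = hdc ((tlc ^^ k) s)"
proof (induction k arbitrary: s)
  case 0
  show ?case by (cases "s = 0") (metis cons_hdc_tlc funpow_0 sn_cons_0 hdc_0 sn_0)+
next
  case (Suc k)
  show ?case
  proof (cases "s = 0")
    case True then show ?thesis using Suc[of 0] by (simp add: funpow_swap1)
  next
    case False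
    then obtain x t where "s = cons x t" by (metis cons_hdc_tlc)
    then show ?thesis using Suc[of t] by (simp add: funpow_swap1)
  qed
qed

lemma funpow_tlc_eq_0_iff: "(tlc ^^ n) s = 0 \<longleftrightarrow> sl s \<le> n"
proof (induction n arbitrary: s)
  case 0 show ?case by (simp add: sl_eq_0_iff)
next
  case (Suc n)
  show ?case
  proof (cases "s = 0")
    case True then show ?thesis using Suc[of 0] by (simp add: funpow_swap1)
  next
    case False
    then obtain x t where "s = cons x t" by (metis cons_hdc_tlc)
    then show ?thesis using Suc[of t] by (simp add: funpow_swap1)
  qed
qed

lemma sl_eq_Least: "sl s = (LEAST n. (tlc ^^ n) s = 0)"
  unfolding funpow_tlc_eq_0_iff by (rule Least_equality[symmetric]) auto

lemma ex_seq: "\<exists>s. sl s = n \<and> (\<forall>i<n. sn s i = g i)"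
  by (rule exI[of _ "list_encode (map g [0..<n])"]) (simp add: sn_list_encode)

lemma seq_eqI: "sl s = sl t \<Longrightarrow> (\<And>k. k < sl s \<Longrightarrow> sn s k = sn t k) \<Longrightarrow> s = t"
  by (metis list_decode_eq nth_equalityI sl_def sn_def)

section \<open>Classes of functions closed under primitive recursion and minimization\<close>

named_theorems cintro

text \<open>Only unary functions are axiomatized, with several arguments packed by
  \<open>pr\<close>, so that one set of rules, run as \<open>intro cintro\<close>, serves both the
  computable functions and, later, the functions whose graph lies in a given class.\<close>

locale fclass =
  fixes C :: "(nat \<Rightarrow> nat) \<Rightarrow> bool"
  assumes C_id [cintro]: "C (\<lambda>x. x)"
    and C_zero: "C (\<lambda>_. 0)"
    and C_Suc [cintro]: "C a \<Longrightarrow> C (\<lambda>x. Suc (a x))"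
    and C_pr [cintro]: "C a \<Longrightarrow> C b \<Longrightarrow> C (\<lambda>x. pr (a x) (b x))"
    and C_p1 [cintro]: "C a \<Longrightarrow> C (\<lambda>x. p1 (a x))"
    and C_p2 [cintro]: "C a \<Longrightarrow> C (\<lambda>x. p2 (a x))"
    and C_comp: "C a \<Longrightarrow> C b \<Longrightarrow> C (\<lambda>x. a (b x))"
    and C_rec0: "C b \<Longrightarrow> C s \<Longrightarrow>
      C (\<lambda>z. rec_nat (b (p2 z)) (\<lambda>k r. s (pr k (pr r (p2 z)))) (p1 z))"
    and C_mu0: "C g \<Longrightarrow> (\<And>x. \<exists>n. g (pr n x) = 0) \<Longrightarrow> C (\<lambda>x. LEAST n. g (pr n x) = 0)"
begin

definition dec :: "(nat \<Rightarrow> bool) \<Rightarrow> bool" where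
  "dec P \<longleftrightarrow> C (\<lambda>x. of_bool (P x))"

definition C2 :: "(nat \<Rightarrow> nat \<Rightarrow> nat) \<Rightarrow> bool" where
  "C2 g \<longleftrightarrow> C (\<lambda>z. g (p1 z) (p2 z))"

lemma C_app2: "C (\<lambda>z. g (p1 z) (p2 z)) \<Longrightarrow> C a \<Longrightarrow> C b \<Longrightarrow> C (\<lambda>x. g (a x) (b x))"
  using C_comp[OF _ C_pr, of "\<lambda>z. g (p1 z) (p2 z)" a b] by simp

lemma C2_app: "C2 g \<Longrightarrow> C a \<Longrightarrow> C b \<Longrightarrow> C (\<lambda>x. g (a x) (b x))"
  unfolding C2_def by (rule C_app2)

lemma C_const [cintro]: "C (\<lambda>_. k)"
  by (induction k) (auto intro: C_zero C_Suc)

lemma C_rec [cintro]: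
  assumes "C n" "C b" "C (\<lambda>z. s (p1 z) (p1 (p2 z)) (p2 (p2 z)))"
  shows "C (\<lambda>x. rec_nat (b x) (\<lambda>k r. s k r x) (n x))"
  using C_comp[OF C_rec0[OF assms(2,3)] C_pr[OF assms(1) C_id]] by simp

lemma C_add [cintro]: assumes "C a" "C b" shows "C (\<lambda>x. a x + b x)"
proof -
  have "m + n = rec_nat n (\<lambda>k r. Suc r) m" for m n :: nat by (induction m) auto
  then show ?thesis by (simp only:) (intro cintro assms)
qed

lemma C_pred: assumes "C a" shows "C (\<lambda>x. a x - 1)"
proof -
  have "m - 1 = rec_nat 0 (\<lambda>k r. k) m" for m :: nat by (cases m) auto
  then show ?thesis by (simp only:) (intro cintro assms)
qed

lemma C_diff [cintro]: assumes "C a" "C b" shows "C (\<lambda>x. a x - b x)"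
proof -
  have *: "m - n = rec_nat m (\<lambda>k r. r - 1) n" for m n :: nat by (induction n) auto
  have "(\<lambda>x. a x - b x) = (\<lambda>x. rec_nat (a x) (\<lambda>k r. r - 1) (b x))"
    by (rule HOL.ext) (rule *)
  moreover have "C (\<lambda>x. rec_nat (a x) (\<lambda>k r. r - 1) (b x))" by (intro cintro assms C_pred)
  ultimately show ?thesis by simp
qed

lemma C_mult [cintro]: assumes "C a" "C b" shows "C (\<lambda>x. a x * b x)"
proof -
  have *: "m * n = rec_nat 0 (\<lambda>k r. n + r) m" for m n :: nat by (induction m) auto
  show ?thesis unfolding * by (intro cintro assms C_comp[OF assms(2)])
qed

lemma C_pow2 [cintro]: assumes "C a" shows "C (\<lambda>x. 2 ^ a x)"
proof -
  have *: "2 ^ m = rec_nat 1 (\<lambda>k r. 2 * r) m" for m by (induction m) auto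
  show ?thesis unfolding * by (intro cintro assms)
qed

lemma C_funpow:
  assumes "C (\<lambda>z. h (p1 z) (p2 z))" "C n" "C a"
  shows "C (\<lambda>x. (h x ^^ n x) (a x))"
proof -
  have *: "(g ^^ m) y = rec_nat y (\<lambda>k r. g r) m" for g :: "nat \<Rightarrow> nat" and m y
    by (induction m) auto
  have "C (\<lambda>z. h (p2 (p2 z)) (p1 (p2 z)))"
    by (intro C_app2[where g = h, OF assms(1)] cintro)
  then show ?thesis unfolding * by (intro C_rec assms)
qed

lemma C_of_bool [cintro]: "dec P \<Longrightarrow> C (\<lambda>x. of_bool (P x))"
  by (simp add: dec_def)

lemma dec_eq [cintro]: assumes "C a" "C b" shows "dec (\<lambda>x. a x = b x)"
proof -
  have "of_bool (m = n) = 1 - ((m - n) + (n - m))" for m n :: nat by auto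
  then show ?thesis unfolding dec_def by (simp only:) (intro cintro assms)
qed

lemma dec_le [cintro]: assumes "C a" "C b" shows "dec (\<lambda>x. a x \<le> b x)"
proof -
  have "of_bool (m \<le> n) = 1 - (m - n)" for m n :: nat by auto
  then show ?thesis unfolding dec_def by (simp only:) (intro cintro assms)
qed

lemma dec_less [cintro]: assumes "C a" "C b" shows "dec (\<lambda>x. a x < b x)"
  unfolding less_eq_Suc_le by (intro cintro assms)

lemma dec_not [cintro]: assumes "dec P" shows "dec (\<lambda>x. \<not> P x)"
proof -
  have "of_bool (\<not> p) = 1 - (of_bool p :: nat)" for p by auto
  then show ?thesis unfolding dec_def by (simp only:) (intro cintro assms)
qed

lemma dec_conj [cintro]: assumes "dec P" "dec Q" shows "dec (\<lambda>x. P x \<and> Q x)"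
proof -
  have "of_bool (p \<and> q) = (of_bool p * of_bool q :: nat)" for p q by auto
  then show ?thesis unfolding dec_def by (simp only:) (intro cintro assms)
qed

lemma dec_disj [cintro]: assumes "dec P" "dec Q" shows "dec (\<lambda>x. P x \<or> Q x)"
proof -
  have "(p \<or> q) = (\<not> (\<not> p \<and> \<not> q))" for p q by auto
  then show ?thesis by (simp only:) (intro cintro assms)
qed

lemma dec_comp: assumes "dec P" "C b" shows "dec (\<lambda>x. P (b x))"
  using C_comp[of "\<lambda>x. of_bool (P x)" b] assms by (simp add: dec_def)

lemma dec_app2:
  "dec (\<lambda>z. P (p1 z) (p2 z)) \<Longrightarrow> C a \<Longrightarrow> C b \<Longrightarrow> dec (\<lambda>x. P (a x) (b x))"
  using dec_comp[OF _ C_pr, of "\<lambda>z. P (p1 z) (p2 z)" a b] by simp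

lemma dec_const [cintro]: "dec (\<lambda>_. p)"
  unfolding dec_def by (rule C_const)

lemma dec_all [cintro]:
  assumes "C b" "dec (\<lambda>z. P (p1 z) (p2 z))"
  shows "dec (\<lambda>x. \<forall>i<b x. P i x)"
proof -
  have *: "of_bool (\<forall>i<n. Q i) = rec_nat (1::nat) (\<lambda>k r. r * of_bool (Q k)) n" for n Q
  proof (induction n)
    case (Suc n)
    have "of_bool (\<forall>i<Suc n. Q i) = of_bool (\<forall>i<n. Q i) * (of_bool (Q n) :: nat)"
      by (auto simp: less_Suc_eq)
    then show ?case using Suc by simp
  qed simp
  show ?thesis unfolding dec_def *
    by (intro cintro assms(1) dec_app2[where P = P, OF assms(2)])
qed

lemma dec_ex [cintro]:
  assumes "C b" "dec (\<lambda>z. P (p1 z) (p2 z))"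
  shows "dec (\<lambda>x. \<exists>i<b x. P i x)"
proof -
  have *: "(\<exists>i<b x. P i x) = (\<not> (\<forall>i<b x. \<not> P i x))" for x by blast
  show ?thesis unfolding * by (intro cintro assms)
qed

lemma C_if [cintro]: assumes "dec P" "C a" "C b" shows "C (\<lambda>x. if P x then a x else b x)"
proof -
  have *: "(if P x then a x else b x) = of_bool (P x) * a x + of_bool (\<not> P x) * b x" for x by auto
  show ?thesis unfolding * by (intro cintro assms)
qed

lemma C_Least:
  assumes "dec (\<lambda>z. P (p1 z) (p2 z))" "\<And>x. \<exists>n. P n x"
  shows "C (\<lambda>x. LEAST n. P n x)"
proof -
  have "C (\<lambda>z. of_bool (\<not> P (p1 z) (p2 z)))" by (intro cintro assms)
  from C_mu0[OF this] assms(2) show ?thesis by simp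
qed

lemma C_div2 [cintro]: assumes "C a" shows "C (\<lambda>x. a x div 2)"
proof -
  have "m div 2 = (LEAST n. m < 2 * Suc n)" for m :: nat
    by (rule Least_equality[symmetric]) auto
  moreover have "\<exists>n. m < 2 * Suc n" for m :: nat by (rule exI[of _ m]) auto
  ultimately show ?thesis
    by (simp only:) (rule C_Least; (intro cintro C_comp[OF assms])?; simp)
qed

lemma dec_even [cintro]: assumes "C a" shows "dec (\<lambda>x. even (a x))"
proof -
  have *: "even m \<longleftrightarrow> 2 * (m div 2) = m" for m :: nat by presburger
  show ?thesis unfolding * by (intro cintro assms)
qed

lemma C_hdc [cintro]: assumes "C a" shows "C (\<lambda>x. hdc (a x))"
  unfolding hdc_def by (intro cintro assms)

lemma C_tlc [cintro]: assumes "C a" shows "C (\<lambda>x. tlc (a x))"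
  unfolding tlc_def by (intro cintro assms)

lemma C_cons [cintro]: assumes "C a" "C b" shows "C (\<lambda>x. cons (a x) (b x))"
  unfolding cons_def by (intro cintro assms)

lemma C_sn [cintro]: assumes "C a" "C b" shows "C (\<lambda>x. sn (a x) (b x))"
  unfolding sn_eq_funpow by (intro cintro C_funpow assms)

lemma C_sl [cintro]: assumes "C a" shows "C (\<lambda>x. sl (a x))"
proof -
  have "C sl" unfolding sl_eq_Least
    by (rule C_Least; (intro cintro C_funpow)?) (auto simp: funpow_tlc_eq_0_iff)
  from C_comp[OF this assms] show ?thesis .
qed

text \<open>Course-of-values recursion. The table \<open>tab m\<close> lists
  \<open>h m, ..., h 0\<close>, newest first, so \<open>h (m div 2)\<close> sits at position
  \<open>m - m div 2\<close>. In a binary tree numbered in level order, \<open>Suc m\<close> has the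
  parent \<open>m div 2\<close>.\<close>

lemma C_half_rec:
  assumes g: "C2 g" and h0: "h 0 = b" and hS: "\<And>m. h (Suc m) = g m (h (m div 2))"
  shows "C h"
proof -
  define tab where "tab = rec_nat (cons b 0) (\<lambda>m r. cons (g m (sn r (m - m div 2))) r)"
  have tab: "k \<le> m \<Longrightarrow> sn (tab m) (m - k) = h k" for k m
  proof (induction m arbitrary: k)
    case 0 then show ?case by (simp add: tab_def h0)
  next
    case (Suc m)
    have *: "tab (Suc m) = cons (h (Suc m)) (tab m)"
      using Suc.IH[of "m div 2"] by (simp add: tab_def hS)
    show ?case
    proof (cases "k = Suc m")
      case False
      then have "k \<le> m" using Suc.prems by simp
      then show ?thesis using Suc.IH[of k] by (simp add: * Suc_diff_le)
    qed (simp add: *)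
  qed
  have "C (\<lambda>m. sn (tab m) 0)"
    unfolding tab_def by (intro cintro C2_app[OF g])
  then show ?thesis using tab[of m m for m] by simp
qed

end

section \<open>Extension and incompatibility of sequence numbers\<close>

definition ext :: "nat \<Rightarrow> nat \<Rightarrow> bool" where
  "ext q p \<longleftrightarrow> sl p \<le> sl q \<and> (\<forall>k<sl p. sn q k = sn p k)"

definition inc :: "nat \<Rightarrow> nat \<Rightarrow> bool" where
  "inc p q \<longleftrightarrow> (\<exists>k<sl p. k < sl q \<and> sn p k \<noteq> sn q k)"

definition pfx :: "nat \<Rightarrow> (nat \<Rightarrow> nat) \<Rightarrow> bool" where
  "pfx p f \<longleftrightarrow> (\<forall>k<sl p. f k = sn p k)"

lemma baire_basis_iff: "f \<in> baire_basis p \<longleftrightarrow> pfx p f"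
  by (simp add: baire_basis_def pfx_def sl_def sn_def)

lemma (in fclass) dec_ext [cintro]:
  assumes "C a" "C b" shows "dec (\<lambda>x. ext (a x) (b x))"
  unfolding ext_def by (intro cintro assms C_comp[OF assms(1)] C_comp[OF assms(2)])

lemma (in fclass) dec_inc [cintro]:
  assumes "C a" "C b" shows "dec (\<lambda>x. inc (a x) (b x))"
  unfolding inc_def by (intro cintro assms C_comp[OF assms(1)] C_comp[OF assms(2)])

lemma ext_refl [simp]: "ext p p" by (simp add: ext_def)
lemma ext_trans: "ext r q \<Longrightarrow> ext q p \<Longrightarrow> ext r p" by (auto simp: ext_def)
lemma ext_0 [simp]: "ext p 0" by (simp add: ext_def)
lemma pfx_0 [simp]: "pfx 0 f" by (simp add: pfx_def)
lemma pfx_ext: "pfx q f \<Longrightarrow> ext q p \<Longrightarrow> pfx p f" by (auto simp: ext_def pfx_def)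
lemma inc_sym: "inc p q \<Longrightarrow> inc q p" by (auto simp: inc_def)
lemma inc_ext: "inc p q \<Longrightarrow> ext p' p \<Longrightarrow> ext q' q \<Longrightarrow> inc p' q'"
  unfolding inc_def ext_def by (metis order_less_le_trans)
lemma not_inc_pfx: "pfx p f \<Longrightarrow> pfx q f \<Longrightarrow> \<not> inc p q" by (auto simp: inc_def pfx_def)
lemma pfx_pfx_ext: "pfx p f \<Longrightarrow> pfx q f \<Longrightarrow> sl p \<le> sl q \<Longrightarrow> ext q p" by (auto simp: ext_def pfx_def)
lemma pfx_pfx_cases: "pfx p f \<Longrightarrow> pfx q f \<Longrightarrow> ext q p \<or> ext p q"
  using pfx_pfx_ext nat_le_linear by blast

lemma ex_pfx: "\<exists>p. pfx p f \<and> sl p = n"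
  using ex_seq[of n f] by (metis pfx_def)

text \<open>A disagreement shows on a finite part, so basic open sets have open complements with
  decidable enumerations.\<close>

lemma not_pfx_iff: "\<not> pfx s f \<longleftrightarrow> (\<exists>u. inc u s \<and> pfx u f)"
proof
  assume "\<not> pfx s f"
  then obtain k where k: "k < sl s" "f k \<noteq> sn s k" by (auto simp: pfx_def)
  obtain u where "sl u = Suc k" "\<forall>i<Suc k. sn u i = f i" using ex_seq by blast
  with k have "inc u s \<and> pfx u f" by (auto simp: inc_def pfx_def)
  then show "\<exists>u. inc u s \<and> pfx u f" ..
qed (use not_inc_pfx in blast)

lemma ex_ext_inc: assumes "\<not> ext p s" shows "\<exists>q. ext q p \<and> inc q s"
proof (cases "inc p s")
  case False
  with assms have lt: "sl p < sl s" by (auto simp: ext_def inc_def)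
  \<comment> \<open>One more entry, the successor of what \<open>s\<close> has there, already
    contradicts \<open>s\<close>.\<close>
  obtain q where q: "sl q = Suc (sl p)" "\<forall>i<Suc (sl p). sn q i = (if i < sl p then sn p i else Suc (sn s i))"
    using ex_seq[of "Suc (sl p)" "\<lambda>i. if i < sl p then sn p i else Suc (sn s i)"] by auto
  have "ext q p" using q by (simp add: ext_def)
  moreover have "inc q s" unfolding inc_def by (rule exI[of _ "sl p"]) (simp add: q lt)
  ultimately have "ext q p \<and> inc q s" ..
  then show ?thesis ..
next
  case True
  then show ?thesis using ext_refl by blast
qed

lemma ex_inc_exts: "\<exists>q r. ext q p \<and> ext r p \<and> inc q r"
proof -
  obtain q where q: "sl q = Suc (sl p)" "\<forall>i<Suc (sl p). sn q i = (if i < sl p then sn p i else 0)"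
    using ex_seq[of "Suc (sl p)" "\<lambda>i. if i < sl p then sn p i else 0"] by auto
  obtain r where r: "sl r = Suc (sl p)" "\<forall>i<Suc (sl p). sn r i = (if i < sl p then sn p i else 1)"
    using ex_seq[of "Suc (sl p)" "\<lambda>i. if i < sl p then sn p i else 1"] by auto
  have "ext q p" "ext r p" using q r by (simp_all add: ext_def)
  moreover have "inc q r" unfolding inc_def by (rule exI[of _ "sl p"]) (simp add: q r)
  ultimately show ?thesis by blast
qed

section \<open>The computable functions form such a class\<close>

definition rc :: "nat \<Rightarrow> (nat list \<Rightarrow> nat) \<Rightarrow> bool" where
  "rc k F \<longleftrightarrow> (\<exists>p. \<forall>xs. length xs = k \<longrightarrow> computes p xs (F xs))"

lemma rc_proj: "i < k \<Longrightarrow> rc k (\<lambda>xs. xs ! i)"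
  unfolding rc_def by (rule exI[of _ "Proj i"]) (auto intro: computes.intros)

lemma rc_zero: "rc k (\<lambda>xs. 0)"
  unfolding rc_def by (rule exI[of _ "Zero"]) (auto intro: computes.intros)

lemma rc_comp1: "rc 1 (\<lambda>xs. f (xs ! 0)) \<Longrightarrow> rc k a \<Longrightarrow> rc k (\<lambda>xs. f (a xs))"
proof -
  assume "rc 1 (\<lambda>xs. f (xs ! 0))" "rc k a"
  then obtain p q where p: "\<And>xs. length xs = 1 \<Longrightarrow> computes p xs (f (xs ! 0))"
    and q: "\<And>xs. length xs = k \<Longrightarrow> computes q xs (a xs)"
    by (auto simp: rc_def)
  have "computes (Comp p [q]) xs (f (a xs))" if "length xs = k" for xs
    by (rule computes.Comp[of _ _ "[a xs]"]) (use q[OF that] p[of "[a xs]"] in auto)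
  then show ?thesis unfolding rc_def by blast
qed

lemma rc_comp2: "rc 2 (\<lambda>xs. f (xs ! 0) (xs ! 1)) \<Longrightarrow> rc k a \<Longrightarrow> rc k b \<Longrightarrow> rc k (\<lambda>xs. f (a xs) (b xs))"
proof -
  assume "rc 2 (\<lambda>xs. f (xs ! 0) (xs ! 1))" "rc k a" "rc k b"
  then obtain p q r where p: "\<And>xs. length xs = 2 \<Longrightarrow> computes p xs (f (xs ! 0) (xs ! 1))"
    and q: "\<And>xs. length xs = k \<Longrightarrow> computes q xs (a xs)"
    and r: "\<And>xs. length xs = k \<Longrightarrow> computes r xs (b xs)"
    by (auto simp: rc_def)
  have "computes (Comp p [q, r]) xs (f (a xs) (b xs))" if "length xs = k" for xs
    by (rule computes.Comp[of _ _ "[a xs, b xs]"]) (use q[OF that] r[OF that] p[of "[a xs, b xs]"] in auto)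
  then show ?thesis unfolding rc_def by blast
qed

lemma rc_Suc: "rc k a \<Longrightarrow> rc k (\<lambda>xs. Suc (a xs))"
proof (rule rc_comp1[of Suc])
  have "computes Succ xs (Suc (xs ! 0))" if "length xs = 1" for xs
    using that by (cases xs) (auto intro: computes.intros)
  then show "rc 1 (\<lambda>xs. Suc (xs ! 0))" unfolding rc_def by blast
qed

lemma rc_rec:
  assumes "rc 1 (\<lambda>xs. b (xs ! 0))" "rc 3 (\<lambda>xs. s (xs ! 0) (xs ! 1) (xs ! 2))" "rc k n" "rc k a"
  shows "rc k (\<lambda>xs. rec_nat (b (a xs)) (\<lambda>i r. s i r (a xs)) (n xs))"
proof (rule rc_comp2[of "\<lambda>m x. rec_nat (b x) (\<lambda>i r. s i r x) m", OF _ assms(3,4)])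
  obtain p q where p: "\<And>xs. length xs = 1 \<Longrightarrow> computes p xs (b (xs ! 0))"
    and q: "\<And>xs. length xs = 3 \<Longrightarrow> computes q xs (s (xs ! 0) (xs ! 1) (xs ! 2))"
    using assms(1,2) by (auto simp: rc_def)
  have *: "computes (PRec p q) [m, x] (rec_nat (b x) (\<lambda>i r. s i r x) m)" for m x
  proof (induction m)
    case 0 show ?case using p[of "[x]"] by (auto intro: computes.intros)
  next
    case (Suc m)
    show ?case using computes.PRec_Suc[OF Suc, of "s m (rec_nat (b x) (\<lambda>i r. s i r x) m) x"]
      q[of "[m, rec_nat (b x) (\<lambda>i r. s i r x) m, x]"] by (simp add: numeral_2_eq_2)
  qed
  have "computes (PRec p q) xs (rec_nat (b (xs ! 1)) (\<lambda>i r. s i r (xs ! 1)) (xs ! 0))"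
    if "length xs = 2" for xs
  proof -
    from that obtain m x where "xs = [m, x]" by (auto simp: length_Suc_conv numeral_2_eq_2)
    then show ?thesis using * by simp
  qed
  then show "rc 2 (\<lambda>xs. rec_nat (b (xs ! 1)) (\<lambda>i r. s i r (xs ! 1)) (xs ! 0))"
    unfolding rc_def by blast
qed

lemma rc_mu:
  assumes "rc 2 (\<lambda>xs. g (xs ! 0) (xs ! 1))" "\<And>x. \<exists>n. g n x = 0"
  shows "rc 1 (\<lambda>xs. LEAST n. g n (xs ! 0) = 0)"
proof -
  obtain p where p: "\<And>xs. length xs = 2 \<Longrightarrow> computes p xs (g (xs ! 0) (xs ! 1))"
    using assms(1) by (auto simp: rc_def)
  have *: "computes (Mu p) [x] (LEAST n. g n x = 0)" for x
  proof (rule computes.Mu)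
    show "computes p [LEAST n. g n x = 0, x] 0"
      using p[of "[LEAST n. g n x = 0, x]"] LeastI_ex[OF assms(2)[of x]] by simp
    show "\<forall>m<LEAST n. g n x = 0. \<exists>y. computes p [m, x] (Suc y)"
    proof safe
      fix m assume "m < (LEAST n. g n x = 0)"
      then have "g m x \<noteq> 0" by (rule not_less_Least)
      then show "\<exists>y. computes p [m, x] (Suc y)" using p[of "[m, x]"] by (cases "g m x") auto
    qed
  qed
  have "computes (Mu p) xs (LEAST n. g n (xs ! 0) = 0)" if "length xs = 1" for xs
    using *[of "xs ! 0"] that by (cases xs) auto
  then show ?thesis unfolding rc_def by blast
qed

lemma computable_iff_rc: "computable f \<longleftrightarrow> rc 1 (\<lambda>xs. f (xs ! 0))"
  unfolding computable_def rc_def by (rule ex_cong1) (auto simp: length_Suc_conv)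

section \<open>Arithmetic and the inverse of pairing among the recursive functions\<close>

lemma rc_add: assumes "rc k a" "rc k b" shows "rc k (\<lambda>xs. a xs + b xs)"
proof -
  have *: "m + n = rec_nat n (\<lambda>i r. Suc r) m" for m n :: nat by (induction m) auto
  show ?thesis unfolding * by (rule rc_rec[of "\<lambda>x. x" "\<lambda>i r x. Suc r"]) (intro rc_proj rc_Suc assms; simp)+
qed

lemma rc_diff: assumes "rc k a" "rc k b" shows "rc k (\<lambda>xs. a xs - b xs)"
proof -
  have 1: "m - 1 = rec_nat 0 (\<lambda>i r. i) m" for m :: nat by (cases m) auto
  have pred: "rc k a \<Longrightarrow> rc k (\<lambda>xs. a xs - 1)" for k a
    unfolding 1 by (rule rc_rec[of "\<lambda>x. 0" "\<lambda>i r x. i"]) (auto intro!: rc_proj rc_zero)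
  have 2: "m - n = rec_nat m (\<lambda>i r. r - 1) n" for m n :: nat by (induction n) auto
  have "(\<lambda>xs. a xs - b xs) = (\<lambda>xs. rec_nat (a xs) (\<lambda>i r. r - 1) (b xs))"
    by (rule HOL.ext) (rule 2)
  moreover have "rc k (\<lambda>xs. rec_nat (a xs) (\<lambda>i r. r - 1) (b xs))"
    by (rule rc_rec[of "\<lambda>x. x" "\<lambda>i r x. r - 1"]) (intro rc_proj pred assms; simp)+
  ultimately show ?thesis by simp
qed

lemma rc_triangle: assumes "rc k a" shows "rc k (\<lambda>xs. triangle (a xs))"
proof -
  have *: "triangle m = rec_nat 0 (\<lambda>i r. r + Suc i) m" for m :: nat by (induction m) auto
  show ?thesis unfolding *
    by (rule rc_rec[of "\<lambda>x. 0" "\<lambda>i r x. r + Suc i", OF _ _ assms assms])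
      (intro rc_proj rc_zero rc_add rc_Suc; simp)+
qed

lemma rc_pr: assumes "rc k a" "rc k b" shows "rc k (\<lambda>xs. pr (a xs) (b xs))"
  unfolding pr_def prod_encode_def split by (rule rc_add[OF rc_triangle[OF rc_add[OF assms]] assms(1)])

text \<open>Inverting Cantor pairing: for \<open>z = pr a b\<close>, \<open>w z\<close> is the
  diagonal \<open>a + b\<close>, the first \<open>w\<close> with
  \<open>z < triangle (Suc w)\<close>. The truncated difference expresses this inequality as a zero,
  which is what minimization looks for.\<close>

lemma p_triangle:
  defines "w z \<equiv> (LEAST w. Suc z - triangle (Suc w) = 0)"
  shows "p1 z = z - triangle (w z)" "p2 z = w z - p1 z"
proof -
  obtain a b where z: "z = pr a b" by (metis pr_p1_p2)
  have mono: "triangle m \<le> triangle n" if "m \<le> n" for m n using that by (induction n) (auto simp: le_Suc_eq)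
  have eq: "z = triangle (a + b) + a" by (simp add: z pr_def prod_encode_def)
  have "w z = a + b" unfolding w_def
  proof (rule Least_equality)
    show "Suc z - triangle (Suc (a + b)) = 0" using eq by simp
    fix v assume v: "Suc z - triangle (Suc v) = 0"
    show "a + b \<le> v"
    proof (rule ccontr)
      assume "\<not> a + b \<le> v"
      then have "triangle (Suc v) \<le> triangle (a + b)" by (intro mono) simp
      then show False using v eq by linarith
    qed
  qed
  moreover have "p1 z = a" "p2 z = b" by (simp_all add: z)
  ultimately show "p1 z = z - triangle (w z)" "p2 z = w z - p1 z" using eq by auto
qed

lemma ex_triangle_gt: "\<exists>w. Suc z - triangle (Suc w) = 0"
proof -
  have "n \<le> triangle n" for n by (induction n) auto
  from this[of "Suc z"] show ?thesis by (intro exI[of _ z]) simp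
qed

lemma rc_p1: "rc k a \<Longrightarrow> rc k (\<lambda>xs. p1 (a xs))" and rc_p2: "rc k a \<Longrightarrow> rc k (\<lambda>xs. p2 (a xs))"
proof -
  have w: "rc 1 (\<lambda>xs. LEAST w. Suc (xs ! 0) - triangle (Suc w) = 0)"
    by (rule rc_mu[of "\<lambda>w z. Suc z - triangle (Suc w)"])
      (intro rc_proj rc_diff rc_triangle rc_Suc ex_triangle_gt; simp)+
  have 1: "rc 1 (\<lambda>xs. p1 (xs ! 0))" unfolding p_triangle(1)
    by (intro rc_diff rc_triangle w rc_proj) simp
  have 2: "rc 1 (\<lambda>xs. p2 (xs ! 0))" unfolding p_triangle(2)
    by (intro rc_diff w 1)
  show "rc k a \<Longrightarrow> rc k (\<lambda>xs. p1 (a xs))" "rc k a \<Longrightarrow> rc k (\<lambda>xs. p2 (a xs))"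
    using rc_comp1[OF 1] rc_comp1[OF 2] by auto
qed

lemma rc_computable: "computable f \<Longrightarrow> rc k a \<Longrightarrow> rc k (\<lambda>xs. f (a xs))"
  unfolding computable_iff_rc by (rule rc_comp1)

interpretation cmp: fclass computable
proof
  show "computable (\<lambda>x. x)" "computable (\<lambda>_. 0)"
    unfolding computable_iff_rc by (rule rc_proj rc_zero; simp)+
next
  fix a assume a: "computable a"
  note * = a[unfolded computable_iff_rc]
  show "computable (\<lambda>x. Suc (a x))" "computable (\<lambda>x. p1 (a x))" "computable (\<lambda>x. p2 (a x))"
    unfolding computable_iff_rc by (rule rc_Suc[OF *] rc_p1[OF *] rc_p2[OF *])+
  fix b assume b: "computable b"
  note ** = b[unfolded computable_iff_rc]
  show "computable (\<lambda>x. pr (a x) (b x))" "computable (\<lambda>x. a (b x))"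
    unfolding computable_iff_rc by (rule rc_pr[OF * **] rc_computable[OF a **])+
next
  fix b s :: "nat \<Rightarrow> nat"
  assume b: "computable b" and s: "computable s"
  have "rc 1 (\<lambda>xs. rec_nat (b (p2 (xs ! 0))) (\<lambda>k r. s (pr k (pr r (p2 (xs ! 0))))) (p1 (xs ! 0)))"
    by (rule rc_rec[of b "\<lambda>k r x. s (pr k (pr r x))"])
      (rule rc_p1 rc_p2 rc_proj rc_computable[OF s] rc_computable[OF b] rc_pr; simp?)+
  then show "computable (\<lambda>z. rec_nat (b (p2 z)) (\<lambda>k r. s (pr k (pr r (p2 z)))) (p1 z))"
    by (simp only: computable_iff_rc)
next
  fix g :: "nat \<Rightarrow> nat"
  assume g: "computable g" and ex: "\<And>x. \<exists>n. g (pr n x) = 0"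
  have "rc 2 (\<lambda>xs. g (pr (xs ! 0) (xs ! 1)))"
    by (rule rc_computable[OF g] rc_pr rc_proj; simp?)+
  from rc_mu[OF this ex] show "computable (\<lambda>x. LEAST n. g (pr n x) = 0)"
    by (simp only: computable_iff_rc)
qed

section \<open>A universal decidable predicate\<close>

declare list_encode.simps(2) [simp del]

primrec enc :: "recf \<Rightarrow> nat" where
  "enc Zero = pr 0 0"
| "enc Succ = pr 1 0"
| "enc (Proj i) = pr 2 i"
| "enc (Comp p qs) = pr 3 (pr (enc p) (list_encode (map enc qs)))"
| "enc (PRec p q) = pr 4 (pr (enc p) (enc q))"
| "enc (Mu p) = pr 5 (enc p)"

definition ent :: "nat \<Rightarrow> nat \<Rightarrow> nat \<Rightarrow> nat" where "ent e xs y = pr e (pr xs y)"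

text \<open>\<open>justified E z\<close>: the entry \<open>z\<close>, claiming a value of a program at an argument tuple, follows by
  one computation rule from entries in \<open>E\<close>. Circular justifications are harmless: an entry of a
  self-justified set never contradicts a terminating computation.\<close>

definition justified :: "nat set \<Rightarrow> nat \<Rightarrow> bool" where
  "justified E z \<longleftrightarrow>
    (let e = p1 z; xs = p1 (p2 z); y = p2 (p2 z); b = p2 e in
      (p1 e = 0 \<and> y = 0) \<or>
      (p1 e = 1 \<and> y = Suc (hdc xs)) \<or>
      (p1 e = 2 \<and> y = sn xs b) \<or>
      (p1 e = 3 \<and> (\<exists>v. ent (p1 b) v y \<in> E \<and> sl v = sl (p2 b) \<and>
        (\<forall>k<sl (p2 b). ent (sn (p2 b) k) xs (sn v k) \<in> E))) \<or>
      (p1 e = 4 \<and> ((hdc xs = 0 \<and> ent (p1 b) (tlc xs) y \<in> E) \<or>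
        (hdc xs \<noteq> 0 \<and> (\<exists>v. ent e (cons (hdc xs - 1) (tlc xs)) v \<in> E \<and>
          ent (p2 b) (cons (hdc xs - 1) (cons v (tlc xs))) y \<in> E)))) \<or>
      (p1 e = 5 \<and> ent b (cons y xs) 0 \<in> E \<and> (\<forall>m<y. \<exists>v. ent b (cons m xs) v \<in> E \<and> v \<noteq> 0)))"

definition self_justified :: "nat set \<Rightarrow> bool" where
  "self_justified E \<longleftrightarrow> (\<forall>z\<in>E. justified E z)"

lemma justified_mono: "justified E z \<Longrightarrow> E \<subseteq> E' \<Longrightarrow> justified E' z"
  unfolding justified_def Let_def by (elim disj_forward conj_forward ex_forward) (auto, blast+)

lemma self_justified_Union: "(\<And>E. E \<in> \<E> \<Longrightarrow> self_justified E) \<Longrightarrow> self_justified (\<Union>\<E>)"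
  unfolding self_justified_def by (meson UnionE Union_upper justified_mono)

lemma self_justified_Un: "self_justified E \<Longrightarrow> self_justified E' \<Longrightarrow> self_justified (E \<union> E')"
  using self_justified_Union[of "{E, E'}"] by auto

lemma self_justified_insert: "self_justified E \<Longrightarrow> justified E z \<Longrightarrow> self_justified (insert z E)"
  unfolding self_justified_def by (auto intro: justified_mono)

lemma self_justified_sound:
  assumes "computes p xs y" "self_justified E" "ent (enc p) (list_encode xs) y' \<in> E"
  shows "y' = y"
  using assms(1,3)
proof (induction arbitrary: y' rule: computes.induct)
  case (Zero xs)
  then show ?case using assms(2) by (auto simp: self_justified_def justified_def ent_def)
next
  case (Succ x xs)
  then show ?case
    using assms(2) by (auto simp: self_justified_def justified_def ent_def list_encode_Cons)
next
  case (Proj i xs)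
  then show ?case
    using assms(2) by (auto simp: self_justified_def justified_def ent_def sn_list_encode)
next
  case (Comp xs qs ys p z)
  from Comp.prems assms(2) obtain v where v: "ent (enc p) v y' \<in> E" "sl v = length qs"
    "\<And>k. k < length qs \<Longrightarrow> ent (sn (list_encode (map enc qs)) k) (list_encode xs) (sn v k) \<in> E"
    by (auto simp: self_justified_def justified_def ent_def dest!: bspec)
  have "sn v k = ys ! k" if "k < length qs" for k
    using Comp.IH(1) v(3)[OF that] that by (auto simp: list_all2_conv_all_nth sn_list_encode)
  moreover have "length ys = length qs" using Comp.IH(1) by (auto dest: list_all2_lengthD)
  ultimately have "v = list_encode ys"
    by (metis seq_eqI sl_list_encode sn_list_encode v(2))
  then show ?case using Comp.IH(2) v(1) by blast
next
  case (PRec_0 p xs y q)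
  then have "ent (enc p) (list_encode xs) y' \<in> E"
    using assms(2) by (auto simp: self_justified_def justified_def ent_def list_encode_Cons dest!: bspec)
  then show ?case by (rule PRec_0.IH)
next
  case (PRec_Suc p q n xs y z)
  then obtain v where "ent (enc (PRec p q)) (list_encode (n # xs)) v \<in> E"
      "ent (enc q) (list_encode (n # v # xs)) y' \<in> E"
    using assms(2) by (auto simp: self_justified_def justified_def ent_def list_encode_Cons dest!: bspec)
  then show ?case using PRec_Suc.IH by blast
next
  case (Mu p n xs)
  then have *: "ent (enc p) (list_encode (y' # xs)) 0 \<in> E"
    "\<And>m. m < y' \<Longrightarrow> \<exists>v. ent (enc p) (list_encode (m # xs)) v \<in> E \<and> v \<noteq> 0"
    using assms(2) by (auto simp: self_justified_def justified_def ent_def list_encode_Cons Let_def dest!: bspec)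
  show ?case
  proof (rule linorder_cases[of y' n])
    assume "y' < n" then show ?thesis using Mu.IH(2) *(1) by blast
  next
    assume "n < y'" then show ?thesis using Mu.IH(1) *(2) by blast
  qed
qed

lemma self_justified_complete:
  assumes "computes p xs y"
  shows "\<exists>E. finite E \<and> self_justified E \<and> ent (enc p) (list_encode xs) y \<in> E"
  using assms
proof (induction rule: computes.induct)
  case (Zero xs)
  show ?case by (rule exI[of _ "{ent (enc Zero) (list_encode xs) 0}"])
      (auto simp: self_justified_def justified_def ent_def)
next
  case (Succ x xs)
  show ?case by (rule exI[of _ "{ent (enc Succ) (list_encode (x # xs)) (Suc x)}"])
      (auto simp: self_justified_def justified_def ent_def list_encode_Cons)
next
  case (Proj i xs)
  then show ?case by (intro exI[of _ "{ent (enc (Proj i)) (list_encode xs) (xs ! i)}"])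
      (auto simp: self_justified_def justified_def ent_def sn_list_encode)
next
  case (Comp xs qs ys p z)
  obtain E0 where E0: "finite E0" "self_justified E0" "ent (enc p) (list_encode ys) z \<in> E0"
    using Comp.IH(2) by blast
  have len: "length qs = length ys" using Comp.IH(1) by (rule list_all2_lengthD)
  have "\<forall>k<length qs. \<exists>E. finite E \<and> self_justified E \<and> ent (enc (qs ! k)) (list_encode xs) (ys ! k) \<in> E"
    using Comp.IH(1) by (auto simp: list_all2_conv_all_nth)
  then obtain F where F: "\<And>k. k < length qs \<Longrightarrow> finite (F k) \<and> self_justified (F k) \<and>
    ent (enc (qs ! k)) (list_encode xs) (ys ! k) \<in> F k" by metis
  define E where "E = E0 \<union> \<Union>(F ` {..<length qs})"
  have sub: "ent (enc (qs ! k)) (list_encode xs) (ys ! k) \<in> E" if "k < length qs" for k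
    using F[OF that] that by (auto simp: E_def)
  have mem: "ent (enc p) (list_encode ys) z \<in> E" "finite E"
    using E0 F by (auto simp: E_def)
  have sj: "self_justified E" unfolding E_def
    by (intro self_justified_Un E0 self_justified_Union) (use F in auto)
  have "justified E (ent (enc (Comp p qs)) (list_encode xs) z)"
    unfolding justified_def ent_def Let_def using mem len sub
    by (auto simp: ent_def sn_list_encode intro!: exI[of _ "list_encode ys"])
  with mem sj show ?case by (meson finite_insert insertI1 self_justified_insert)
next
  case (PRec_0 p xs y q)
  then obtain E where E: "finite E" "self_justified E" "ent (enc p) (list_encode xs) y \<in> E" by blast
  then have "justified E (ent (enc (PRec p q)) (list_encode (0 # xs)) y)"
    by (auto simp: justified_def ent_def list_encode_Cons)
  with E show ?case by (meson finite_insert insertI1 self_justified_insert)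
next
  case (PRec_Suc p q n xs y z)
  then obtain E F where E: "finite E" "self_justified E" "ent (enc (PRec p q)) (list_encode (n # xs)) y \<in> E"
    and F: "finite F" "self_justified F" "ent (enc q) (list_encode (n # y # xs)) z \<in> F" by blast
  then have "justified (E \<union> F) (ent (enc (PRec p q)) (list_encode (Suc n # xs)) z)"
    by (auto simp: justified_def ent_def list_encode_Cons Let_def intro!: exI[of _ y])
  with E F show ?case by (meson finite_insert finite_UnI insertI1 self_justified_insert self_justified_Un)
next
  case (Mu p n xs)
  obtain E0 where E0: "finite E0" "self_justified E0" "ent (enc p) (list_encode (n # xs)) 0 \<in> E0"
    using Mu.IH(1) by blast
  have "\<forall>m<n. \<exists>E. finite E \<and> self_justified E \<and> (\<exists>v. ent (enc p) (list_encode (m # xs)) v \<in> E \<and> v \<noteq> 0)"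
    using Mu.IH(2) by blast
  then obtain F where F: "\<And>m. m < n \<Longrightarrow> finite (F m) \<and> self_justified (F m) \<and>
    (\<exists>v. ent (enc p) (list_encode (m # xs)) v \<in> F m \<and> v \<noteq> 0)" by metis
  define E where "E = E0 \<union> \<Union>(F ` {..<n})"
  have mem: "ent (enc p) (list_encode (n # xs)) 0 \<in> E" "finite E"
    using E0 F by (auto simp: E_def)
  have mem': "\<exists>v. ent (enc p) (list_encode (m # xs)) v \<in> E \<and> v \<noteq> 0" if "m < n" for m
    using F[OF that] that by (auto simp: E_def)
  have sj: "self_justified E" unfolding E_def
    by (intro self_justified_Un E0 self_justified_Union) (use F in auto)
  have "justified E (ent (enc (Mu p)) (list_encode xs) n)"
    unfolding justified_def Let_def using mem(1) mem' by (simp add: ent_def list_encode_Cons)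
  with mem sj show ?case by (meson finite_insert insertI1 self_justified_insert)
qed

definition has :: "nat \<Rightarrow> nat \<Rightarrow> bool" where "has t z \<longleftrightarrow> (\<exists>i<p1 t. sn (p2 t) i = z)"

lemma has_of_finite: assumes "finite E" shows "\<exists>t. {z. has t z} = E"
proof -
  obtain l where l: "set l = E" using finite_list[OF assms] ..
  have "has (pr (length l) (list_encode l)) z \<longleftrightarrow> z \<in> E" for z
    by (auto simp: has_def l[symmetric] in_set_conv_nth sn_list_encode)
  then show ?thesis by blast
qed

text \<open>Plays the part of Kleene's T predicate, with a finite self-justified set of entries as
  witness in place of a computation history.\<close>

definition Tr :: "nat \<Rightarrow> nat \<Rightarrow> nat \<Rightarrow> nat \<Rightarrow> bool" where
  "Tr e x y t \<longleftrightarrow> has t (ent e (cons x 0) y) \<and> self_justified {z. has t z}"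

lemma Tr_enumerates:
  assumes "computable g"
  shows "\<exists>e. \<forall>x y. g x = y \<longleftrightarrow> (\<exists>t. Tr e x y t)"
proof -
  obtain p where p: "\<And>n. computes p [n] (g n)" using assms by (auto simp: computable_def)
  have lst: "list_encode [x] = cons x 0" for x by (simp only: list_encode_Cons list_encode.simps)
  show ?thesis
  proof (rule exI[of _ "enc p"], intro allI iffI)
    fix x y assume "g x = y"
    then obtain E where "finite E" "self_justified E" "ent (enc p) (cons x 0) y \<in> E"
      using self_justified_complete[OF p[of x]] lst by auto
    then show "\<exists>t. Tr (enc p) x y t" using has_of_finite[of E] unfolding Tr_def by (metis mem_Collect_eq)
  next
    fix x y assume "\<exists>t. Tr (enc p) x y t"
    then show "g x = y" using self_justified_sound[OF p[of x]] lst unfolding Tr_def by fastforce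
  qed
qed

text \<open>A value claimed in the finite set is a component of one of its listed entries, so the
  unbounded quantifiers of \<open>justified\<close> become bounded and \<open>Tr\<close> becomes
  decidable.\<close>

lemma ex_value: "(\<exists>v. has t (ent a b v) \<and> P v) \<longleftrightarrow>
    (\<exists>i<p1 t. has t (ent a b (p2 (p2 (sn (p2 t) i)))) \<and> P (p2 (p2 (sn (p2 t) i))))"
  by (fastforce simp: has_def ent_def)

lemma ex_args: "(\<exists>v. has t (ent a v y) \<and> P v) \<longleftrightarrow>
    (\<exists>i<p1 t. has t (ent a (p1 (p2 (sn (p2 t) i))) y) \<and> P (p1 (p2 (sn (p2 t) i))))"
  by (fastforce simp: has_def ent_def)

context fclass
begin

lemma C_ent [cintro]:
  assumes "C a" "C b" "C c" shows "C (\<lambda>x. ent (a x) (b x) (c x))"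
  unfolding ent_def by (intro cintro assms)

lemma dec_has [cintro]:
  assumes "C a" "C b" shows "dec (\<lambda>x. has (a x) (b x))"
  unfolding has_def by (intro cintro assms C_comp[OF assms(1)] C_comp[OF assms(2)])

lemma dec_justified: "dec (\<lambda>w. justified {z. has (p1 w) z} (p2 w))"
  unfolding justified_def Let_def mem_Collect_eq ex_args ex_value by (intro cintro)

lemma dec_Tr [cintro]:
  assumes "C a" "C b" "C c" "C d" shows "dec (\<lambda>x. Tr (a x) (b x) (c x) (d x))"
proof -
  have *: "self_justified {z. has t z} \<longleftrightarrow> (\<forall>i<p1 t. justified {z. has t z} (sn (p2 t) i))" for t
    by (auto simp: self_justified_def has_def)
  show ?thesis unfolding Tr_def *
    by (intro cintro assms dec_app2[OF dec_justified] C_comp[OF assms(4)])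
qed

end

section \<open>Countable ordinals\<close>

\<comment> \<open>Modulo isomorphism, ordinals form a type of class \<open>wellorder\<close>, with
  induction, \<open>LEAST\<close> and \<open>Max\<close>. The quotient is partial because
  \<open>r =o r\<close> holds for well-orders only.\<close>
quotient_type cord = "nat rel" / partial: "\<lambda>r s :: nat rel. r =o s"
proof (rule part_equivpI)
  have "Well_order ({} :: nat rel)" by (simp add: Field_def well_order_on_empty)
  then show "\<exists>r :: nat rel. r =o r" using ordIso_reflexive by blast
qed (auto intro: sympI transpI ordIso_symmetric ordIso_transitive)

lemma ordIso_Well_order: "r =o s \<Longrightarrow> Well_order r \<and> Well_order s"
  by (simp add: ordIso_def)

instantiation cord :: wellorder
begin

lift_definition less_eq_cord :: "cord \<Rightarrow> cord \<Rightarrow> bool" is "\<lambda>r s. r \<le>o s"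
  by (meson ordIso_ordLeq_trans ordIso_symmetric ordLeq_ordIso_trans)

lift_definition less_cord :: "cord \<Rightarrow> cord \<Rightarrow> bool" is "\<lambda>r s. r <o s"
  by (meson ordIso_ordLess_trans ordIso_symmetric ordLess_ordIso_trans)

instance
proof
  fix x y z :: cord and P :: "cord \<Rightarrow> bool"
  show "x < y \<longleftrightarrow> x \<le> y \<and> \<not> y \<le> x"
    by transfer (meson not_ordLess_iff_ordLeq ordIso_Well_order ordLess_imp_ordLeq)
  show "x \<le> x" by transfer (simp add: ordIso_imp_ordLeq)
  show "x \<le> y \<Longrightarrow> y \<le> z \<Longrightarrow> x \<le> z" by transfer (rule ordLeq_transitive)
  show "x \<le> y \<Longrightarrow> y \<le> x \<Longrightarrow> x = y" by transfer (simp add: ordIso_iff_ordLeq)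
  show "x \<le> y \<or> y \<le> x" by transfer (meson ordIso_Well_order ordLeq_total)
  have "wf {(x :: cord, y). x < y}"
  proof (rule wf_subset[OF wf_inv_image[OF wf_ordLess, of rep_cord]], clarsimp simp: inv_image_def)
    fix x y :: cord assume "x < y" then show "rep_cord x <o rep_cord y" by (simp add: less_cord.rep_eq)
  qed
  then show "(\<And>x. (\<And>y. y < x \<Longrightarrow> P y) \<Longrightarrow> P x) \<Longrightarrow> P x"
    by (rule wf_induct_rule) auto
qed

end

lemma abs_cord_less_iff: "Well_order r \<Longrightarrow> Well_order s \<Longrightarrow> abs_cord r < abs_cord s \<longleftrightarrow> r <o s"
  by (simp add: less_cord.abs_eq ordIso_reflexive)

lemma abs_cord_le_iff: "Well_order r \<Longrightarrow> Well_order s \<Longrightarrow> abs_cord r \<le> abs_cord s \<longleftrightarrow> r \<le>o s"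
  by (simp add: less_eq_cord.abs_eq ordIso_reflexive)

lemma abs_cord_eq_iff: "Well_order r \<Longrightarrow> Well_order s \<Longrightarrow> abs_cord r = abs_cord s \<longleftrightarrow> r =o s"
  using Quotient_rel[OF Quotient_cord] ordIso_reflexive by fastforce

lemma abs_cord_surj: "\<exists>r. Well_order r \<and> x = abs_cord r"
  by (metis Quotient_abs_rep[OF Quotient_cord] Quotient_rep_reflp[OF Quotient_cord] ordIso_Well_order)

lemma less_abs_cord_iff:
  assumes "Well_order r"
  shows "x < abs_cord r \<longleftrightarrow> (\<exists>a\<in>Field r. x = abs_cord (Restr r (underS r a)))"
proof -
  obtain s where s: "Well_order s" "x = abs_cord s" using abs_cord_surj by blast
  have "x < abs_cord r \<longleftrightarrow> s <o r" using s assms by (simp add: abs_cord_less_iff)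
  also have "\<dots> \<longleftrightarrow> (\<exists>a\<in>Field r. s =o Restr r (underS r a))"
    by (rule ordLess_iff_ordIso_Restr) (use s assms in auto)
  also have "\<dots> \<longleftrightarrow> (\<exists>a\<in>Field r. x = abs_cord (Restr r (underS r a)))"
    using s assms by (simp add: abs_cord_eq_iff Well_order_Restr)
  finally show ?thesis .
qed

definition ord1 :: cord where "ord1 = abs_cord ord_one"

lemma Field_ord_one: "Field ord_one = {0}" by (auto simp: ord_one_def Field_def)

lemma Well_order_ord_one: "Well_order ord_one"
  unfolding Field_ord_one
  by (auto simp: ord_one_def well_order_on_def linear_order_on_def partial_order_on_def preorder_on_def
      refl_on_def trans_def antisym_def total_on_def)

text \<open>Below \<open>ord1\<close> there is only the order type of \<open>{}\<close>. Hence every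
  ordinal with something below it is at least \<open>ord1\<close>.\<close>

lemma less_ord1: assumes "y < ord1" shows "\<not> x < y"
proof -
  have "underS ord_one 0 = {}" by (auto simp: underS_def ord_one_def)
  with assms have "y = abs_cord {}"
    unfolding ord1_def less_abs_cord_iff[OF Well_order_ord_one] Field_ord_one by simp
  then show ?thesis using less_abs_cord_iff[of "{}" x] well_order_on_empty by (auto simp: Field_def)
qed

lemma ord1_le: "x < y \<Longrightarrow> ord1 \<le> y"
  using less_ord1 leI by blast

section \<open>Ranks and values of Borel codes\<close>

lemma code_section_pr: "code_section c n m = c (Suc (pr n m))"
  by (simp add: code_section_def pr_def)

text \<open>Ranks without reference to a space or a coded set. Passing to a larger rank is no rule
  of its own: both rules accept every sufficiently large \<open>x\<close>.\<close>

inductive rk :: "cord \<Rightarrow> (nat \<Rightarrow> nat) \<Rightarrow> bool" where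
  leaf: "c 0 = 0 \<Longrightarrow> ord1 \<le> x \<Longrightarrow> rk x c"
| node: "c 0 = 1 \<Longrightarrow> (\<forall>n. \<exists>y<x. rk y (code_section c n)) \<Longrightarrow> rk x c"

lemma rk_mono: assumes "rk x c" "x \<le> y" shows "rk y c"
  using assms(1)
proof cases
  case leaf
  then show ?thesis using assms(2) by (intro rk.leaf) auto
next
  case node
  then have "\<exists>z<y. rk z (code_section c n)" for n using assms(2) by (meson order_less_le_trans)
  then show ?thesis using node(1) by (intro rk.node) auto
qed

lemma rk_ord1_le: "rk x c \<Longrightarrow> ord1 \<le> x"
  by (induction rule: rk.induct) (auto dest: order_le_less_trans)

lemma rk_node_less: "rk x c \<Longrightarrow> c 0 \<noteq> 0 \<Longrightarrow> ord1 < x"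
  by (erule rk.cases) (auto dest: rk_ord1_le order_le_less_trans)

lemma rk_flag: "rk x c \<Longrightarrow> c 0 \<noteq> 0 \<Longrightarrow> c 0 = 1"
  by (erule rk.cases) auto

lemma rk_section: "rk x c \<Longrightarrow> c 0 \<noteq> 0 \<Longrightarrow> \<exists>y<x. rk y (code_section c n)"
  by (erule rk.cases) auto

text \<open>Codes are evaluated in an arbitrary algebra, so that the sets they code and their Cohen forcing
  relations are instances of one notion.\<close>

inductive itp :: "((nat \<Rightarrow> nat) \<Rightarrow> 'v) \<Rightarrow> ((nat \<Rightarrow> 'v) \<Rightarrow> 'v) \<Rightarrow> (nat \<Rightarrow> nat) \<Rightarrow> 'v \<Rightarrow> bool"
  for lf nd where
  leaf: "c 0 = 0 \<Longrightarrow> itp lf nd c (lf c)"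
| node: "c 0 = 1 \<Longrightarrow> (\<forall>n. itp lf nd (code_section c n) (v n)) \<Longrightarrow> itp lf nd c (nd v)"

definition ev :: "((nat \<Rightarrow> nat) \<Rightarrow> 'v) \<Rightarrow> ((nat \<Rightarrow> 'v) \<Rightarrow> 'v) \<Rightarrow> (nat \<Rightarrow> nat) \<Rightarrow> 'v" where
  "ev lf nd c = (THE v. itp lf nd c v)"

lemma itp_unique: "itp lf nd c v \<Longrightarrow> itp lf nd c w \<Longrightarrow> v = w"
proof (induction arbitrary: w rule: itp.induct)
  case (leaf c)
  from leaf(2,1) show ?case by cases auto
next
  case (node c v)
  from node(3,1) obtain u where u: "w = nd u" "\<forall>n. itp lf nd (code_section c n) (u n)"
    by cases auto
  have "v = u" using node(2) u(2) by (intro HOL.ext) auto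
  then show ?case using u by simp
qed

lemma itp_ev: "itp lf nd c v \<Longrightarrow> ev lf nd c = v"
  unfolding ev_def by (blast intro: the_equality itp_unique)

lemma rk_itp: "rk x c \<Longrightarrow> itp lf nd c (ev lf nd c)"
proof (induction rule: rk.induct)
  case (leaf c x)
  then show ?case using itp.leaf itp_ev by metis
next
  case (node c x)
  then have "itp lf nd c (nd (\<lambda>n. ev lf nd (code_section c n)))" by (intro itp.node) auto
  then show ?case using itp_ev by metis
qed

lemma ev_leaf: "c 0 = 0 \<Longrightarrow> ev lf nd c = lf c"
  by (intro itp_ev itp.leaf)

lemma ev_node: "rk x c \<Longrightarrow> c 0 \<noteq> 0 \<Longrightarrow> ev lf nd c = nd (\<lambda>n. ev lf nd (code_section c n))"
  by (intro itp_ev itp.node) (auto dest: rk_flag rk_section intro: rk_itp)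

section \<open>Sets coded in a space, and agreement with the inductively defined Borel codes\<close>

definition evs :: "(nat \<Rightarrow> 'a set) \<Rightarrow> (nat \<Rightarrow> nat) \<Rightarrow> 'a set" where
  "evs N = ev (\<lambda>c. \<Union>{N s | s. \<exists>n. c (n + 1) = s + 1}) (\<lambda>P. \<Union>n. UNIV - P n)"

abbreviation bev :: "(nat \<Rightarrow> nat) \<Rightarrow> (nat \<Rightarrow> nat) set" where "bev \<equiv> evs baire_basis"

lemma evs_leaf: "c 0 = 0 \<Longrightarrow> z \<in> evs N c \<longleftrightarrow> (\<exists>n s. c (Suc n) = Suc s \<and> z \<in> N s)"
  unfolding evs_def by (subst ev_leaf, assumption, simp, blast)

lemma evs_node: "rk x c \<Longrightarrow> c 0 \<noteq> 0 \<Longrightarrow> z \<in> evs N c \<longleftrightarrow> (\<exists>n. z \<notin> evs N (code_section c n))"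
  unfolding evs_def by (subst ev_node) auto

lemma borel_code_imp: "borel_code N \<alpha> c P \<Longrightarrow> rk (abs_cord \<alpha>) c \<and> P = evs N c \<and> Well_order \<alpha>"
proof (induction rule: borel_code.induct)
  case (open_code \<alpha> c)
  then have "ord1 \<le> abs_cord \<alpha>"
    by (simp add: ord1_def abs_cord_le_iff ordIso_Well_order ordIso_iff_ordLeq)
  moreover have "\<Union>{N s | s. \<exists>n. c (n + 1) = s + 1} = evs N c"
    unfolding set_eq_iff evs_leaf[of c, OF open_code(2)] by (simp, blast)
  ultimately show ?case using open_code by (auto intro: rk.leaf dest: ordIso_Well_order)
next
  case (smaller_rank \<beta> \<alpha> c P)
  then have "Well_order \<alpha>" by (simp add: ordLess_def)
  moreover have "abs_cord \<beta> < abs_cord \<alpha>" using smaller_rank calculation by (simp add: abs_cord_less_iff)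
  ultimately show ?case using smaller_rank by (auto intro: rk_mono)
next
  case (union_code c \<alpha> P)
  then have "Well_order \<alpha>" by (auto simp: ordLess_def)
  have "\<exists>y<abs_cord \<alpha>. rk y (code_section c n)" and P: "P n = evs N (code_section c n)" for n
    using union_code(2) \<open>Well_order \<alpha>\<close> by (metis abs_cord_less_iff)+
  then have "rk (abs_cord \<alpha>) c" using union_code(1) by (auto intro: rk.node)
  moreover from this have "(\<Union>n. UNIV - P n) = evs N c"
    using union_code(1) by (auto simp: evs_node P)
  ultimately show ?case using \<open>Well_order \<alpha>\<close> by blast
qed

lemma rk_imp_borel_code: "rk x c \<Longrightarrow> Well_order \<alpha> \<Longrightarrow> x = abs_cord \<alpha> \<Longrightarrow> borel_code N \<alpha> c (evs N c)"
proof (induction arbitrary: \<alpha> rule: rk.induct)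
  case (leaf c x)
  have eq: "evs N c = \<Union>{N s | s. \<exists>n. c (n + 1) = s + 1}"
    unfolding set_eq_iff evs_leaf[of c, OF leaf(1)] by (simp, blast)
  have *: "borel_code N ord_one c (evs N c)" unfolding eq
    by (rule borel_code.open_code) (use leaf ordIso_reflexive Well_order_ord_one in auto)
  show ?case
  proof (cases "x = ord1")
    case True
    then have "\<alpha> =o ord_one" using leaf Well_order_ord_one by (simp add: ord1_def abs_cord_eq_iff)
    then show ?thesis unfolding eq by (rule borel_code.open_code) (rule leaf)
  next
    case False
    then have "ord_one <o \<alpha>" using leaf Well_order_ord_one
      by (metis abs_cord_less_iff ord1_def order_le_imp_less_or_eq)
    then show ?thesis using * by (rule borel_code.smaller_rank)
  qed
next
  case (node c x)
  have eq: "evs N c = (\<Union>n. UNIV - evs N (code_section c n))"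
  proof -
    have "\<forall>n. \<exists>y<x. rk y (code_section c n)" using node(2) by blast
    with node(1) have "rk x c" by (rule rk.node)
    from evs_node[OF this, of _ N] node(1) show ?thesis by auto
  qed
  have "\<exists>\<beta>. \<beta> <o \<alpha> \<and> borel_code N \<beta> (code_section c n) (evs N (code_section c n))" for n
  proof -
    obtain y where y: "y < x" "\<And>\<beta>. Well_order \<beta> \<Longrightarrow> y = abs_cord \<beta> \<Longrightarrow>
      borel_code N \<beta> (code_section c n) (evs N (code_section c n))" using node(2) by blast
    obtain \<beta> where \<beta>: "Well_order \<beta>" "y = abs_cord \<beta>" using abs_cord_surj by blast
    then have "\<beta> <o \<alpha>" using y(1) node(3,4) by (simp add: abs_cord_less_iff)
    then show ?thesis using y(2) \<beta> by blast
  qed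
  then show ?case unfolding eq using node(1) by (intro borel_code.union_code) auto
qed

lemma Sigma0_iff:
  assumes "Well_order \<alpha>"
  shows "Sigma0 N \<alpha> P \<longleftrightarrow> (\<exists>c. computable c \<and> rk (abs_cord \<alpha>) c \<and> evs N c = P)"
  unfolding Sigma0_def using borel_code_imp rk_imp_borel_code[OF _ assms] by metis

section \<open>Codes from computable systems of nodes\<close>

text \<open>\<open>sc t ch lf j\<close> is the code which unwinds the node \<open>j\<close> of the system with flags \<open>t\<close>, children
  \<open>ch\<close> and leaf entries \<open>lf\<close>.\<close>

function sc :: "(nat \<Rightarrow> nat) \<Rightarrow> (nat \<Rightarrow> nat \<Rightarrow> nat) \<Rightarrow> (nat \<Rightarrow> nat \<Rightarrow> nat) \<Rightarrow> nat \<Rightarrow> nat \<Rightarrow> nat" where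
  "sc t ch lf j 0 = t j"
| "sc t ch lf j (Suc m) = (if t j = 0 then lf j m else sc t ch lf (ch j (p1 m)) (p2 m))"
  by pat_completeness auto
termination
  by (relation "measure (\<lambda>(t, ch, lf, j, m). m)") (auto simp: less_Suc_eq_le p2_le)

lemma sc_section: "t j \<noteq> 0 \<Longrightarrow> code_section (sc t ch lf j) n = sc t ch lf (ch j n)"
  by (rule HOL.ext) (simp add: code_section_pr)

text \<open>Reading one entry is a walk through the system. A state is a node with a remaining
  argument, which drops at every proper step, so \<open>m\<close> steps reach a leaf or the argument
  0, where \<open>step\<close> idles.\<close>

lemma C2_sc:
  assumes t: "computable t" and ch: "cmp.C2 ch" and lf: "cmp.C2 lf"
  shows "cmp.C2 (sc t ch lf)"
proof -
  define step where "step s = (if p2 s = 0 \<or> t (p1 s) = 0 then s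
    else pr (ch (p1 s) (p1 (p2 s - 1))) (p2 (p2 s - 1)))" for s
  define out where "out s = (if p2 s = 0 then t (p1 s) else lf (p1 s) (p2 s - 1))" for s
  have stuck: "step s = s \<Longrightarrow> (step ^^ k) s = s" for s k by (induction k) auto
  have *: "m \<le> k \<Longrightarrow> sc t ch lf j m = out ((step ^^ k) (pr j m))" for j m k
  proof (induction m arbitrary: j k rule: less_induct)
    case (less m)
    show ?case
    proof (cases "m = 0 \<or> t j = 0")
      case True
      then have "step (pr j m) = pr j m" by (auto simp: step_def)
      from stuck[OF this] show ?thesis using True by (cases m) (auto simp: out_def)
    next
      case False
      then obtain m' k' where m': "m = Suc m'" "k = Suc k'" using less.prems by (cases m; cases k) auto
      have "p2 m' \<le> k'" "p2 m' < m" using p2_le[of m'] less.prems m' by auto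
      moreover have "step (pr j m) = pr (ch j (p1 m')) (p2 m')" using False m' by (auto simp: step_def)
      ultimately show ?thesis using less.IH[of "p2 m'" k' "ch j (p1 m')"] False m'
        by (simp add: funpow_swap1)
    qed
  qed
  have step: "computable step" unfolding step_def
    by (intro cintro cmp.C2_app[OF ch] cmp.C_comp[OF t])
  have out: "computable out" unfolding out_def
    by (intro cintro cmp.C2_app[OF lf] cmp.C_comp[OF t])
  show ?thesis unfolding cmp.C2_def *[OF order_refl]
    by (intro cmp.C_comp[OF out] cmp.C_funpow cintro cmp.C_comp[OF step])
qed

definition pre :: "nat \<Rightarrow> nat \<Rightarrow> nat" where
  "pre w m = rec_nat m (\<lambda>k r. Suc (pr (sn w k) r)) (sl w)"

lemma pre_0 [simp]: "pre 0 m = m" by (simp add: pre_def)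

lemma pre_cons: "pre (cons n w) m = pre w (Suc (pr n m))"
proof -
  have "rec_nat m (\<lambda>k r. Suc (pr (sn (cons n w) k) r)) (Suc l) =
    rec_nat (Suc (pr n m)) (\<lambda>k r. Suc (pr (sn w k) r)) l" for l
    by (induction l) auto
  then show ?thesis by (simp add: pre_def)
qed

lemma (in fclass) C_pre [cintro]: assumes "C a" "C b" shows "C (\<lambda>x. pre (a x) (b x))"
  unfolding pre_def by (intro cintro assms C_comp[OF assms(1)])

text \<open>\<open>sub c w\<close> is the subcode of \<open>c\<close> at the address \<open>w\<close>, a sequence number with the last step first.\<close>

definition sub :: "(nat \<Rightarrow> nat) \<Rightarrow> nat \<Rightarrow> nat \<Rightarrow> nat" where
  "sub c w = (\<lambda>m. c (pre w m))"

lemma sub_0 [simp]: "sub c 0 = c" by (simp add: sub_def)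

lemma section_sub: "code_section (sub c w) n = sub c (cons n w)"
  by (rule HOL.ext) (simp add: code_section_pr sub_def pre_cons)

section \<open>Uniformly Borel families\<close>

text \<open>Natural number arguments are treated as indices: \<open>SR \<rho> \<phi>\<close> says that the sections \<open>\<phi> i\<close> have
  uniformly computable codes, that of \<open>\<phi> i\<close> being of rank at most \<open>\<rho> i\<close>.\<close>

definition SR :: "(nat \<Rightarrow> cord) \<Rightarrow> (nat \<Rightarrow> (nat \<Rightarrow> nat) \<Rightarrow> bool) \<Rightarrow> bool" where
  "SR \<rho> \<phi> \<longleftrightarrow> (\<exists>c. cmp.C2 c \<and> (\<forall>i. rk (\<rho> i) (c i) \<and> (\<forall>f. f \<in> bev (c i) \<longleftrightarrow> \<phi> i f)))"

definition S :: "cord \<Rightarrow> (nat \<Rightarrow> (nat \<Rightarrow> nat) \<Rightarrow> bool) \<Rightarrow> bool" where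
  "S x \<phi> \<longleftrightarrow> SR (\<lambda>_. x) \<phi>"

lemma SRI: "cmp.C2 c \<Longrightarrow> (\<And>i. rk (\<rho> i) (c i)) \<Longrightarrow>
    (\<And>i f. f \<in> bev (c i) \<longleftrightarrow> \<phi> i f) \<Longrightarrow> SR \<rho> \<phi>"
  unfolding SR_def by blast

lemma SR_comp: assumes "SR \<rho> \<phi>" "computable u" shows "SR (\<lambda>i. \<rho> (u i)) (\<lambda>i. \<phi> (u i))"
proof -
  obtain c where c: "cmp.C2 c" "\<And>i. rk (\<rho> i) (c i)" "\<And>i f. f \<in> bev (c i) \<longleftrightarrow> \<phi> i f"
    using assms(1) unfolding SR_def by blast
  have "cmp.C2 (\<lambda>i. c (u i))" unfolding cmp.C2_def
    by (intro cmp.C2_app[OF c(1)] cintro cmp.C_comp[OF assms(2)])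
  then show ?thesis by (rule SRI) (use c in auto)
qed

lemma SR_mono: "SR \<rho> \<phi> \<Longrightarrow> (\<And>i. \<rho> i \<le> \<sigma> i) \<Longrightarrow> SR \<sigma> \<phi>"
  unfolding SR_def using rk_mono by metis

lemma SR_leafI:
  assumes "cmp.C2 e" "\<And>i. ord1 \<le> \<rho> i" "\<And>i f. \<phi> i f \<longleftrightarrow> (\<exists>n s. e i n = Suc s \<and> pfx s f)"
  shows "SR \<rho> \<phi>"
proof (rule SRI)
  let ?c = "\<lambda>i m. if m = 0 then 0 else e i (m - 1)"
  show "cmp.C2 ?c" unfolding cmp.C2_def by (intro cintro cmp.C2_app[OF assms(1)])
  show "rk (\<rho> i) (?c i)" for i by (rule rk.leaf) (use assms in auto)
  show "f \<in> bev (?c i) \<longleftrightarrow> \<phi> i f" for i f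
    by (subst evs_leaf) (auto simp: assms(3) baire_basis_iff)
qed

lemma SR_union:
  assumes "SR \<sigma> \<psi>" "\<And>i n. \<sigma> (pr n i) < \<rho> i"
  shows "SR \<rho> (\<lambda>i f. \<exists>n. \<not> \<psi> (pr n i) f)"
proof -
  obtain d where d: "cmp.C2 d" "\<And>i. rk (\<sigma> i) (d i)" "\<And>i f. f \<in> bev (d i) \<longleftrightarrow> \<psi> i f"
    using assms(1) unfolding SR_def by blast
  let ?c = "\<lambda>i m. if m = 0 then 1 else d (pr (p1 (m - 1)) i) (p2 (m - 1))"
  have sec: "code_section (?c i) n = d (pr n i)" for i n
    by (rule HOL.ext) (simp add: code_section_pr)
  show ?thesis
  proof (rule SRI)
    show "cmp.C2 ?c" unfolding cmp.C2_def by (intro cintro cmp.C2_app[OF d(1)])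
    show rk: "rk (\<rho> i) (?c i)" for i
      by (rule rk.node) (use assms(2) d(2) in \<open>auto simp: sec\<close>)
    show "f \<in> bev (?c i) \<longleftrightarrow> (\<exists>n. \<not> \<psi> (pr n i) f)" for i f
      by (subst evs_node[OF rk]) (auto simp: sec d(3))
  qed
qed

lemma SR_if:
  assumes "SR \<rho> \<phi>" "SR \<sigma> \<psi>" "cmp.dec d"
  shows "SR (\<lambda>i. if d i then \<rho> i else \<sigma> i) (\<lambda>i f. if d i then \<phi> i f else \<psi> i f)"
proof -
  obtain b where b: "cmp.C2 b" "\<And>i. rk (\<rho> i) (b i)" "\<And>i f. f \<in> bev (b i) \<longleftrightarrow> \<phi> i f"
    using assms(1) unfolding SR_def by blast
  obtain c where c: "cmp.C2 c" "\<And>i. rk (\<sigma> i) (c i)" "\<And>i f. f \<in> bev (c i) \<longleftrightarrow> \<psi> i f"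
    using assms(2) unfolding SR_def by blast
  have "cmp.C2 (\<lambda>i. if d i then b i else c i)" unfolding cmp.C2_def if_distribR
    by (intro cintro cmp.C2_app[OF b(1)] cmp.C2_app[OF c(1)] cmp.dec_comp[OF assms(3)])
  then show ?thesis by (rule SRI) (use b c in auto)
qed

subsection \<open>Unions of complements\<close>

text \<open>A leaf code for the complement of what the entry \<open>e\<close> of an open code
  contributes: for the void entry 0 the whole space, for \<open>Suc s\<close> the union over all
  stems incompatible with \<open>s\<close>. \<open>CB 0\<close> also serves as a filler child, since
  its complement adds nothing to a union.\<close>

definition CB :: "nat \<Rightarrow> nat \<Rightarrow> nat" where
  "CB e r = (if r = 0 then 0 else if e = 0 then 1 else if inc (r - 1) (e - 1) then r else 0)"

lemma rk_CB: "ord1 \<le> x \<Longrightarrow> rk x (CB e)"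
  by (rule rk.leaf) (auto simp: CB_def)

lemma evs_CB: "f \<in> bev (CB e) \<longleftrightarrow> \<not> (\<exists>s. e = Suc s \<and> pfx s f)"
proof (cases e)
  case 0
  then show ?thesis by (subst evs_leaf) (auto simp: CB_def baire_basis_iff intro: exI[of _ 0])
next
  case (Suc s)
  have "f \<in> bev (CB e) \<longleftrightarrow> (\<exists>u. inc u s \<and> pfx u f)"
    by (subst evs_leaf) (auto simp: CB_def baire_basis_iff Suc)
  then show ?thesis by (simp add: Suc not_pfx_iff)
qed

lemma (in fclass) C_CB [cintro]: assumes "C a" "C b" shows "C (\<lambda>x. CB (a x) (b x))"
  unfolding CB_def by (intro cintro assms)

text \<open>Every code of rank at least two, open or not, is a union of complements of the sets coded by
  \<open>nch c n\<close>.\<close>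

definition nch :: "(nat \<Rightarrow> nat) \<Rightarrow> nat \<Rightarrow> nat \<Rightarrow> nat" where
  "nch c n = (if c 0 = 0 then CB (c (Suc n)) else code_section c n)"

lemma nch_eq: "nch c n r = (if c 0 = 0 then CB (c (Suc n)) r else c (Suc (pr n r)))"
  by (simp add: nch_def code_section_pr)

lemma rk_nch: assumes "rk x c" "ord1 < y" "x \<le> y" shows "\<exists>z<y. rk z (nch c n)"
proof (cases "c 0 = 0")
  case True then show ?thesis using assms(2) rk_CB[of ord1] by (auto simp: nch_def)
next
  case False then show ?thesis using rk_section[OF assms(1) False, of n] assms(3)
    by (auto simp: nch_def intro: order_less_le_trans)
qed

lemma evs_nch: assumes "rk x c" shows "f \<in> bev c \<longleftrightarrow> (\<exists>n. f \<notin> bev (nch c n))"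
proof (cases "c 0 = 0")
  case True then show ?thesis by (auto simp: nch_def evs_CB evs_leaf baire_basis_iff)
next
  case False then show ?thesis using evs_node[OF assms False] by (simp add: nch_def)
qed

text \<open>The rank bounds of the children are picked by choice and need not be computable; this is
  why \<open>SR\<close> allows an arbitrary function of ranks.\<close>

lemma S_normal_SR:
  assumes "S x \<phi>" "ord1 < x"
  obtains \<sigma> \<psi> where "SR \<sigma> \<psi>" "\<And>j. \<sigma> j < x" "\<And>i f. \<phi> i f \<longleftrightarrow> (\<exists>n. \<not> \<psi> (pr n i) f)"
proof -
  obtain c where c: "cmp.C2 c" "\<And>i. rk x (c i)" "\<And>i f. f \<in> bev (c i) \<longleftrightarrow> \<phi> i f"
    using assms(1) unfolding S_def SR_def by blast
  let ?d = "\<lambda>j. nch (c (p2 j)) (p1 j)"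
  define \<sigma> where "\<sigma> j = (SOME z. z < x \<and> rk z (?d j))" for j
  have \<sigma>: "\<sigma> j < x \<and> rk (\<sigma> j) (?d j)" for j
    unfolding \<sigma>_def by (rule someI_ex) (use rk_nch[OF c(2) assms(2) order_refl] in blast)
  have "cmp.C2 ?d" unfolding cmp.C2_def nch_eq by (intro cintro cmp.C2_app[OF c(1)])
  then have "SR \<sigma> (\<lambda>j f. f \<in> bev (?d j))" by (rule SRI) (use \<sigma> in auto)
  then show ?thesis by (rule that) (use \<sigma> c evs_nch[OF c(2)] in auto)
qed

lemma S_1_E:
  assumes "S ord1 \<phi>"
  obtains e where "cmp.C2 e" "\<And>i f. \<phi> i f \<longleftrightarrow> (\<exists>n s. e i n = Suc s \<and> pfx s f)"
proof -
  obtain c where c: "cmp.C2 c" "\<And>i. rk ord1 (c i)" "\<And>i f. f \<in> bev (c i) \<longleftrightarrow> \<phi> i f"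
    using assms(1) unfolding S_def SR_def by blast
  have "c i 0 = 0" for i using rk_node_less[OF c(2)] by blast
  then have "\<phi> i f \<longleftrightarrow> (\<exists>n s. c i (Suc n) = Suc s \<and> pfx s f)" for i f
    unfolding c(3)[symmetric] by (simp add: evs_leaf baire_basis_iff)
  moreover have "cmp.C2 (\<lambda>i n. c i (Suc n))" unfolding cmp.C2_def
    by (intro cintro cmp.C2_app[OF c(1)])
  ultimately show ?thesis by (rule that[rotated])
qed

text \<open>A finite union must not raise the rank. If all members are leaves, which is decidable
  from the codes, their enumerations merge into one leaf. Otherwise the rank exceeds
  \<open>ord1\<close>, and all members, leaves included, are split by \<open>nch\<close> into
  complements and merged as a node.\<close>

lemma SR_bex:
  assumes "SR \<rho> \<phi>" "computable b" "\<And>i. ord1 \<le> \<sigma> i" "\<And>i k. k < b i \<Longrightarrow> \<rho> (pr k i) \<le> \<sigma> i"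
  shows "SR \<sigma> (\<lambda>i f. \<exists>k<b i. \<phi> (pr k i) f)"
proof -
  obtain c where c: "cmp.C2 c" "\<And>i. rk (\<rho> i) (c i)" "\<And>i f. f \<in> bev (c i) \<longleftrightarrow> \<phi> i f"
    using assms(1) unfolding SR_def by blast
  define A where "A i \<longleftrightarrow> (\<forall>k<b i. c (pr k i) 0 = 0)" for i
  define d where "d i m = (if m = 0 then if A i then 0 else 1
    else if A i then if p1 (m - 1) < b i then c (pr (p1 (m - 1)) i) (Suc (p2 (m - 1))) else 0
    else if p1 (p1 (m - 1)) < b i then nch (c (pr (p1 (p1 (m - 1))) i)) (p2 (p1 (m - 1))) (p2 (m - 1))
    else CB 0 (p2 (m - 1)))" for i m
  have sec: "code_section (d i) n = (if p1 n < b i then nch (c (pr (p1 n) i)) (p2 n) else CB 0)"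
    if "\<not> A i" for i n
    using that by (intro HOL.ext) (simp add: code_section_pr d_def)
  have A: "cmp.dec A" unfolding A_def
    by (intro cintro cmp.C2_app[OF c(1)] cmp.C_comp[OF assms(2)])
  have rkn: "ord1 < \<sigma> i" if "\<not> A i" for i
    using that rk_node_less[OF c(2)] assms(4) unfolding A_def by (meson order_less_le_trans)
  show ?thesis
  proof (rule SRI)
    show "cmp.C2 d" unfolding cmp.C2_def d_def nch_eq
      by (intro cintro cmp.C2_app[OF c(1)] cmp.dec_comp[OF A] cmp.C_comp[OF assms(2)])
    show rk: "rk (\<sigma> i) (d i)" for i
    proof (cases "A i")
      case True then show ?thesis by (intro rk.leaf) (auto simp: d_def assms(3))
    next
      case False
      have "\<exists>y<\<sigma> i. rk y (code_section (d i) n)" for n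
        unfolding sec[OF False] using rk_nch[OF c(2) rkn[OF False] assms(4)] rkn[OF False] rk_CB[of ord1 0]
        by auto
      then show ?thesis using False by (intro rk.node) (auto simp: d_def)
    qed
    show "f \<in> bev (d i) \<longleftrightarrow> (\<exists>k<b i. \<phi> (pr k i) f)" for i f
    proof (cases "A i")
      case True
      then have "f \<in> bev (d i) \<longleftrightarrow> (\<exists>n s. d i (Suc n) = Suc s \<and> pfx s f)"
        by (subst evs_leaf) (auto simp: d_def baire_basis_iff)
      also have "\<dots> \<longleftrightarrow> (\<exists>n. p1 n < b i \<and> (\<exists>s. c (pr (p1 n) i) (Suc (p2 n)) = Suc s \<and> pfx s f))"
        by (rule ex_cong1) (use True in \<open>auto simp: d_def\<close>)
      also have "\<dots> \<longleftrightarrow> (\<exists>k<b i. \<exists>n s. c (pr k i) (Suc n) = Suc s \<and> pfx s f)"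
        by (metis p1_pr p2_pr)
      also have "\<dots> \<longleftrightarrow> (\<exists>k<b i. \<phi> (pr k i) f)"
      proof -
        have "\<phi> (pr k i) f \<longleftrightarrow> (\<exists>n s. c (pr k i) (Suc n) = Suc s \<and> pfx s f)" if "k < b i" for k
          using True that unfolding A_def c(3)[symmetric] by (simp add: evs_leaf baire_basis_iff)
        then show ?thesis by blast
      qed
      finally show ?thesis .
    next
      case False
      then have "f \<in> bev (d i) \<longleftrightarrow> (\<exists>n. f \<notin> bev (code_section (d i) n))"
        by (intro evs_node[OF rk]) (simp add: d_def)
      also have "\<dots> \<longleftrightarrow> (\<exists>n. p1 n < b i \<and> f \<notin> bev (nch (c (pr (p1 n) i)) (p2 n)))"
        unfolding sec[OF False] by (auto simp: evs_CB)
      also have "\<dots> \<longleftrightarrow> (\<exists>k<b i. \<exists>n. f \<notin> bev (nch (c (pr k i)) n))"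
        by (metis p1_pr p2_pr)
      finally show ?thesis using evs_nch[OF c(2)] c(3) by simp
    qed
  qed
qed

lemma S_comp: "S x \<phi> \<Longrightarrow> computable u \<Longrightarrow> S x (\<lambda>i. \<phi> (u i))"
  unfolding S_def using SR_comp[of "\<lambda>_. x"] by simp

section \<open>Closure properties of a class of uniformly Borel families\<close>

named_theorems sintro

locale pos_rank =
  fixes x :: cord
  assumes pos: "ord1 \<le> x"
begin

lemma S_below: assumes "SR \<sigma> \<psi>" "\<And>j. \<sigma> j < x" shows "S x \<psi>" "S x (\<lambda>i f. \<not> \<psi> i f)"
proof -
  show "S x \<psi>" unfolding S_def using assms by (intro SR_mono[OF assms(1)]) (simp add: less_imp_le)
  have "SR (\<lambda>i. \<sigma> (p2 i)) (\<lambda>i. \<psi> (p2 i))" by (rule SR_comp[OF assms(1)]) (intro cintro)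
  from SR_union[OF this, of "\<lambda>_. x"] assms(2) show "S x (\<lambda>i f. \<not> \<psi> i f)" by (simp add: S_def)
qed

lemma S_open:
  assumes "cmp.C2 e" "\<And>i f. \<phi> i f \<longleftrightarrow> (\<exists>n s. e i n = Suc s \<and> pfx s f)"
  shows "S x \<phi>"
  unfolding S_def by (rule SR_leafI[OF assms(1) pos assms(2)])

lemma S_dec [sintro]: assumes "cmp.dec d" shows "S x (\<lambda>i f. d i)"
proof (rule S_open)
  show "cmp.C2 (\<lambda>i n. of_bool (d i))" unfolding cmp.C2_def
    by (intro cintro cmp.dec_comp[OF assms])
  show "d i \<longleftrightarrow> (\<exists>n s. of_bool (d i) = Suc s \<and> pfx s f)" for i f by (auto intro: exI[of _ 0])
qed

lemma S_pfx [sintro]: assumes "computable u" shows "S x (\<lambda>i f. pfx (u i) f)"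
proof (rule S_open)
  show "cmp.C2 (\<lambda>i n. Suc (u i))" unfolding cmp.C2_def by (intro cintro cmp.C_comp[OF assms])
qed auto

lemma S_not_pfx [sintro]: assumes "computable u" shows "S x (\<lambda>i f. \<not> pfx (u i) f)"
proof (rule S_open)
  show "cmp.C2 (\<lambda>i n. if inc n (u i) then Suc n else 0)" unfolding cmp.C2_def
    by (intro cintro cmp.C_comp[OF assms])
qed (auto simp: not_pfx_iff)

lemma S_if [sintro]:
  "cmp.dec d \<Longrightarrow> S x \<phi> \<Longrightarrow> S x \<psi> \<Longrightarrow> S x (\<lambda>i f. if d i then \<phi> i f else \<psi> i f)"
  unfolding S_def using SR_if[of "\<lambda>_. x" \<phi> "\<lambda>_. x" \<psi> d] by simp

lemma S_ex_pr: assumes "S x \<phi>" shows "S x (\<lambda>i f. \<exists>n. \<phi> (pr n i) f)"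
proof (cases "x = ord1")
  case True
  then obtain e where e: "cmp.C2 e" "\<And>i f. \<phi> i f \<longleftrightarrow> (\<exists>n s. e i n = Suc s \<and> pfx s f)"
    using assms by (auto elim: S_1_E)
  show ?thesis
  proof (rule S_open)
    show "cmp.C2 (\<lambda>i n. e (pr (p1 n) i) (p2 n))" unfolding cmp.C2_def
      by (intro cintro cmp.C2_app[OF e(1)])
    show "(\<exists>n. \<phi> (pr n i) f) \<longleftrightarrow> (\<exists>n s. e (pr (p1 n) i) (p2 n) = Suc s \<and> pfx s f)" for i f
      unfolding e(2) by (metis p1_pr p2_pr)
  qed
next
  case False
  then have "ord1 < x" using pos by simp
  from S_normal_SR[OF assms this] obtain \<sigma> \<psi> where \<sigma>: "SR \<sigma> \<psi>" "\<And>j. \<sigma> j < x"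
    "\<And>i f. \<phi> i f \<longleftrightarrow> (\<exists>n. \<not> \<psi> (pr n i) f)" by metis
  have "SR (\<lambda>j. \<sigma> (pr (p1 (p1 j)) (pr (p2 (p1 j)) (p2 j)))) (\<lambda>j. \<psi> (pr (p1 (p1 j)) (pr (p2 (p1 j)) (p2 j))))"
    by (intro SR_comp[OF \<sigma>(1)] cintro)
  from SR_union[OF this, of "\<lambda>_. x"] \<sigma>(2)
  have "S x (\<lambda>i f. \<exists>n. \<not> \<psi> (pr (p1 n) (pr (p2 n) i)) f)" by (simp add: S_def)
  moreover have "(\<exists>n. \<phi> (pr n i) f) \<longleftrightarrow> (\<exists>n. \<not> \<psi> (pr (p1 n) (pr (p2 n) i)) f)" for i f
    unfolding \<sigma>(3) by (metis p1_pr p2_pr)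
  ultimately show ?thesis by simp
qed

lemma S_ex [sintro]: "S x (\<lambda>z. \<phi> (p1 z) (p2 z)) \<Longrightarrow> S x (\<lambda>i f. \<exists>n. \<phi> n i f)"
  by (drule S_ex_pr) simp

text \<open>In the open case an index pairs a choice of one entry for every \<open>k\<close> with a
  stem extending all chosen stems. In the higher case a sequence number of witnesses moves the
  existential quantifier outside, leaving the complement of a finite union of sets of rank below
  \<open>x\<close>.\<close>

lemma S_ball_pr: assumes "computable b" "S x \<phi>" shows "S x (\<lambda>i f. \<forall>k<b i. \<phi> (pr k i) f)"
proof (cases "x = ord1")
  case True
  then obtain e where e: "cmp.C2 e" "\<And>i f. \<phi> i f \<longleftrightarrow> (\<exists>n s. e i n = Suc s \<and> pfx s f)"
    using assms by (auto elim: S_1_E)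
  let ?Q = "\<lambda>s p i. \<forall>k<b i. e (pr k i) (sn s k) \<noteq> 0 \<and> ext p (e (pr k i) (sn s k) - 1)"
  show ?thesis
  proof (rule S_open)
    show "cmp.C2 (\<lambda>i n. if ?Q (p1 n) (p2 n) i then Suc (p2 n) else 0)" unfolding cmp.C2_def
      by (intro cintro cmp.C2_app[OF e(1)] cmp.C_comp[OF assms(1)])
    show "(\<forall>k<b i. \<phi> (pr k i) f) \<longleftrightarrow> (\<exists>n s. (if ?Q (p1 n) (p2 n) i then Suc (p2 n) else 0) = Suc s \<and> pfx s f)"
      for i f
    proof
      assume "\<forall>k<b i. \<phi> (pr k i) f"
      then have "\<forall>k<b i. \<exists>n. e (pr k i) n \<noteq> 0 \<and> pfx (e (pr k i) n - 1) f"
        unfolding e(2) by (metis diff_Suc_1 nat.distinct(1))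
      then obtain g where g: "\<And>k. k < b i \<Longrightarrow> e (pr k i) (g k) \<noteq> 0 \<and> pfx (e (pr k i) (g k) - 1) f" by metis
      obtain s where s: "\<forall>k<b i. sn s k = g k" using ex_seq[of "b i" g] by blast
      obtain p where p: "pfx p f" "sl p = (\<Sum>k<b i. sl (e (pr k i) (g k) - 1))" using ex_pfx by blast
      have "ext p (e (pr k i) (g k) - 1)" if "k < b i" for k
      proof (rule pfx_pfx_ext[OF _ p(1)])
        show "pfx (e (pr k i) (g k) - 1) f" using g[OF that] by simp
        show "sl (e (pr k i) (g k) - 1) \<le> sl p" unfolding p(2)
          by (rule member_le_sum) (use that in auto)
      qed
      then have "?Q s p i" using g s by simp
      then show "\<exists>n s. (if ?Q (p1 n) (p2 n) i then Suc (p2 n) else 0) = Suc s \<and> pfx s f"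
        using p(1) by (intro exI[of _ "pr s p"] exI[of _ p]) simp
    next
      assume "\<exists>n s. (if ?Q (p1 n) (p2 n) i then Suc (p2 n) else 0) = Suc s \<and> pfx s f"
      then obtain n where n: "?Q (p1 n) (p2 n) i" "pfx (p2 n) f" by (auto split: if_splits)
      show "\<forall>k<b i. \<phi> (pr k i) f"
      proof (intro allI impI)
        fix k assume k: "k < b i"
        then have "pfx (e (pr k i) (sn (p1 n) k) - 1) f" using n pfx_ext by blast
        then show "\<phi> (pr k i) f" unfolding e(2) using n(1) k
          by (intro exI[of _ "sn (p1 n) k"] exI[of _ "e (pr k i) (sn (p1 n) k) - 1"]) simp
      qed
    qed
  qed
next
  case False
  then have x: "ord1 < x" using pos by simp
  from S_normal_SR[OF assms(2) this] obtain \<sigma> \<psi> where \<sigma>: "SR \<sigma> \<psi>" "\<And>j. \<sigma> j < x"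
    "\<And>i f. \<phi> i f \<longleftrightarrow> (\<exists>n. \<not> \<psi> (pr n i) f)" by metis
  define u where "u w = pr (sn (p1 (p2 w)) (p1 w)) (pr (p1 w) (p2 (p2 w)))" for w
  \<comment> \<open>A maximum of finitely many ranks stays below \<open>x\<close>; including
    \<open>ord1\<close> gives a legal rank for the empty union as well.\<close>
  define \<rho> where "\<rho> j = Max (insert ord1 ((\<lambda>k. \<sigma> (u (pr k j))) ` {..<b (p2 j)}))" for j
  have u: "computable u" unfolding u_def by (intro cintro)
  have \<rho>: "\<rho> j < x" "ord1 \<le> \<rho> j" "k < b (p2 j) \<Longrightarrow> \<sigma> (u (pr k j)) \<le> \<rho> j" for j k
    unfolding \<rho>_def using x \<sigma>(2) by (auto simp: Max_less_iff intro!: Max_ge)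
  have "SR \<rho> (\<lambda>j f. \<exists>k<b (p2 j). \<psi> (u (pr k j)) f)"
    by (rule SR_bex[OF SR_comp[OF \<sigma>(1) u]]) (auto intro: \<rho> cmp.C_comp[OF assms(1), OF cmp.C_p2[OF cmp.C_id]])
  from SR_union[OF this, of "\<lambda>_. x"] \<rho>(1)
  have "S x (\<lambda>i f. \<exists>s. \<not> (\<exists>k<b i. \<psi> (pr (sn s k) (pr k i)) f))" by (simp add: S_def u_def)
  moreover have "(\<forall>k<b i. \<phi> (pr k i) f) \<longleftrightarrow> (\<exists>s. \<not> (\<exists>k<b i. \<psi> (pr (sn s k) (pr k i)) f))" for i f
  proof
    assume "\<forall>k<b i. \<phi> (pr k i) f"
    then obtain g where g: "\<And>k. k < b i \<Longrightarrow> \<not> \<psi> (pr (g k) (pr k i)) f" unfolding \<sigma>(3) by metis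
    obtain s where "\<forall>k<b i. sn s k = g k" using ex_seq[of "b i" g] by blast
    then show "\<exists>s. \<not> (\<exists>k<b i. \<psi> (pr (sn s k) (pr k i)) f)" using g by (intro exI[of _ s]) auto
  qed (auto simp: \<sigma>(3))
  ultimately show ?thesis by simp
qed

lemma S_ball [sintro]:
  "computable b \<Longrightarrow> S x (\<lambda>z. \<phi> (p1 z) (p2 z)) \<Longrightarrow> S x (\<lambda>i f. \<forall>k<b i. \<phi> k i f)"
  by (drule (1) S_ball_pr) simp

lemma S_conj [sintro]: assumes "S x \<phi>" "S x \<psi>" shows "S x (\<lambda>i f. \<phi> i f \<and> \<psi> i f)"
proof -
  have *: "\<phi> i f \<and> \<psi> i f \<longleftrightarrow> (\<forall>k<2::nat. if k = 0 then \<phi> i f else \<psi> i f)" for i f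
    by (auto simp: numeral_2_eq_2 less_Suc_eq)
  show ?thesis unfolding * by (intro sintro cintro S_comp[OF assms(1)] S_comp[OF assms(2)])
qed

lemma S_disj [sintro]: assumes "S x \<phi>" "S x \<psi>" shows "S x (\<lambda>i f. \<phi> i f \<or> \<psi> i f)"
proof -
  have *: "\<phi> i f \<or> \<psi> i f \<longleftrightarrow> (\<exists>k::nat. if k = 0 then \<phi> i f else \<psi> i f)" for i f
    by (metis zero_neq_one)
  show ?thesis unfolding * by (intro sintro cintro S_comp[OF assms(1)] S_comp[OF assms(2)])
qed

lemma S_bex [sintro]:
  assumes "computable b" "S x (\<lambda>z. \<phi> (p1 z) (p2 z))" shows "S x (\<lambda>i f. \<exists>k<b i. \<phi> k i f)"
  by (intro sintro cintro assms cmp.C_comp[OF assms(1)])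

text \<open>Projections of families that lie in the class together with their complements: searching
  for the first witness is then itself in the class.\<close>

lemma S_normal:
  assumes "S x \<phi>"
  obtains \<psi> where "S x \<psi>" "S x (\<lambda>i f. \<not> \<psi> i f)" "\<And>i f. \<phi> i f \<longleftrightarrow> (\<exists>n. \<psi> (pr n i) f)"
proof (cases "x = ord1")
  case True
  then obtain e where e: "cmp.C2 e" "\<And>i f. \<phi> i f \<longleftrightarrow> (\<exists>n s. e i n = Suc s \<and> pfx s f)"
    using assms by (auto elim: S_1_E)
  let ?\<psi> = "\<lambda>j f. e (p2 j) (p1 j) \<noteq> 0 \<and> pfx (e (p2 j) (p1 j) - 1) f"
  show ?thesis
  proof (rule that)
    show "S x ?\<psi>" by (intro sintro cintro cmp.C2_app[OF e(1)])
    show "S x (\<lambda>i f. \<not> ?\<psi> i f)" unfolding de_Morgan_conj not_not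
      by (intro sintro cintro cmp.C2_app[OF e(1)])
    show "\<phi> i f \<longleftrightarrow> (\<exists>n. ?\<psi> (pr n i) f)" for i f unfolding e(2)
      by (simp, metis Suc_pred diff_Suc_1 nat.distinct(1) not_gr_zero)
  qed
next
  case False
  then have x: "ord1 < x" using pos by simp
  from S_normal_SR[OF assms this] obtain \<sigma> \<psi> where \<sigma>: "SR \<sigma> \<psi>" "\<And>j. \<sigma> j < x"
    "\<And>i f. \<phi> i f \<longleftrightarrow> (\<exists>n. \<not> \<psi> (pr n i) f)" by metis
  show ?thesis by (rule that[of "\<lambda>i f. \<not> \<psi> i f"]) (use S_below[OF \<sigma>(1,2)] \<sigma>(3) in auto)
qed

end

section \<open>Change of presentation\<close>

lemma ex_even_odd: "(\<exists>n::nat. Q n) \<longleftrightarrow> (\<exists>k. Q (2 * k)) \<or> (\<exists>k. Q (Suc (2 * k)))"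
  by (metis evenE oddE Suc_eq_plus1)

text \<open>Preimages of coded sets under maps \<open>F q\<close> defined on clopen sets \<open>{z. E q z}\<close>. The complement of
  the domain is added, so that it drops out of the complements of which unions are formed.\<close>

lemma transfer_codes:
  assumes d: "cmp.C2 d" "\<And>q. rk (\<rho> q) (d q)"
    and v: "cmp.C2 v" and a: "cmp.dec (\<lambda>z. a (p1 z) (p2 z))" and pe: "cmp.C2 pe" and ne: "cmp.C2 ne"
    and E: "\<And>q z. E q z \<longleftrightarrow> (\<exists>n r. pe q n = Suc r \<and> z \<in> N r)"
      "\<And>q z. \<not> E q z \<longleftrightarrow> (\<exists>n r. ne q n = Suc r \<and> z \<in> N r)"
    and F: "\<And>q r z. z \<in> N (v q r) \<and> a q r \<longleftrightarrow> E q z \<and> F q z \<in> M r"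
  obtains c where "cmp.C2 c" "\<And>q. rk (\<rho> q) (c q)"
    "\<And>q z. z \<in> evs N (c q) \<longleftrightarrow> \<not> E q z \<or> F q z \<in> evs M (d q)"
proof -
  text \<open>The node \<open>2 * q\<close> stands for the domain of \<open>F q\<close>, and \<open>Suc (2 * pr q w)\<close> for the preimage of the
    set coded by \<open>sub (d q) w\<close>.\<close>
  define t where "t j = (if even j then 0 else d (p1 (j div 2)) (pre (p2 (j div 2)) 0))" for j
  define ch where "ch j n = (if even n then Suc (2 * pr (p1 (j div 2)) (cons (n div 2) (p2 (j div 2))))
    else 2 * p1 (j div 2))" for j n
  define lf where "lf j m = (if even j then pe (j div 2) m else let q = p1 (j div 2) in
    if even m then let r = d q (pre (p2 (j div 2)) (Suc (m div 2))) in
      if r \<noteq> 0 \<and> a q (r - 1) then Suc (v q (r - 1)) else 0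
    else ne q (m div 2))" for j m
  define s where "s q w = sc t ch lf (Suc (2 * pr q w))" for q w
  define e where "e q = sc t ch lf (2 * q)" for q
  have C: "cmp.C2 (sc t ch lf)"
  proof (rule C2_sc)
    show "computable t" unfolding t_def by (intro cintro cmp.C2_app[OF d(1)])
    show "cmp.C2 ch" unfolding cmp.C2_def ch_def by (intro cintro)
    show "cmp.C2 lf" unfolding cmp.C2_def lf_def Let_def
      by (intro cintro cmp.C2_app[OF d(1)] cmp.C2_app[OF v] cmp.C2_app[OF pe] cmp.C2_app[OF ne] cmp.dec_app2[OF a])
  qed
  have e: "rk ord1 (e q)" "z \<in> evs N (e q) \<longleftrightarrow> E q z" for q z
    unfolding E by (auto simp: evs_leaf e_def t_def lf_def intro: rk.leaf)
  have flag: "s q w 0 = sub (d q) w 0" for q w by (simp add: s_def t_def sub_def)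
  have sec: "code_section (s q w) n = (if even n then s q (cons (n div 2) w) else e q)"
    if "sub (d q) w 0 \<noteq> 0" for q w n
    using that unfolding s_def e_def by (subst sc_section) (auto simp: ch_def t_def sub_def)
  have leaf: "z \<in> evs N (s q w) \<longleftrightarrow> \<not> E q z \<or> F q z \<in> evs M (sub (d q) w)"
    if 0: "sub (d q) w 0 = 0" for q w z
  proof -
    let ?r = "\<lambda>n. sub (d q) w (Suc n)"
    have ev: "s q w (Suc (2 * n)) = (if ?r n \<noteq> 0 \<and> a q (?r n - 1) then Suc (v q (?r n - 1)) else 0)" for n
      using 0 by (simp add: s_def t_def lf_def Let_def sub_def)
    have od: "s q w (Suc (Suc (2 * n))) = ne q n" for n
      using 0 by (simp add: s_def t_def lf_def sub_def)
    have "z \<in> evs N (s q w) \<longleftrightarrow> (\<exists>n y. s q w (Suc n) = Suc y \<and> z \<in> N y)"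
      by (rule evs_leaf) (simp add: flag 0)
    also have "\<dots> \<longleftrightarrow> (\<exists>n y. s q w (Suc (2 * n)) = Suc y \<and> z \<in> N y) \<or> \<not> E q z"
      unfolding E(2) by (subst ex_even_odd) (simp only: od)
    also have "(\<exists>n y. s q w (Suc (2 * n)) = Suc y \<and> z \<in> N y) \<longleftrightarrow>
      (\<exists>n. ?r n \<noteq> 0 \<and> a q (?r n - 1) \<and> z \<in> N (v q (?r n - 1)))"
      unfolding ev by (rule ex_cong1) auto
    also have "\<dots> \<longleftrightarrow> (\<exists>n y. ?r n = Suc y \<and> E q z \<and> F q z \<in> M y)"
      unfolding F[symmetric] by (metis diff_Suc_1 not0_implies_Suc nat.distinct(1))
    finally show ?thesis unfolding evs_leaf[of "sub (d q) w", OF 0] by blast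
  qed
  have main: "rk y (sub (d q) w) \<Longrightarrow> rk y (s q w) \<and>
    (\<forall>z. z \<in> evs N (s q w) \<longleftrightarrow> \<not> E q z \<or> F q z \<in> evs M (sub (d q) w))" for y q w
  proof (induction y arbitrary: w rule: less_induct)
    case (less y)
    show ?case
    proof (cases "sub (d q) w 0 = 0")
      case True
      then show ?thesis using rk_ord1_le[OF less.prems] leaf by (auto intro!: rk.leaf simp: flag)
    next
      case False
      have IH: "\<exists>z<y. rk z (s q (cons n w))"
        "z \<in> evs N (s q (cons n w)) \<longleftrightarrow> \<not> E q z \<or> F q z \<in> evs M (sub (d q) (cons n w))" for n z
        using rk_section[OF less.prems False, of n] less.IH unfolding section_sub by blast+
      have rk: "rk y (s q w)"
      proof (rule rk.node)
        show "\<forall>n. \<exists>z<y. rk z (code_section (s q w) n)"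
          unfolding sec[OF False] using IH(1) e(1) rk_node_less[OF less.prems False] by auto
      qed (use rk_flag[OF less.prems False] in \<open>simp add: flag\<close>)
      have "z \<in> evs N (s q w) \<longleftrightarrow> \<not> E q z \<or> F q z \<in> evs M (sub (d q) w)" for z
      proof -
        have "z \<in> evs N (s q w) \<longleftrightarrow> (\<exists>n. z \<notin> evs N (code_section (s q w) n))"
          by (rule evs_node[OF rk]) (use False in \<open>simp add: flag\<close>)
        also have "\<dots> \<longleftrightarrow> (\<exists>n. z \<notin> evs N (s q (cons n w))) \<or> z \<notin> evs N (e q)"
          unfolding sec[OF False] by (subst ex_even_odd) simp
        finally show ?thesis unfolding IH(2) e(2) evs_node[OF less.prems False] section_sub by blast
      qed
      with rk show ?thesis by blast
    qed
  qed
  show ?thesis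
  proof (rule that[of "\<lambda>q. s q 0"])
    show "cmp.C2 (\<lambda>q. s q 0)" unfolding cmp.C2_def s_def by (intro cmp.C2_app[OF C] cintro)
  qed (use main[of _ _ 0] d(2) in auto)
qed

text \<open>The case of everywhere defined maps from Baire space: \<open>a\<close> checks the number
  coordinates fixed by \<open>i\<close>, and \<open>u s\<close> is the stem required of the
  real.\<close>

lemma SR_of_codes:
  assumes c: "cmp.C2 c" "\<And>i. rk (\<rho> i) (c i)"
    and u: "computable u" and a: "cmp.dec (\<lambda>z. a (p1 z) (p2 z))"
    and \<xi>: "\<And>i f s. \<xi> i f \<in> N s \<longleftrightarrow> a i s \<and> pfx (u s) f"
  shows "SR \<rho> (\<lambda>i f. \<xi> i f \<in> evs N (c i))"
proof (rule transfer_codes[OF c, where v = "\<lambda>_. u" and a = a and pe = "\<lambda>_ _. 1" and ne = "\<lambda>_ _. 0"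
      and E = "\<lambda>_ _. True" and F = \<xi> and M = N and N = baire_basis])
  show "cmp.C2 (\<lambda>_. u)" "cmp.C2 (\<lambda>_ _. 1)" "cmp.C2 (\<lambda>_ _. 0)" unfolding cmp.C2_def
    by (intro cintro cmp.C_comp[OF u])+
  show "cmp.dec (\<lambda>z. a (p1 z) (p2 z))" by (rule a)
  fix c' assume "cmp.C2 c'" "\<And>q. rk (\<rho> q) (c' q)"
    "\<And>q z. z \<in> bev (c' q) \<longleftrightarrow> \<not> True \<or> \<xi> q z \<in> evs N (c q)"
  then show ?thesis by (intro SRI) auto
qed (auto simp: baire_basis_iff \<xi>)

text \<open>The coded point selects its own index. Child \<open>q\<close> lives on the clopen slice
  \<open>\<pi> z = p2 q\<close> and is everything outside it, so that in the union of complements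
  only the right index counts. By \<open>a i 0\<close>, the basic set with number
  \<open>v i 0\<close> is the slice of \<open>i\<close>.\<close>

lemma code_of_S:
  assumes x: "ord1 \<le> x" and \<phi>: "S x \<phi>"
    and v: "cmp.C2 v" and a: "cmp.dec (\<lambda>z. a (p1 z) (p2 z))" and a0: "\<And>i. a i 0"
    and basis: "\<And>i s z. z \<in> N (v i s) \<and> a i s \<longleftrightarrow> \<pi> z = i \<and> pfx s (F z)"
  shows "\<exists>c. computable c \<and> rk x c \<and> (\<forall>z. z \<in> evs N c \<longleftrightarrow> \<phi> (\<pi> z) (F z))"
proof (cases "x = ord1")
  case True
  then obtain e where e: "cmp.C2 e" "\<And>i f. \<phi> i f \<longleftrightarrow> (\<exists>n s. e i n = Suc s \<and> pfx s f)"
    using \<phi> by (auto elim: S_1_E)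
  define c where "c m = (if m = 0 then 0 else
    let i = p1 (m - 1); r = e i (p2 (m - 1)) in if r \<noteq> 0 \<and> a i (r - 1) then Suc (v i (r - 1)) else 0)" for m
  have "computable c" unfolding c_def Let_def
    by (intro cintro cmp.C2_app[OF e(1)] cmp.C2_app[OF v] cmp.dec_app2[OF a])
  moreover have "rk x c" by (rule rk.leaf) (auto simp: c_def x)
  moreover have "z \<in> evs N c \<longleftrightarrow> \<phi> (\<pi> z) (F z)" for z
  proof -
    let ?r = "\<lambda>n. e (p1 n) (p2 n)"
    have c: "c (Suc n) = (if ?r n \<noteq> 0 \<and> a (p1 n) (?r n - 1) then Suc (v (p1 n) (?r n - 1)) else 0)" for n
      by (simp add: c_def Let_def)
    have "z \<in> evs N c \<longleftrightarrow> (\<exists>n s. c (Suc n) = Suc s \<and> z \<in> N s)"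
      by (rule evs_leaf) (simp add: c_def)
    also have "\<dots> \<longleftrightarrow> (\<exists>n. ?r n \<noteq> 0 \<and> z \<in> N (v (p1 n) (?r n - 1)) \<and> a (p1 n) (?r n - 1))"
      unfolding c by (rule ex_cong1) auto
    also have "\<dots> \<longleftrightarrow> (\<exists>n. e (\<pi> z) n \<noteq> 0 \<and> pfx (e (\<pi> z) n - 1) (F z))"
      unfolding basis by (metis p1_pr p2_pr)
    also have "\<dots> \<longleftrightarrow> \<phi> (\<pi> z) (F z)" unfolding e(2) by (metis diff_Suc_1 not0_implies_Suc nat.distinct(1))
    finally show ?thesis .
  qed
  ultimately show ?thesis by blast
next
  case False
  then have "ord1 < x" using x by simp
  from S_normal_SR[OF \<phi> this] obtain \<sigma> \<psi> where \<sigma>: "SR \<sigma> \<psi>" "\<And>j. \<sigma> j < x"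
    "\<And>i f. \<phi> i f \<longleftrightarrow> (\<exists>n. \<not> \<psi> (pr n i) f)" by metis
  obtain d where d: "cmp.C2 d" "\<And>q. rk (\<sigma> q) (d q)" "\<And>q f. f \<in> bev (d q) \<longleftrightarrow> \<psi> q f"
    using \<sigma>(1) unfolding SR_def by blast
  have eq0: "z \<in> N (v i 0) \<longleftrightarrow> \<pi> z = i" for i z using basis[of z i 0] a0 by simp
  obtain s where s: "cmp.C2 s" "\<And>q. rk (\<sigma> q) (s q)"
    "\<And>q z. z \<in> evs N (s q) \<longleftrightarrow> \<not> \<pi> z = p2 q \<or> F z \<in> bev (d q)"
  proof (rule transfer_codes[OF d(1,2), where v = "\<lambda>q. v (p2 q)" and a = "\<lambda>q. a (p2 q)"
        and pe = "\<lambda>q n. Suc (v (p2 q) 0)" and ne = "\<lambda>q n. if n \<noteq> p2 q then Suc (v n 0) else 0"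
        and E = "\<lambda>q z. \<pi> z = p2 q" and F = "\<lambda>_. F" and M = baire_basis and N = N])
    show "cmp.C2 (\<lambda>q. v (p2 q))" "cmp.C2 (\<lambda>q n. Suc (v (p2 q) 0))"
      "cmp.C2 (\<lambda>q n. if n \<noteq> p2 q then Suc (v n 0) else 0)"
      unfolding cmp.C2_def by (intro cintro cmp.C2_app[OF v])+
    show "cmp.dec (\<lambda>z. a (p2 (p1 z)) (p2 z))" by (intro cintro cmp.dec_app2[OF a])
  qed (auto simp: eq0 basis baire_basis_iff split: if_splits)
  define c where "c m = (if m = 0 then 1 else s (p1 (m - 1)) (p2 (m - 1)))" for m
  have sec: "code_section c q = s q" for q by (rule HOL.ext) (simp add: code_section_pr c_def)
  have "computable c" unfolding c_def by (intro cintro cmp.C2_app[OF s(1)])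
  moreover have rk: "rk x c"
  proof (rule rk.node)
    show "\<forall>n. \<exists>y<x. rk y (code_section c n)" unfolding sec using s(2) \<sigma>(2) by blast
  qed (simp add: c_def)
  moreover have "z \<in> evs N c \<longleftrightarrow> \<phi> (\<pi> z) (F z)" for z
  proof -
    have "z \<in> evs N c \<longleftrightarrow> (\<exists>q. \<pi> z = p2 q \<and> \<not> \<psi> q (F z))"
      using evs_node[OF rk, of z N] by (simp add: sec s(3) d(3) c_def)
    also have "\<dots> \<longleftrightarrow> (\<exists>n. \<not> \<psi> (pr n (\<pi> z)) (F z))" by (metis p2_pr pr_p1_p2)
    finally show ?thesis by (simp add: \<sigma>(3))
  qed
  ultimately show ?thesis by blast
qed

section \<open>Cohen forcing\<close>

text \<open>Strong forcing as the value of the code in the algebra of sets of conditions: a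
  complement is forced when no extension forces the set.\<close>

definition forces :: "nat \<Rightarrow> (nat \<Rightarrow> nat) \<Rightarrow> bool" where
  "forces p c \<longleftrightarrow> p \<in> ev (\<lambda>c. {p. \<exists>n s. c (Suc n) = Suc s \<and> ext p s})
    (\<lambda>P. {p. \<exists>n. \<forall>q. ext q p \<longrightarrow> q \<notin> P n}) c"

text \<open>The failure of \<open>compat p c\<close> is forcing of the complement of the coded
  set.\<close>

definition compat :: "nat \<Rightarrow> (nat \<Rightarrow> nat) \<Rightarrow> bool" where
  "compat p c \<longleftrightarrow> (\<exists>q. ext q p \<and> forces q c)"

lemma forces_leaf: "c 0 = 0 \<Longrightarrow> forces p c \<longleftrightarrow> (\<exists>n s. c (Suc n) = Suc s \<and> ext p s)"
  unfolding forces_def by (subst ev_leaf) auto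

lemma forces_node: "rk x c \<Longrightarrow> c 0 \<noteq> 0 \<Longrightarrow> forces p c \<longleftrightarrow> (\<exists>n. \<not> compat p (code_section c n))"
  unfolding forces_def compat_def by (subst ev_node) auto

lemma compat_mono: "compat q c \<Longrightarrow> ext q p \<Longrightarrow> compat p c"
  unfolding compat_def using ext_trans by blast

lemma forces_mono: "rk x c \<Longrightarrow> forces p c \<Longrightarrow> ext q p \<Longrightarrow> forces q c"
  using forces_leaf[of c] forces_node[of x c] ext_trans compat_mono by metis

definition decided :: "(nat \<Rightarrow> nat) \<Rightarrow> (nat \<Rightarrow> nat) \<Rightarrow> bool" where
  "decided f c \<longleftrightarrow> (\<exists>p. pfx p f \<and> (forces p c \<or> \<not> compat p c))"

lemma computable_section: assumes "computable c" shows "computable (code_section c n)"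
proof -
  have "computable (\<lambda>m. c (Suc (pr n m)))" by (intro cmp.C_comp[OF assms] cintro)
  then show ?thesis by (simp add: code_section_pr[abs_def])
qed

text \<open>Decisions are needed only at the children of a node: \<open>f\<close> avoids a decided
  child iff some stem of \<open>f\<close> has no extension forcing it. Sections of computable codes
  are computable, so being generic for countably many codes suffices.\<close>

lemma truth:
  assumes "rk x c" "computable c"
    "\<And>d y. computable d \<Longrightarrow> rk y d \<Longrightarrow> y < x \<Longrightarrow> decided f d"
  shows "f \<in> bev c \<longleftrightarrow> (\<exists>p. pfx p f \<and> forces p c)"
  using assms
proof (induction x arbitrary: c rule: less_induct)
  case (less x)
  show ?case
  proof (cases "c 0 = 0")
    case True
    then show ?thesis by (auto simp: evs_leaf forces_leaf baire_basis_iff intro: pfx_ext ext_refl)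
  next
    case False
    have "f \<notin> bev (code_section c n) \<longleftrightarrow> (\<exists>p. pfx p f \<and> \<not> compat p (code_section c n))" for n
    proof -
      obtain y where y: "y < x" "rk y (code_section c n)" using rk_section[OF less.prems(1) False] by blast
      have IH: "f \<in> bev (code_section c n) \<longleftrightarrow> (\<exists>p. pfx p f \<and> forces p (code_section c n))"
        by (rule less.IH[OF y computable_section[OF less.prems(2)]]) (use y less.prems(3) in auto)
      have "decided f (code_section c n)"
        using less.prems(3)[OF computable_section[OF less.prems(2)] y(2,1)] .
      then show ?thesis unfolding IH decided_def
        using pfx_pfx_cases forces_mono[OF y(2)] ext_refl ext_trans unfolding compat_def by metis
    qed
    then show ?thesis
      using evs_node[OF less.prems(1) False] forces_node[OF less.prems(1) False] by metis
  qed
qed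

lemma not_compat_CB: "\<not> compat p (CB e) \<longleftrightarrow> (\<exists>s. e = Suc s \<and> ext p s)"
proof (cases e)
  case 0
  have "compat p (CB 0)" unfolding compat_def
    by (rule exI[of _ p], subst forces_leaf) (auto simp: CB_def intro!: exI[of _ 0])
  then show ?thesis by (simp add: 0)
next
  case (Suc s)
  have "forces q (CB e) \<longleftrightarrow> (\<exists>u. inc u s \<and> ext q u)" for q
    by (subst forces_leaf) (auto simp: CB_def Suc)
  then have "compat p (CB e) \<longleftrightarrow> (\<exists>q. ext q p \<and> inc q s)"
    unfolding compat_def by (metis ext_refl inc_ext)
  also have "\<dots> \<longleftrightarrow> \<not> ext p s"
    using ex_ext_inc inc_ext[of _ s] ext_refl ext_trans by (metis inc_def ext_def)
  finally show ?thesis by (simp add: Suc)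
qed

text \<open>At a node, \<open>compat p c\<close> unfolds to a union, over the extensions
  \<open>q\<close> of \<open>p\<close> and all \<open>n\<close>, of the complements of
  \<open>compat q\<close> at child \<open>n\<close>; hence the rank is kept. The coded sets are
  trivial, containing every \<open>f\<close> or none.\<close>

lemma SR_compat:
  assumes c: "cmp.C2 c" "\<And>i. rk (\<rho> i) (c i)"
  shows "SR (\<lambda>j. \<rho> (p1 j)) (\<lambda>j f. compat (p2 j) (c (p1 j)))"
proof -
  text \<open>The node \<open>Suc (pr i (pr w p))\<close> stands for \<open>compat p (sub (c i) w)\<close>; the node \<open>0\<close> is true.\<close>
  define t where "t j = (if j = 0 then 0 else c (p1 (j - 1)) (pre (p1 (p2 (j - 1))) 0))" for j
  define ch where "ch j n = (if ext (p2 n) (p2 (p2 (j - 1)))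
    then Suc (pr (p1 (j - 1)) (pr (cons (p1 n) (p1 (p2 (j - 1)))) (p2 n))) else 0)" for j n
  define lf where "lf j m = (if j = 0 then 1 else let e = c (p1 (j - 1)) (pre (p1 (p2 (j - 1))) (Suc (p1 m))) in
    if e \<noteq> 0 \<and> ext (p2 m) (p2 (p2 (j - 1))) \<and> ext (p2 m) (e - 1) then 1 else (0::nat))" for j m
  define s where "s i w p = sc t ch lf (Suc (pr i (pr w p)))" for i w p
  have C: "cmp.C2 (sc t ch lf)"
  proof (rule C2_sc)
    show "computable t" unfolding t_def by (intro cintro cmp.C_pred cmp.C2_app[OF c(1)])
    show "cmp.C2 ch" unfolding cmp.C2_def ch_def Let_def by (intro cintro cmp.C_pred)
    show "cmp.C2 lf" unfolding cmp.C2_def lf_def Let_def by (intro cintro cmp.C_pred cmp.C2_app[OF c(1)])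
  qed
  have top: "f \<in> bev (sc t ch lf 0)" "rk ord1 (sc t ch lf 0)" for f
    by (auto simp: evs_leaf t_def lf_def baire_basis_iff intro: rk.leaf)
  have ent0: "(\<exists>n s. (if P n then 1 else 0) = Suc s \<and> pfx s f) \<longleftrightarrow> (\<exists>n. P n)" for P :: "nat \<Rightarrow> bool" and f
    by (auto intro!: exI[of _ 0])
  have flag: "s i w p 0 = sub (c i) w 0" for i w p by (simp add: s_def t_def sub_def)
  have sec: "code_section (s i w p) n = (if ext (p2 n) p then s i (cons (p1 n) w) (p2 n) else sc t ch lf 0)"
    if "sub (c i) w 0 \<noteq> 0" for i w p n
    using that unfolding s_def by (subst sc_section) (auto simp: ch_def t_def sub_def)
  have leaf: "f \<in> bev (s i w p) \<longleftrightarrow> compat p (sub (c i) w)"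
    if "sub (c i) w 0 = 0" for f i w p
  proof -
    let ?P = "\<lambda>n. sub (c i) w (Suc (p1 n)) \<noteq> 0 \<and> ext (p2 n) p \<and> ext (p2 n) (sub (c i) w (Suc (p1 n)) - 1)"
    have lf: "s i w p (Suc n) = (if ?P n then 1 else 0)" for n
      using that by (simp add: s_def t_def lf_def Let_def sub_def)
    have "f \<in> bev (s i w p) \<longleftrightarrow> (\<exists>n r. s i w p (Suc n) = Suc r \<and> pfx r f)"
      by (subst evs_leaf) (simp_all only: flag that baire_basis_iff)
    also have "\<dots> \<longleftrightarrow> (\<exists>n. ?P n)" unfolding lf by (rule ent0)
    also have "\<dots> \<longleftrightarrow> (\<exists>q. ext q p \<and> (\<exists>n s. sub (c i) w (Suc n) = Suc s \<and> ext q s))"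
      by (metis Suc_pred diff_Suc_1 nat.distinct(1) not_gr_zero p1_pr p2_pr)
    finally show ?thesis using that by (simp add: compat_def forces_leaf)
  qed
  have main: "rk y (sub (c i) w) \<Longrightarrow> rk y (s i w p) \<and>
    (\<forall>f. f \<in> bev (s i w p) \<longleftrightarrow> compat p (sub (c i) w))" for y i w p
  proof (induction y arbitrary: w p rule: less_induct)
    case (less y)
    show ?case
    proof (cases "sub (c i) w 0 = 0")
      case True
      then show ?thesis using rk_ord1_le[OF less.prems] leaf by (auto intro!: rk.leaf simp: flag)
    next
      case False
      have IH: "\<exists>z<y. rk z (s i (cons n w) q)"
        "f \<in> bev (s i (cons n w) q) \<longleftrightarrow> compat q (sub (c i) (cons n w))" for n f q
        using rk_section[OF less.prems False, of n] less.IH unfolding section_sub by blast+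
      have rk: "rk y (s i w p)"
      proof (rule rk.node)
        show "\<forall>n. \<exists>z<y. rk z (code_section (s i w p) n)"
          unfolding sec[OF False] using IH(1) top(2) rk_node_less[OF less.prems False] by auto
      qed (use rk_flag[OF less.prems False] in \<open>simp add: flag\<close>)
      have "f \<in> bev (s i w p) \<longleftrightarrow> compat p (sub (c i) w)" for f
      proof -
        have "f \<in> bev (s i w p) \<longleftrightarrow> (\<exists>n. f \<notin> bev (code_section (s i w p) n))"
          by (rule evs_node[OF rk]) (use False in \<open>simp add: flag\<close>)
        also have "\<dots> \<longleftrightarrow> (\<exists>n. ext (p2 n) p \<and> \<not> compat (p2 n) (sub (c i) (cons (p1 n) w)))"
          unfolding sec[OF False] using IH(2) top(1) by auto
        also have "\<dots> \<longleftrightarrow> compat p (sub (c i) w)"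
          unfolding compat_def[of p] forces_node[OF less.prems False] section_sub by (metis p1_pr p2_pr)
        finally show ?thesis .
      qed
      with rk show ?thesis by blast
    qed
  qed
  have "cmp.C2 (\<lambda>j. s (p1 j) 0 (p2 j))" unfolding cmp.C2_def s_def
    by (intro cmp.C2_app[OF C] cintro)
  then show ?thesis by (rule SRI) (use main[of _ _ 0] c(2) in auto)
qed

text \<open>Above \<open>ord1\<close>, being forced means that \<open>compat\<close> fails at some
  child, a union of complements of sets of smaller rank. Leaves are rewritten by \<open>nch\<close>,
  so that all codes are treated alike.\<close>

lemma S_forces:
  assumes c: "cmp.C2 c" "\<And>i. rk x (c i)" and x: "ord1 \<le> x"
  shows "S x (\<lambda>j f. forces (p2 j) (c (p1 j)))"
proof -
  interpret pos_rank x by unfold_locales (rule x)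
  show ?thesis
  proof (cases "x = ord1")
    case True
    then have "c i 0 = 0" for i using rk_node_less[OF c(2)] by blast
    then have "forces (p2 j) (c (p1 j)) \<longleftrightarrow>
        (\<exists>n. c (p1 j) (Suc n) \<noteq> 0 \<and> ext (p2 j) (c (p1 j) (Suc n) - 1))" for j
      by (simp add: forces_leaf) (metis Suc_pred diff_Suc_1 nat.distinct(1) not_gr_zero)
    then show ?thesis by (simp only:) (intro sintro cintro cmp.C2_app[OF c(1)])
  next
    case False
    let ?d = "\<lambda>j. nch (c (p2 j)) (p1 j)"
    have "\<forall>j. \<exists>y<x. rk y (?d j)" using rk_nch[OF c(2) _ order_refl] False x by simp
    then obtain \<sigma> where \<sigma>: "\<And>j. \<sigma> j < x" "\<And>j. rk (\<sigma> j) (?d j)" by metis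
    have "cmp.C2 ?d" unfolding cmp.C2_def nch_eq by (intro cintro cmp.C2_app[OF c(1)])
    from S_below(2)[OF SR_compat[OF this \<sigma>(2)] \<sigma>(1)]
    have "S x (\<lambda>j f. \<exists>n. \<not> compat (p2 j) (nch (c (p1 j)) n))"
      by (intro S_ex) (drule S_comp[of _ _ "\<lambda>z. pr (pr (p1 z) (p1 (p2 z))) (p2 (p2 z))"]; (intro cintro)?; simp)
    moreover have "forces p (c i) \<longleftrightarrow> (\<exists>n. \<not> compat p (nch (c i) n))" for p i
      using forces_leaf[of "c i" p] forces_node[OF c(2), of i p]
      by (cases "c i 0 = 0") (auto simp: nch_def not_compat_CB)
    ultimately show ?thesis by simp
  qed
qed

section \<open>Universal families for the forcing relation\<close>

text \<open>An index \<open>d = pr e w\<close> describes the subcode at \<open>w\<close> of the code computed by the program \<open>e\<close>.\<close>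

definition gives :: "nat \<Rightarrow> nat \<Rightarrow> nat \<Rightarrow> nat \<Rightarrow> bool" where
  "gives d m y t \<longleftrightarrow> Tr (p1 d) (pre (p2 d) m) y t"

definition cch :: "nat \<Rightarrow> nat \<Rightarrow> nat" where "cch d m = pr (p1 d) (cons m (p2 d))"

definition good :: "nat \<Rightarrow> (nat \<Rightarrow> nat) \<Rightarrow> bool" where
  "good d c \<longleftrightarrow> (\<forall>m y. c m = y \<longleftrightarrow> (\<exists>t. gives d m y t))"

lemma good_cch: "good d c \<Longrightarrow> good (cch d n) (code_section c n)"
  unfolding good_def gives_def cch_def by (simp add: pre_cons code_section_pr)

lemma ex_good: assumes "computable c" shows "\<exists>d. good d c"
proof -
  obtain e where "\<forall>x y. c x = y \<longleftrightarrow> (\<exists>t. Tr e x y t)" using Tr_enumerates[OF assms] by blast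
  then have "good (pr e 0) c" by (simp add: good_def gives_def)
  then show ?thesis ..
qed

context fclass
begin

lemma dec_gives [cintro]:
  assumes "C a" "C b" "C c" "C d" shows "dec (\<lambda>x. gives (a x) (b x) (c x) (d x))"
  unfolding gives_def by (intro cintro assms)

lemma C_cch [cintro]: assumes "C a" "C b" shows "C (\<lambda>x. cch (a x) (b x))"
  unfolding cch_def by (intro cintro assms)

end

text \<open>The computations encoded in \<open>n\<close> may show that the code described by \<open>d\<close> is a leaf with this
  entry; if they do not, the entry is void.\<close>

definition opc :: "nat \<Rightarrow> nat \<Rightarrow> nat" where
  "opc d n = (if gives d 0 0 (p1 (p2 n)) \<and> gives d (Suc (p1 (p1 n))) (Suc (p2 (p1 n))) (p2 (p2 n))
    then Suc (p2 (p1 n)) else 0)"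

lemma (in fclass) C_opc [cintro]: assumes "C a" "C b" shows "C (\<lambda>x. opc (a x) (b x))"
  unfolding opc_def by (intro cintro assms)

lemma opc_iff: assumes "good d c"
  shows "(\<exists>n. opc d n = Suc s) \<longleftrightarrow> c 0 = 0 \<and> (\<exists>m. c (Suc m) = Suc s)"
proof
  assume "\<exists>n. opc d n = Suc s"
  then obtain n where n: "opc d n = Suc s" ..
  then have "gives d 0 0 (p1 (p2 n))" "gives d (Suc (p1 (p1 n))) (Suc s) (p2 (p2 n))"
    by (auto simp: opc_def split: if_splits)
  then show "c 0 = 0 \<and> (\<exists>m. c (Suc m) = Suc s)" using assms unfolding good_def by metis
next
  assume "c 0 = 0 \<and> (\<exists>m. c (Suc m) = Suc s)"
  then obtain m t u where "gives d 0 0 t" "gives d (Suc m) (Suc s) u"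
    using assms unfolding good_def by metis
  then have "opc d (pr (pr m s) (pr t u)) = Suc s" by (simp add: opc_def)
  then show "\<exists>n. opc d n = Suc s" ..
qed

text \<open>A description may belong to no code at all, so \<open>u\<close> cannot wait to learn
  whether it describes a leaf. It carries both possibilities: even children hold the open part, odd
  ones stand for the subcodes, and void places are filled with \<open>CB 0\<close>.\<close>

lemma forces_split:
  assumes "rk x u" "u 0 = 1" "good d c"
    "\<And>n. code_section u n = (if even n then CB (opc d (n div 2)) else if P (n div 2) then v (n div 2) else CB 0)"
  shows "forces p u \<longleftrightarrow> (c 0 = 0 \<and> forces p c) \<or> (\<exists>k. P k \<and> \<not> compat p (v k))"
proof -
  have "forces p u \<longleftrightarrow> (\<exists>n. \<not> compat p (code_section u n))"
    by (rule forces_node[OF assms(1)]) (simp add: assms(2))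
  also have "\<dots> \<longleftrightarrow> (\<exists>k. \<not> compat p (CB (opc d k))) \<or> (\<exists>k. P k \<and> \<not> compat p (v k))"
    unfolding assms(4) by (subst ex_even_odd) (auto simp: not_compat_CB split: if_splits)
  also have "(\<exists>k. \<not> compat p (CB (opc d k))) \<longleftrightarrow> c 0 = 0 \<and> forces p c"
    unfolding not_compat_CB using opc_iff[OF assms(3)] forces_leaf[of c p] by metis
  finally show ?thesis .
qed

lemma good_1: "good d c \<Longrightarrow> c 0 = 1 \<longleftrightarrow> (\<exists>t. gives d 0 1 t)"
  by (simp add: good_def)

lemma forces_via_sections:
  assumes "rk x c" "good d c"
    "c 0 = 1 \<Longrightarrow> (\<exists>k. P k \<and> \<not> compat p (v k)) \<longleftrightarrow> (\<exists>m. \<not> compat p (code_section c m))"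
    "c 0 \<noteq> 1 \<Longrightarrow> \<not> (\<exists>k. P k)"
  shows "(c 0 = 0 \<and> forces p c) \<or> (\<exists>k. P k \<and> \<not> compat p (v k)) \<longleftrightarrow> forces p c"
  using assms forces_node[OF assms(1)] rk_flag[OF assms(1)] by (metis one_neq_zero)

text \<open>The rank bound is demanded for every index, even one that describes no code. Agreement
  is demanded of the forcing relations only, which is all that deciding a code involves.\<close>

definition Univ :: "cord \<Rightarrow> (nat \<Rightarrow> nat \<Rightarrow> nat) \<Rightarrow> bool" where
  "Univ x u \<longleftrightarrow> cmp.C2 u \<and> (\<forall>d. rk x (u d)) \<and>
    (\<forall>d c. good d c \<longrightarrow> rk x c \<longrightarrow> (\<forall>p. forces p (u d) \<longleftrightarrow> forces p c))"

lemma Univ_ord1: "\<exists>u. Univ ord1 u"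
proof -
  let ?u = "\<lambda>d m. if m = 0 then 0 else opc d (m - 1)"
  have "cmp.C2 ?u" unfolding cmp.C2_def by (intro cintro)
  moreover have "rk ord1 (?u d)" for d by (rule rk.leaf) auto
  moreover have "forces p (?u d) \<longleftrightarrow> forces p c" if "good d c" "rk ord1 c" for d c p
  proof -
    have "c 0 = 0" using rk_node_less[OF that(2)] by blast
    then have "forces p c \<longleftrightarrow> (\<exists>s. (\<exists>n. opc d n = Suc s) \<and> ext p s)"
      using opc_iff[OF that(1)] by (auto simp: forces_leaf)
    then show ?thesis by (subst forces_leaf) auto
  qed
  ultimately show ?thesis unfolding Univ_def by blast
qed

text \<open>Common part of the successor and limit steps, which then only have to supply codes below
  \<open>x\<close> standing in for the subcodes.\<close>

lemma Univ_union:
  assumes V: "cmp.C2 V" and h: "cmp.C2 h" and P: "cmp.dec (\<lambda>z. P (p1 z) (p2 z))" and x: "ord1 < x"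
    and rkV: "\<And>d k. P d k \<Longrightarrow> \<exists>y<x. rk y (V (h d k))"
    and eq: "\<And>d c p. good d c \<Longrightarrow> rk x c \<Longrightarrow> c 0 = 1 \<Longrightarrow>
      (\<exists>k. P d k \<and> \<not> compat p (V (h d k))) \<longleftrightarrow> (\<exists>m. \<not> compat p (code_section c m))"
    and no: "\<And>d k. P d k \<Longrightarrow> \<exists>t. gives d 0 1 t"
  shows "\<exists>u. Univ x u"
proof -
  define w where "w d m = (if m = 0 then 1 else let n = p1 (m - 1); r = p2 (m - 1); k = n div 2 in
    if even n then CB (opc d k) r else if P d k then V (h d k) r else CB 0 r)" for d m
  have sec: "code_section (w d) n = (if even n then CB (opc d (n div 2)) else
    if P d (n div 2) then V (h d (n div 2)) else CB 0)" for d n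
    by (rule HOL.ext) (simp add: code_section_pr w_def Let_def)
  have "cmp.C2 w" unfolding cmp.C2_def w_def Let_def
    by (intro cintro cmp.C2_app[OF V] cmp.C2_app[OF h] cmp.dec_app2[OF P])
  moreover have rk: "rk x (w d)" for d
  proof (rule rk.node)
    show "\<forall>n. \<exists>y<x. rk y (code_section (w d) n)"
      unfolding sec using rkV rk_CB[OF order_refl] x by auto
  qed (simp add: w_def)
  moreover have "forces p (w d) \<longleftrightarrow> forces p c" if d: "good d c" "rk x c" for d c p
  proof -
    have "forces p (w d) \<longleftrightarrow> (c 0 = 0 \<and> forces p c) \<or> (\<exists>k. P d k \<and> \<not> compat p (V (h d k)))"
      by (rule forces_split[OF rk _ d(1)]) (simp_all add: sec w_def)
    also have "\<dots> \<longleftrightarrow> forces p c"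
      by (rule forces_via_sections[OF d(2,1)]) (use eq[OF d] no good_1[OF d(1)] in blast)+
    finally show ?thesis .
  qed
  ultimately show ?thesis unfolding Univ_def by blast
qed

lemma Univ_succ:
  assumes "Univ y u" "y < x" "\<And>z. z < x \<Longrightarrow> z \<le> y"
  shows "\<exists>u. Univ x u"
proof -
  have u: "cmp.C2 u" "\<And>d. rk y (u d)"
    "\<And>d c p. good d c \<Longrightarrow> rk y c \<Longrightarrow> forces p (u d) \<longleftrightarrow> forces p c"
    using assms(1) unfolding Univ_def by auto
  show ?thesis
  proof (rule Univ_union[OF u(1), where h = "\<lambda>d k. cch d (p1 k)" and P = "\<lambda>d k. gives d 0 1 (p2 k)"])
    show "cmp.C2 (\<lambda>d k. cch d (p1 k))" "cmp.dec (\<lambda>z. gives (p1 z) 0 1 (p2 (p2 z)))"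
      unfolding cmp.C2_def by (intro cintro)+
    show "ord1 < x" using rk_ord1_le[OF u(2)] assms(2) by (rule order_le_less_trans)
    fix d c p assume d: "good d c" "rk x c" and c0: "c 0 = 1"
    have "compat p (u (cch d m)) \<longleftrightarrow> compat p (code_section c m)" for m
    proof -
      have "rk y (code_section c m)" using rk_section[OF d(2), of m] c0 assms(3) rk_mono by fastforce
      then show ?thesis unfolding compat_def using u(3)[OF good_cch[OF d(1)]] by simp
    qed
    then show "(\<exists>k. gives d 0 1 (p2 k) \<and> \<not> compat p (u (cch d (p1 k)))) \<longleftrightarrow>
      (\<exists>m. \<not> compat p (code_section c m))"
      using c0 unfolding good_1[OF d(1)] by (metis p1_pr p2_pr)
  qed (use u(2) assms(2) in blast)+
qed

section \<open>Limit ordinals\<close>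

definition is_lim :: "cord \<Rightarrow> bool" where
  "is_lim x \<longleftrightarrow> (\<exists>y. y < x) \<and> (\<forall>y<x. \<exists>z<x. y < z)"

text \<open>Applied only below a limit, where a larger element exists.\<close>

definition osuc :: "cord \<Rightarrow> cord" where "osuc y = (LEAST z. y < z)"

lemma osuc_lim: assumes "is_lim x" "y < x" shows "y < osuc y" "osuc y < x"
proof -
  obtain z where "z < x" "y < z" using assms unfolding is_lim_def by blast
  then show "y < osuc y" "osuc y < x" unfolding osuc_def
    by (auto intro: LeastI order_le_less_trans[OF Least_le])
qed

lemma ord1_less_lim: "is_lim x \<Longrightarrow> ord1 < x"
  unfolding is_lim_def by (meson leI less_ord1 order_le_less_trans)

text \<open>At limit ordinals the ranks of the subcodes of a code are not computable from it. Instead, every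
  subcode \<open>c\<close> gets for each label \<open>a\<close> of a computable well-order a lower approximation \<open>L d a\<close> and an
  upper approximation \<open>U d a\<close>, which are exact as soon as the rank of \<open>c\<close> is at most that of \<open>a\<close>:
  \<open>L d a\<close> is the union of the complements of \<open>U (cch d m) b\<close> over all \<open>m\<close> and \<open>b < a\<close>, and
  \<open>U d a\<close> is the union of the complements of \<open>L (cch d m) a\<close> over all \<open>m\<close>.\<close>

locale labels =
  fixes R :: "nat rel"
  assumes R: "computable_rel R" "Well_order R" and lim: "is_lim (abs_cord R)"
begin

definition ord :: "nat \<Rightarrow> cord" where "ord a = abs_cord (Restr R (underS R a))"

definition lt :: "nat \<Rightarrow> nat \<Rightarrow> bool" where "lt b a \<longleftrightarrow> (b, a) \<in> R \<and> b \<noteq> a"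

lemma lt_Field: "lt b a \<Longrightarrow> b \<in> Field R" by (auto simp: lt_def Field_def)

lemma Field_iff: "a \<in> Field R \<longleftrightarrow> (a, a) \<in> R"
  using R(2) by (auto simp: well_order_on_def linear_order_on_def partial_order_on_def preorder_on_def
      refl_on_def Field_def)

lemma dec_R: "cmp.dec (\<lambda>z. (p1 z, p2 z) \<in> R)"
proof -
  obtain p where p: "\<And>m n. computes p [m, n] (if (m, n) \<in> R then 1 else 0)"
    using R(1) unfolding computable_rel_def by blast
  have "computes p xs (of_bool ((xs ! 0, xs ! 1) \<in> R))" if "length xs = 2" for xs
  proof -
    from that obtain m n where "xs = [m, n]" by (auto simp: length_Suc_conv numeral_2_eq_2)
    then show ?thesis using p[of m n] by (simp add: of_bool_def)
  qed
  then have "rc 2 (\<lambda>xs. of_bool ((xs ! 0, xs ! 1) \<in> R))" unfolding rc_def by blast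
  from rc_comp2[OF this rc_p1 rc_p2, of 1 "\<lambda>xs. xs ! 0" "\<lambda>xs. xs ! 0"]
  show ?thesis unfolding cmp.dec_def computable_iff_rc by (simp add: rc_proj)
qed

lemma dec_lt [cintro]: assumes "computable a" "computable b" shows "cmp.dec (\<lambda>x. lt (a x) (b x))"
  unfolding lt_def by (intro cintro assms cmp.dec_app2[OF dec_R])

lemma dec_Field [cintro]: assumes "computable a" shows "cmp.dec (\<lambda>x. a x \<in> Field R)"
  unfolding Field_iff by (intro assms cmp.dec_app2[OF dec_R])

lemma less_lim_iff: "z < abs_cord R \<longleftrightarrow> (\<exists>a\<in>Field R. z = ord a)"
  unfolding ord_def by (rule less_abs_cord_iff[OF R(2)])

lemma lt_total: "a \<in> Field R \<Longrightarrow> b \<in> Field R \<Longrightarrow> lt a b \<or> a = b \<or> lt b a"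
  using R(2) by (auto simp: lt_def well_order_on_def linear_order_on_def total_on_def)

lemma ord_mono: assumes "lt b a" shows "ord b < ord a"
proof -
  have wo: "wo_rel R" using R(2) by (simp add: wo_rel_def)
  have a: "a \<in> Field R" "b \<in> Field R" using assms by (auto simp: lt_def Field_def)
  have "underS R b \<subset> underS R a"
  proof
    have tr: "trans R" and an: "antisym R"
      using R(2) by (auto simp: well_order_on_def linear_order_on_def partial_order_on_def preorder_on_def)
    show "underS R b \<subseteq> underS R a"
      using assms tr an unfolding underS_def lt_def trans_def antisym_def by blast
    show "underS R b \<noteq> underS R a"
      using assms unfolding underS_def lt_def by blast
  qed
  then have "Restr R (underS R b) <o Restr R (underS R a)"
    using ofilter_subset_ordLess[OF R(2)] wo_rel.underS_ofilter[OF wo] by blast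
  then show ?thesis unfolding ord_def by (simp add: abs_cord_less_iff Well_order_Restr R(2))
qed

lemma less_ord_iff: assumes "a \<in> Field R" shows "z < ord a \<longleftrightarrow> (\<exists>b. lt b a \<and> z = ord b)"
proof
  assume z: "z < ord a"
  moreover have "ord a < abs_cord R" using assms less_lim_iff by blast
  ultimately obtain b where "b \<in> Field R" "z = ord b" using less_lim_iff by (meson order_less_trans)
  moreover from this have "lt b a" using z assms lt_total[of a b] ord_mono[of a b] by auto
  ultimately show "\<exists>b. lt b a \<and> z = ord b" by blast
qed (use ord_mono in blast)

text \<open>One system holds three kinds of nodes, since \<open>L\<close> and \<open>U\<close> refer
  to each other: a first component 0 marks a leaf \<open>CB\<close>, 1 a node of kind
  \<open>L\<close>, and 2 a node of kind \<open>U\<close>.\<close>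

definition nt :: "nat \<Rightarrow> nat" where "nt j = (if p1 j = 0 then 0 else 1)"

definition nl :: "nat \<Rightarrow> nat \<Rightarrow> nat" where "nl j m = CB (p2 j) (Suc m)"

definition nc :: "nat \<Rightarrow> nat \<Rightarrow> nat" where
  "nc j n = (let d = p1 (p2 j); a = p2 (p2 j); k = n div 2; m = p1 (p1 k); b = p2 (p1 k) in
    if even n then pr 0 (opc d k)
    else if p1 j = 1 then if gives d 0 1 (p2 k) \<and> lt b a then pr 2 (pr (cch d m) b) else pr 0 0
    else if gives d 0 1 (p2 k) then pr 1 (pr (cch d m) a) else pr 0 0)"

definition L :: "nat \<Rightarrow> nat \<Rightarrow> nat \<Rightarrow> nat" where "L d a = sc nt nc nl (pr 1 (pr d a))"
definition U :: "nat \<Rightarrow> nat \<Rightarrow> nat \<Rightarrow> nat" where "U d a = sc nt nc nl (pr 2 (pr d a))"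

lemma C2_LU: "cmp.C2 (sc nt nc nl)"
proof (rule C2_sc)
  show "computable nt" unfolding nt_def by (intro cintro)
  show "cmp.C2 nc" unfolding cmp.C2_def nc_def Let_def by (intro cintro)
  show "cmp.C2 nl" unfolding cmp.C2_def nl_def by (intro cintro)
qed

lemma CB_node: "sc nt nc nl (pr 0 e) = CB e"
proof
  show "sc nt nc nl (pr 0 e) m = CB e m" for m by (cases m) (auto simp: nt_def nl_def CB_def)
qed

lemma LU_0: "L d a 0 = 1" "U d a 0 = 1"
  by (auto simp: L_def U_def nt_def)

lemma L_section: "code_section (L d a) n = (if even n then CB (opc d (n div 2))
  else if gives d 0 1 (p2 (n div 2)) \<and> lt (p2 (p1 (n div 2))) a
    then U (cch d (p1 (p1 (n div 2)))) (p2 (p1 (n div 2))) else CB 0)"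
  unfolding L_def U_def CB_node[symmetric] by (subst sc_section) (auto simp: nt_def nc_def Let_def)

lemma U_section: "code_section (U d a) n = (if even n then CB (opc d (n div 2))
  else if gives d 0 1 (p2 (n div 2)) then L (cch d (p1 (p1 (n div 2)))) a else CB 0)"
  unfolding L_def U_def CB_node[symmetric] by (subst sc_section) (auto simp: nt_def nc_def Let_def)

lemma rk_L: assumes "ord1 < z" "\<And>b d. lt b a \<Longrightarrow> \<exists>y<z. rk y (U d b)" shows "rk z (L d a)"
proof (rule rk.node)
  show "\<forall>n. \<exists>y<z. rk y (code_section (L d a) n)"
    unfolding L_section using assms rk_CB[OF order_refl] by auto
qed (rule LU_0)

text \<open>Every child of \<open>L d b\<close> is a child of \<open>L d a\<close> or a
  filler.\<close>

lemma rk_L_anti: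
  assumes "rk z (L d a)" "\<And>b'. lt b' b \<Longrightarrow> lt b' a" shows "rk z (L d b)"
proof (rule rk.node)
  have z: "ord1 < z" using rk_node_less[OF assms(1)] LU_0 by simp
  show "\<forall>n. \<exists>y<z. rk y (code_section (L d b) n)"
  proof
    fix n
    have "\<exists>y<z. rk y (code_section (L d a) n)" using rk_section[OF assms(1)] LU_0 by simp
    then show "\<exists>y<z. rk y (code_section (L d b) n)"
      unfolding L_section using assms(2) z rk_CB[OF order_refl] by (auto split: if_splits)
  qed
qed (rule LU_0)

lemma rk_U: assumes "\<And>d. rk z (L d a)" "z < y" shows "rk y (U d a)"
proof (rule rk.node)
  have "ord1 < y" using rk_ord1_le[OF assms(1)] assms(2) by (rule order_le_less_trans)
  then show "\<forall>n. \<exists>z<y. rk z (code_section (U d a) n)"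
    unfolding U_section using assms rk_CB[OF order_refl] by auto
qed (rule LU_0)

text \<open>A successor label costs finitely many ranks, so every limit above \<open>ord a\<close>
  stays above the bound; at a limit label \<open>ord a\<close> itself is a bound. It is uniform in
  \<open>d\<close> because the children belong to other descriptions.\<close>

lemma rk_L_bound:
  "a \<in> Field R \<Longrightarrow> \<exists>z. (\<forall>d. rk z (L d a)) \<and> (\<forall>\<mu>. is_lim \<mu> \<longrightarrow> ord a < \<mu> \<longrightarrow> z < \<mu>)"
proof (induction "ord a" arbitrary: a rule: less_induct)
  case less
  have IH: "\<exists>z. (\<forall>d. rk z (L d b)) \<and> (\<forall>\<mu>. is_lim \<mu> \<longrightarrow> ord b < \<mu> \<longrightarrow> z < \<mu>)" if "lt b a" for b
    using less.hyps[OF ord_mono[OF that]] lt_Field[OF that] by blast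
  have a: "ord a < abs_cord R" using less.prems less_lim_iff by blast
  consider "\<not> (\<exists>b. lt b a)" | b where "lt b a" "\<And>b'. lt b' a \<Longrightarrow> b' = b \<or> lt b' b"
    | b0 where "lt b0 a" "\<And>b. lt b a \<Longrightarrow> \<exists>b'. lt b' a \<and> lt b b'"
    using lt_total lt_Field by metis
  then show ?case
  proof cases
    case 1
    have "rk (osuc ord1) (L d a)" for d
      by (rule rk_L[OF osuc_lim(1)[OF lim ord1_less_lim[OF lim]]]) (use 1 in blast)
    then show ?thesis using osuc_lim(2)[OF _ ord1_less_lim] by blast
  next
    \<comment> \<open>Here \<open>b\<close> is the immediate predecessor of \<open>a\<close>. By
      \<open>rk_L_anti\<close> its bound \<open>z\<close> covers \<open>L\<close> at all labels
      below \<open>a\<close>; one successor accounts for \<open>U\<close>, a second one for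
      \<open>L d a\<close>.\<close>
    case 2
    obtain z where z: "\<And>d. rk z (L d b)" "\<And>\<mu>. is_lim \<mu> \<Longrightarrow> ord b < \<mu> \<Longrightarrow> z < \<mu>"
      using IH[OF 2(1)] by blast
    have zl: "z < \<mu>" if "is_lim \<mu>" "ord a < \<mu>" for \<mu>
      using z(2)[OF that(1)] ord_mono[OF 2(1)] that(2) by (meson order_less_trans)
    have s: "z < osuc z" "osuc z < osuc (osuc z)"
      using osuc_lim[OF lim] zl[OF lim a] by blast+
    have "rk (osuc z) (U d b')" if "lt b' a" for d b'
    proof (rule rk_U[OF _ s(1)])
      show "rk z (L d b')" for d
      proof (cases "b' = b")
        case False
        then have "lt b' b" using 2(2)[OF that] by blast
        moreover have "lt b'' b" if "lt b'' b'" for b''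
          using ord_mono[OF that] ord_mono[OF calculation] lt_Field that calculation
          by (metis less_ord_iff lt_total ord_mono order_less_asym order_less_trans 2(1) order_less_irrefl)
        ultimately show ?thesis using rk_L_anti[OF z(1)] by blast
      qed (simp add: z)
    qed
    then have "rk (osuc (osuc z)) (L d a)" for d
      using s rk_ord1_le[OF z(1)] by (intro rk_L) (auto intro: order_le_less_trans order_less_trans)
    moreover have "osuc (osuc z) < \<mu>" if "is_lim \<mu>" "ord a < \<mu>" for \<mu>
      using osuc_lim(2)[OF that(1)] zl[OF that] by blast
    ultimately show ?thesis by blast
  next
    case 3
    have la: "is_lim (ord a)" unfolding is_lim_def less_ord_iff[OF less.prems]
      using 3 ord_mono by metis
    have "\<exists>y < ord a. rk y (U d b)" if b: "lt b a" for d b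
    proof -
      obtain z where z: "\<And>d. rk z (L d b)" "z < ord a" using IH[OF b] la ord_mono[OF b] by blast
      show ?thesis using rk_U[OF z(1) osuc_lim(1)[OF la z(2)]] osuc_lim(2)[OF la z(2)] by blast
    qed
    then have "rk (ord a) (L d a)" for d by (intro rk_L ord1_less_lim[OF la])
    then show ?thesis by blast
  qed
qed

lemma rk_LU: assumes "a \<in> Field R"
  shows "\<exists>z<abs_cord R. \<forall>d. rk z (L d a)" "\<exists>z<abs_cord R. \<forall>d. rk z (U d a)"
proof -
  obtain z where z: "\<And>d. rk z (L d a)" "z < abs_cord R"
    using rk_L_bound[OF assms] lim less_lim_iff assms by blast
  then show "\<exists>z<abs_cord R. \<forall>d. rk z (L d a)" by blast
  show "\<exists>z<abs_cord R. \<forall>d. rk z (U d a)"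
    using rk_U[OF z(1) osuc_lim(1)[OF lim z(2)]] osuc_lim(2)[OF lim z(2)] by blast
qed

lemma forces_L: assumes "a \<in> Field R" "good d c"
  shows "forces p (L d a) \<longleftrightarrow> (c 0 = 0 \<and> forces p c) \<or>
    (\<exists>k. (gives d 0 1 (p2 k) \<and> lt (p2 (p1 k)) a) \<and> \<not> compat p (U (cch d (p1 (p1 k))) (p2 (p1 k))))"
proof -
  obtain z where "rk z (L d a)" using rk_LU(1)[OF assms(1)] by blast
  then show ?thesis by (rule forces_split[where u = "L d a", OF _ LU_0(1) assms(2)]) (rule L_section)
qed

lemma forces_U: assumes "a \<in> Field R" "good d c"
  shows "forces p (U d a) \<longleftrightarrow> (c 0 = 0 \<and> forces p c) \<or>
    (\<exists>k. gives d 0 1 (p2 k) \<and> \<not> compat p (L (cch d (p1 (p1 k))) a))"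
proof -
  obtain z where "rk z (U d a)" using rk_LU(2)[OF assms(1)] by blast
  then show ?thesis by (rule forces_split[where u = "U d a", OF _ LU_0(2) assms(2)]) (rule U_section)
qed

text \<open>The unconditional inclusions turn into each other under the complements taken at the
  children. For exactness of \<open>L d a\<close>, a child of rank \<open>y\<close> below
  \<open>ord a\<close> gets the label of rank exactly \<open>y\<close>; for \<open>U d a\<close> the
  label \<open>a\<close> is still large enough at the children.\<close>

lemma approx:
  assumes "rk x c" "good d c" "a \<in> Field R"
  shows "(forces p (L d a) \<longrightarrow> forces p c) \<and> (forces p c \<longrightarrow> forces p (U d a)) \<and>
    (x \<le> ord a \<longrightarrow> (forces p c \<longrightarrow> forces p (L d a)) \<and> (forces p (U d a) \<longrightarrow> forces p c))"
  using assms
proof (induction x arbitrary: c d a p rule: less_induct)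
  case (less x)
  note c = less.prems(1) and d = less.prems(2) and a = less.prems(3)
  show ?case
  proof (cases "c 0 = 0")
    case True
    then have "\<not> gives d 0 1 t" for t using good_1[OF d] by auto
    then show ?thesis using True by (simp add: forces_L[OF a d] forces_U[OF a d])
  next
    case False
    then have g: "\<exists>t. gives d 0 1 t" using rk_flag[OF c] good_1[OF d] by simp
    have fc: "forces p c \<longleftrightarrow> (\<exists>m. \<not> compat p (code_section c m))" by (rule forces_node[OF c False])
    have fU: "forces p (U d a) \<longleftrightarrow> (\<exists>m. \<not> compat p (L (cch d m) a))"
      unfolding forces_U[OF a d] using False g by (metis p1_pr p2_pr)
    have fL: "forces p (L d a) \<longleftrightarrow> (\<exists>m b. lt b a \<and> \<not> compat p (U (cch d m) b))"
      unfolding forces_L[OF a d] using False g by (metis p1_pr p2_pr)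
    have IH: "\<exists>y<x. rk y (code_section c m) \<and> (\<forall>b\<in>Field R. 
        (compat p (L (cch d m) b) \<longrightarrow> compat p (code_section c m)) \<and>
        (compat p (code_section c m) \<longrightarrow> compat p (U (cch d m) b)) \<and>
        (y \<le> ord b \<longrightarrow> (compat p (code_section c m) \<longrightarrow> compat p (L (cch d m) b)) \<and>
          (compat p (U (cch d m) b) \<longrightarrow> compat p (code_section c m))))" for m
    proof -
      obtain y where y: "y < x" "rk y (code_section c m)" using rk_section[OF c False] by blast
      show ?thesis
        by (rule exI[of _ y]) (use y less.IH[OF y good_cch[OF d, of m]] in \<open>unfold compat_def, blast\<close>)
    qed
    have "forces p c" if "forces p (L d a)"
      using that IH lt_Field unfolding fc fL by metis
    moreover have "forces p (U d a)" if "forces p c"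
      using that IH a unfolding fc fU by metis
    moreover have "forces p (L d a)" if x: "x \<le> ord a" "forces p c"
    proof -
      obtain m where m: "\<not> compat p (code_section c m)" using x(2) fc by blast
      obtain y where y: "y < x" "\<And>b. b \<in> Field R \<Longrightarrow> y \<le> ord b \<Longrightarrow>
        compat p (U (cch d m) b) \<Longrightarrow> compat p (code_section c m)" using IH[of m] by blast
      obtain b where b: "lt b a" "y = ord b"
        using less_ord_iff[OF a] order_less_le_trans[OF y(1) x(1)] by blast
      then have "\<not> compat p (U (cch d m) b)" using y(2)[of b] lt_Field m by auto
      then show ?thesis using b fL by blast
    qed
    moreover have "forces p c" if x: "x \<le> ord a" "forces p (U d a)"
    proof -
      obtain m where m: "\<not> compat p (L (cch d m) a)" using x(2) fU by blast
      then have "\<not> compat p (code_section c m)" using IH[of m] a x(1)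
        by (meson order_less_le_trans less_imp_le)
      then show ?thesis using fc by blast
    qed
    ultimately show ?thesis by blast
  qed
qed

text \<open>No single label suits all subcodes, so the union runs over all labels: a label that is
  too small adds nothing false to a union of complements of upper approximations, and the label
  matching the rank of a subcode is exact.\<close>

lemma Univ_lim: "\<exists>u. Univ (abs_cord R) u"
proof (rule Univ_union[OF C2_LU, where P = "\<lambda>d k. gives d 0 1 (p2 k) \<and> p2 (p1 k) \<in> Field R"
      and h = "\<lambda>d k. pr 2 (pr (cch d (p1 (p1 k))) (p2 (p1 k)))", folded U_def])
  show "cmp.C2 (\<lambda>d k. pr 2 (pr (cch d (p1 (p1 k))) (p2 (p1 k))))"
    "cmp.dec (\<lambda>z. gives (p1 z) 0 1 (p2 (p2 z)) \<and> p2 (p1 (p2 z)) \<in> Field R)"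
    unfolding cmp.C2_def by (intro cintro)+
  show "ord1 < abs_cord R" by (rule ord1_less_lim[OF lim])
  fix d c p assume d: "good d c" "rk (abs_cord R) c" and c0: "c 0 = 1"
  show "(\<exists>k. (gives d 0 1 (p2 k) \<and> p2 (p1 k) \<in> Field R) \<and> \<not> compat p (U (cch d (p1 (p1 k))) (p2 (p1 k))))
    \<longleftrightarrow> (\<exists>m. \<not> compat p (code_section c m))" (is "?l \<longleftrightarrow> _")
  proof
    assume ?l
    then obtain m b where mb: "b \<in> Field R" "\<not> compat p (U (cch d m) b)" by blast
    obtain y where "rk y (code_section c m)" using rk_section[OF d(2)] c0 by fastforce
    from approx[OF this good_cch[OF d(1)] mb(1)] mb(2)
    have "\<not> compat p (code_section c m)" unfolding compat_def by blast
    then show "\<exists>m. \<not> compat p (code_section c m)" ..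
  next
    assume "\<exists>m. \<not> compat p (code_section c m)"
    then obtain m where m: "\<not> compat p (code_section c m)" ..
    obtain y where y: "y < abs_cord R" "rk y (code_section c m)" using rk_section[OF d(2)] c0 by fastforce
    then obtain b where b: "b \<in> Field R" "y = ord b" using less_lim_iff by blast
    from approx[OF y(2) good_cch[OF d(1)] b(1)] m b(2)
    have "\<not> compat p (U (cch d m) b)" unfolding compat_def by blast
    moreover obtain t where "gives d 0 1 t" using c0 good_1[OF d(1)] by blast
    ultimately show ?l using b by (intro exI[of _ "pr (pr m b) t"]) simp
  qed
qed (use rk_LU(2) in blast)+

lemma below_lim:
  "\<exists>w. cmp.C2 w \<and> (\<forall>j. \<exists>y<abs_cord R. rk y (w j)) \<and>
    (\<forall>c y. computable c \<longrightarrow> rk y c \<longrightarrow> y < abs_cord R \<longrightarrow> (\<exists>j. \<forall>p. forces p (w j) \<longleftrightarrow> forces p c))"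
proof (intro exI[of _ "\<lambda>j m. if p2 j \<in> Field R then L (p1 j) (p2 j) m else CB 0 m"] conjI allI impI)
  let ?w = "\<lambda>j m. if p2 j \<in> Field R then L (p1 j) (p2 j) m else CB 0 m"
  show "cmp.C2 ?w" unfolding cmp.C2_def L_def by (intro cintro cmp.C2_app[OF C2_LU])
  show "\<exists>y<abs_cord R. rk y (?w j)" for j
  proof (cases "p2 j \<in> Field R")
    case True then show ?thesis using rk_LU(1)[OF True] by auto
  next
    case False then show ?thesis using rk_CB[OF order_refl] ord1_less_lim[OF lim] by auto
  qed
  fix c y assume c: "computable c" "rk y c" "y < abs_cord R"
  obtain d where d: "good d c" using ex_good[OF c(1)] by blast
  obtain a where a: "a \<in> Field R" "y = ord a" using c(3) less_lim_iff by blast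
  have "forces p (L d a) \<longleftrightarrow> forces p c" for p
    using approx[OF c(2) d a(1)] a(2) by blast
  then have "forces p (?w (pr d a)) \<longleftrightarrow> forces p c" for p
    using a(1) by simp
  then show "\<exists>j. \<forall>p. forces p (?w j) \<longleftrightarrow> forces p c" by blast
qed

end

text \<open>Stated for all limits up to \<open>x\<close>, so that it is inherited by smaller
  ordinals in the induction.\<close>

definition lim_computable :: "cord \<Rightarrow> bool" where
  "lim_computable x \<longleftrightarrow>
    (\<forall>\<mu>\<le>x. is_lim \<mu> \<longrightarrow> (\<exists>R. computable_rel R \<and> Well_order R \<and> abs_cord R = \<mu>))"

lemma succ_or_lim: "ord1 < x \<Longrightarrow> is_lim x \<or> (\<exists>y<x. ord1 \<le> y \<and> (\<forall>z<x. z \<le> y))"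
proof -
  assume x: "ord1 < x"
  show ?thesis
  proof (cases "is_lim x")
    case False
    then obtain y where y: "y < x" "\<forall>z<x. z \<le> y" using x unfolding is_lim_def by (meson leI)
    then show ?thesis using x by blast
  qed simp
qed

section \<open>Universal families at every rank, and the dense sets obtained from them\<close>

lemma ex_Univ: assumes "ord1 \<le> x" "lim_computable x" shows "\<exists>u. Univ x u"
  using assms
proof (induction x rule: less_induct)
  case (less x)
  consider "x = ord1" | "is_lim x" | y where "y < x" "ord1 \<le> y" "\<And>z. z < x \<Longrightarrow> z \<le> y"
    using less.prems(1) succ_or_lim[of x] by (metis order_le_imp_less_or_eq)
  then show ?case
  proof cases
    case 1 then show ?thesis using Univ_ord1 by simp
  next
    case 2
    then obtain R where R': "computable_rel R" "Well_order R" "abs_cord R = x"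
      using less.prems(2) unfolding lim_computable_def by blast
    interpret labels R by unfold_locales (use R' 2 in auto)
    show ?thesis using Univ_lim R'(3) by simp
  next
    case 3
    have "lim_computable y" using less.prems(2) 3(1) unfolding lim_computable_def by auto
    then obtain u where "Univ y u" using less.IH[OF 3(1,2)] by blast
    then show ?thesis using Univ_succ 3(1,3) by blast
  qed
qed

lemma below_family:
  assumes "ord1 < x" "lim_computable x"
  shows "\<exists>w. cmp.C2 w \<and> (\<forall>j. \<exists>y<x. rk y (w j)) \<and>
    (\<forall>c y. computable c \<longrightarrow> rk y c \<longrightarrow> y < x \<longrightarrow> (\<exists>j. \<forall>p. forces p (w j) \<longleftrightarrow> forces p c))"
proof (cases "is_lim x")
  case True
  then obtain R where R': "computable_rel R" "Well_order R" "abs_cord R = x"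
    using assms(2) unfolding lim_computable_def by blast
  interpret labels R by unfold_locales (use R' True in auto)
  show ?thesis using below_lim R'(3) by simp
next
  case False
  then obtain y where y: "y < x" "ord1 \<le> y" "\<And>z. z < x \<Longrightarrow> z \<le> y"
    using succ_or_lim[OF assms(1)] by blast
  have "lim_computable y" using assms(2) y(1) unfolding lim_computable_def by auto
  then obtain u where u: "Univ y u" using ex_Univ y(2) by blast
  show ?thesis
  proof (intro exI[of _ u] conjI allI impI)
    fix c z assume c: "computable c" "rk z c" "z < x"
    obtain d where "good d c" using ex_good[OF c(1)] by blast
    moreover have "rk y c" using rk_mono[OF c(2) y(3)[OF c(3)]] .
    ultimately show "\<exists>j. \<forall>p. forces p (u j) \<longleftrightarrow> forces p c" using u unfolding Univ_def by blast
  qed (use u y(1) in \<open>auto simp: Univ_def\<close>)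
qed

text \<open>Take \<open>D (pr k p)\<close> to say that \<open>p\<close> decides the
  \<open>k\<close>-th code of a family covering all ranks below \<open>x\<close>. It is in the
  class, as \<open>forces\<close> has rank \<open>x\<close> and \<open>compat\<close> smaller rank;
  equal forcing relations carry decisions over to every computable code below
  \<open>x\<close>.\<close>

lemma deciding_family:
  assumes "ord1 \<le> x" "lim_computable x"
  obtains D where "S x (\<lambda>j f. D j)" "\<And>k p. \<exists>q. ext q p \<and> D (pr k q)"
    "\<And>f c y. (\<And>k. \<exists>p. pfx p f \<and> D (pr k p)) \<Longrightarrow> computable c \<Longrightarrow> rk y c \<Longrightarrow> y < x \<Longrightarrow> decided f c"
proof (cases "x = ord1")
  case True
  interpret pos_rank x by unfold_locales (rule assms)
  show ?thesis
  proof (rule that[of "\<lambda>_. True"])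
    show "\<exists>q. ext q p \<and> True" for p using ext_refl by blast
    fix f c y assume "rk y c" "y < x"
    then show "decided f c" using rk_ord1_le True by fastforce
  qed (auto intro!: S_dec cmp.dec_const)
next
  case False
  then have x: "ord1 < x" using assms(1) by simp
  interpret pos_rank x by unfold_locales (rule assms)
  obtain w where w: "cmp.C2 w" "\<And>j. \<exists>y<x. rk y (w j)"
    "\<And>c y. computable c \<Longrightarrow> rk y c \<Longrightarrow> y < x \<Longrightarrow> \<exists>j. \<forall>p. forces p (w j) \<longleftrightarrow> forces p c"
    using below_family[OF x assms(2)] by blast
  from w(2) obtain \<rho> where \<rho>: "\<And>j. \<rho> j < x" "\<And>j. rk (\<rho> j) (w j)" by metis
  have "rk x (w j)" for j using rk_mono[OF \<rho>(2)] \<rho>(1) by (simp add: less_imp_le)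
  note Sf = S_forces[OF w(1) this pos]
  let ?D = "\<lambda>j. forces (p2 j) (w (p1 j)) \<or> \<not> compat (p2 j) (w (p1 j))"
  show ?thesis
  proof (rule that[of ?D])
    show "S x (\<lambda>j f. ?D j)"
      by (intro S_disj Sf S_below(2)[OF SR_compat[OF w(1) \<rho>(2)]] \<rho>(1))
    show "\<exists>q. ext q p \<and> ?D (pr k q)" for k p unfolding compat_def by simp (use ext_refl in blast)
    fix f c y assume D: "\<And>k. \<exists>p. pfx p f \<and> ?D (pr k p)" and c: "computable c" "rk y c" "y < x"
    obtain k where "\<And>p. forces p (w k) \<longleftrightarrow> forces p c" using w(3)[OF c] by blast
    then show "decided f c" using D[of k] unfolding decided_def compat_def by simp
  qed
qed

section \<open>Functions with graph in the class\<close>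

text \<open>The normal form of a family independent of \<open>f\<close> may depend on
  \<open>f\<close>; evaluation at the zero function removes the dependence within the class.\<close>

lemma S_eval0: assumes "S x \<phi>" shows "S x (\<lambda>i f. \<phi> i (\<lambda>_. 0))"
proof -
  obtain c where c: "cmp.C2 c" "\<And>i. rk x (c i)" "\<And>i f. f \<in> bev (c i) \<longleftrightarrow> \<phi> i f"
    using assms unfolding S_def SR_def by blast
  have "SR (\<lambda>_. x) (\<lambda>i f. (\<lambda>_. 0) \<in> bev (c i))"
  proof (rule SR_of_codes[OF c(1,2), where u = "\<lambda>_. 0" and a = "\<lambda>i s. \<forall>k<sl s. 0 = sn s k"])
    show "computable (\<lambda>_. 0)" by (intro cintro)
    show "cmp.dec (\<lambda>z. \<forall>k<sl (p2 z). 0 = sn (p2 z) k)" by (intro cintro)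
  qed (simp add: baire_basis_iff pfx_def)
  then show ?thesis unfolding S_def c(3) .
qed

context pos_rank
begin

definition Dfun :: "(nat \<Rightarrow> nat) \<Rightarrow> bool" where
  "Dfun h \<longleftrightarrow> S x (\<lambda>i f. p2 i = h (p1 i))"

lemma Dfun_computable: assumes "computable h" shows "Dfun h"
  unfolding Dfun_def by (intro sintro cintro cmp.C_comp[OF assms])

lemma S_val:
  assumes "Dfun h" "computable u" "S x (\<lambda>z. \<phi> (p1 z) (p2 z))"
  shows "S x (\<lambda>i f. \<phi> (h (u i)) i f)"
proof -
  have eq: "\<phi> (h (u i)) i f \<longleftrightarrow> (\<exists>z. z = h (u i) \<and> \<phi> z i f)" for i f by simp
  have "S x (\<lambda>w f. p1 w = h (u (p2 w)))"
    using S_comp[OF assms(1)[unfolded Dfun_def] cmp.C_pr[OF cmp.C_comp[OF assms(2) cmp.C_p2[OF cmp.C_id]]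
      cmp.C_p1[OF cmp.C_id]]] by simp
  then show ?thesis unfolding eq by (intro S_ex S_conj assms(3))
qed

lemma S_graph:
  assumes "Dfun h" "computable a" "computable b" shows "S x (\<lambda>i f. b i = h (a i))"
  using S_comp[OF assms(1)[unfolded Dfun_def] cmp.C_pr[OF assms(2,3)]] by simp

sublocale dfn: fclass Dfun
proof
  show "Dfun (\<lambda>x. x)" "Dfun (\<lambda>_. 0)" by (intro Dfun_computable cintro)+
next
  fix a assume a: "Dfun a"
  have "S x (\<lambda>i f. p2 i = u (a (p1 i)))" if "computable u" for u
    by (rule S_val[where \<phi> = "\<lambda>v i f. p2 i = u v", OF a cmp.C_p1[OF cmp.C_id]])
      (intro sintro cintro cmp.C_comp[OF that])
  then show "Dfun (\<lambda>x. Suc (a x))" "Dfun (\<lambda>x. p1 (a x))" "Dfun (\<lambda>x. p2 (a x))"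
    unfolding Dfun_def by (simp_all add: cmp.C_id cmp.C_Suc cmp.C_p1 cmp.C_p2)
  fix b assume b: "Dfun b"
  show "Dfun (\<lambda>x. a (b x))" unfolding Dfun_def
    by (rule S_val[where \<phi> = "\<lambda>v i f. p2 i = a v", OF b cmp.C_p1[OF cmp.C_id]])
      (intro S_graph[OF a] cintro)
  show "Dfun (\<lambda>x. pr (a x) (b x))" unfolding Dfun_def
  proof (rule S_val[where \<phi> = "\<lambda>v i f. p2 i = pr v (b (p1 i))", OF a cmp.C_p1[OF cmp.C_id]])
    show "S x (\<lambda>z f. p2 (p2 z) = pr (p1 z) (b (p1 (p2 z))))"
      by (rule S_val[where \<phi> = "\<lambda>v z f. p2 (p2 z) = pr (p1 z) v", OF b]) (intro sintro cintro)+
  qed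
next
  fix b s assume b: "Dfun b" and s: "Dfun s"
  let ?r = "\<lambda>z. rec_nat (b (p2 z)) (\<lambda>k r. s (pr k (pr r (p2 z)))) (p1 z)"
  \<comment> \<open>The graph of a recursion: the sequence number \<open>q\<close> lists all
    intermediate values.\<close>
  have "p2 i = ?r (p1 i) \<longleftrightarrow> (\<exists>q. sn q 0 = b (p2 (p1 i)) \<and>
    (\<forall>k<p1 (p1 i). sn q (Suc k) = s (pr k (pr (sn q k) (p2 (p1 i))))) \<and> p2 i = sn q (p1 (p1 i)))" (is "_ \<longleftrightarrow> ?R") for i
  proof
    define g where "g = rec_nat (b (p2 (p1 i))) (\<lambda>k r. s (pr k (pr r (p2 (p1 i)))))"
    obtain q where q: "\<forall>k<Suc (p1 (p1 i)). sn q k = g k" using ex_seq[of "Suc (p1 (p1 i))" g] by blast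
    have g: "g 0 = b (p2 (p1 i))" "\<And>k. g (Suc k) = s (pr k (pr (g k) (p2 (p1 i))))" by (simp_all add: g_def)
    assume "p2 i = ?r (p1 i)"
    then have "p2 i = g (p1 (p1 i))" by (simp add: g_def)
    then show ?R
      using q g by (intro exI[of _ q]) auto
  next
    assume ?R
    then obtain q where q: "sn q 0 = b (p2 (p1 i))"
      "\<And>k. k < p1 (p1 i) \<Longrightarrow> sn q (Suc k) = s (pr k (pr (sn q k) (p2 (p1 i))))" "p2 i = sn q (p1 (p1 i))"
      by blast
    have "k \<le> p1 (p1 i) \<Longrightarrow> sn q k = rec_nat (b (p2 (p1 i))) (\<lambda>k r. s (pr k (pr r (p2 (p1 i))))) k" for k
      by (induction k) (auto simp: q(1,2))
    then show "p2 i = ?r (p1 i)" using q(3) by simp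
  qed
  then show "Dfun ?r" unfolding Dfun_def
    by (simp only:) (intro sintro cintro S_graph[OF b] S_graph[OF s])
next
  fix g assume g: "Dfun g" and ex: "\<And>x. \<exists>n. g (pr n x) = 0"
  \<comment> \<open>Being nonzero is written as being a successor, a positive condition on the graph
    of \<open>g\<close>.\<close>
  have "p2 i = (LEAST n. g (pr n (p1 i)) = 0) \<longleftrightarrow>
    0 = g (pr (p2 i) (p1 i)) \<and> (\<forall>k<p2 i. \<exists>v. Suc v = g (pr k (p1 i)))" (is "?l \<longleftrightarrow> ?r") for i
  proof
    assume ?l
    then show ?r
      using LeastI_ex[OF ex[of "p1 i"]] not_less_Least[of _ "\<lambda>n. g (pr n (p1 i)) = 0"]
      by (metis not0_implies_Suc)
  next
    assume ?r
    then show ?l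
      by (intro Least_equality[symmetric]) (metis nat.distinct(1) not_le_imp_less)+
  qed
  then show "Dfun (\<lambda>x. LEAST n. g (pr n x) = 0)" unfolding Dfun_def
    by (simp only:) (intro sintro cintro S_graph[OF g])
qed

section \<open>Decidability relative to the class, and uniformization\<close>

lemma S_Dsubst: assumes "S x \<phi>" "Dfun g" shows "S x (\<lambda>i f. \<phi> (g i) f)"
  by (rule S_val[where \<phi> = "\<lambda>v i f. \<phi> v f", OF assms(2) cmp.C_id]) (intro S_comp[OF assms(1)] cintro)

lemma S_ddec: assumes "dfn.dec P" shows "S x (\<lambda>i f. P i)"
proof -
  have "P i \<longleftrightarrow> 1 = (of_bool (P i) :: nat)" for i by simp
  then show ?thesis using S_graph[OF assms[unfolded dfn.dec_def] cmp.C_id cmp.C_const[of 1]] by simp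
qed

lemma ddecI: assumes "S x (\<lambda>i f. P i)" "S x (\<lambda>i f. \<not> P i)" shows "dfn.dec P"
proof -
  have "p2 i = of_bool (P (p1 i)) \<longleftrightarrow> (p2 i = 1 \<and> P (p1 i)) \<or> (p2 i = 0 \<and> \<not> P (p1 i))" for i by simp
  then show ?thesis unfolding dfn.dec_def Dfun_def
    by (simp only:) (intro sintro cintro S_comp[OF assms(1)] S_comp[OF assms(2)])
qed

text \<open>The search runs over pairs of a value and a witness of the normal form, a condition
  decidable relative to the class; so minimization applies.\<close>

lemma uniformization:
  assumes "S x (\<lambda>i f. A i)" "\<And>i. \<exists>w. A (pr w i)"
  obtains u where "Dfun u" "\<And>i. A (pr (u i) i)"
proof -
  from assms(1) obtain \<psi> where \<psi>: "S x \<psi>" "S x (\<lambda>i f. \<not> \<psi> i f)"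
    "\<And>i f. A i \<longleftrightarrow> (\<exists>n. \<psi> (pr n i) f)" by (rule S_normal) blast
  define B where "B i = \<psi> i (\<lambda>_. 0)" for i
  have B: "dfn.dec B" unfolding B_def by (rule ddecI[OF S_eval0[OF \<psi>(1)] S_eval0[OF \<psi>(2)]])
  have AB: "A i \<longleftrightarrow> (\<exists>n. B (pr n i))" for i unfolding B_def by (rule \<psi>(3))
  define v where "v i = (LEAST m. B (pr (p2 m) (pr (p1 m) i)))" for i
  have ex: "\<exists>m. B (pr (p2 m) (pr (p1 m) i))" for i
    using assms(2)[of i] unfolding AB by (metis p1_pr p2_pr)
  have "Dfun v" unfolding v_def
    by (rule dfn.C_Least[OF _ ex]) (intro dfn.dec_comp[OF B] cintro)
  then have "Dfun (\<lambda>i. p1 (v i))" by (rule dfn.C_p1)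
  moreover have "A (pr (p1 (v i)) i)" for i
    using LeastI_ex[OF ex[of i]] unfolding AB v_def by blast
  ultimately show ?thesis by (rule that)
qed

section \<open>Perfect trees\<close>

text \<open>A condition enumerates the nodes, not necessarily in tree order, of a perfect tree.\<close>

definition cond :: "(nat \<Rightarrow> nat) \<Rightarrow> bool" where
  "cond T \<longleftrightarrow> Dfun T \<and> (\<forall>k. \<exists>k0 k1. ext (T k0) (T k) \<and> ext (T k1) (T k) \<and> inc (T k0) (T k1))"

definition body :: "(nat \<Rightarrow> nat) \<Rightarrow> (nat \<Rightarrow> nat) \<Rightarrow> bool" where
  "body T f \<longleftrightarrow> (\<forall>m. \<exists>k. m \<le> sl (T k) \<and> pfx (T k) f)"

lemma body_mono: assumes "body T' f" "range T' \<subseteq> range T" shows "body T f"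
  unfolding body_def
proof
  fix m
  obtain k where k: "m \<le> sl (T' k)" "pfx (T' k) f" using assms(1) unfolding body_def by blast
  obtain j where "T' k = T j" using assms(2) by blast
  with k show "\<exists>k. m \<le> sl (T k) \<and> pfx (T k) f" by auto
qed

fun half_rec :: "nat \<Rightarrow> (nat \<Rightarrow> nat \<Rightarrow> nat) \<Rightarrow> nat \<Rightarrow> nat" where
  "half_rec b g 0 = b"
| "half_rec b g (Suc m) = g m (half_rec b g (m div 2))"

text \<open>The thinned tree is indexed by the binary tree in which \<open>m\<close> has the children \<open>2 * m + 1\<close> and
  \<open>2 * m + 2\<close>; all its nodes at depth \<open>n + 1\<close> satisfy \<open>\<Phi>\<close> for \<open>n\<close> and some value, and the
  function \<open>h\<close> sums up the finitely many values used up to that depth.\<close>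

lemma thin:
  assumes T: "cond T" and \<Phi>: "S x (\<lambda>j f. \<Phi> j)"
    and ex: "\<And>k n. \<exists>k' y. ext (T k') (T k) \<and> \<Phi> (pr (pr n y) (T k'))"
  obtains T' h where "cond T'" "range T' \<subseteq> range T" "Dfun h"
    "\<And>f n. body T' f \<Longrightarrow> \<exists>y\<le>h n. \<exists>p. pfx p f \<and> \<Phi> (pr (pr n y) p)"
proof -
  have DT: "Dfun T" using T by (simp add: cond_def)
  define A where "A j \<longleftrightarrow> (let k0 = p1 (p1 (p1 j)); k1 = p2 (p1 (p1 j)); y0 = p1 (p2 (p1 j)); y1 = p2 (p2 (p1 j));
    k = p1 (p2 j); n = p2 (p2 j) in
    (ext (T k0) (T k) \<and> ext (T k1) (T k) \<and> inc (T k0) (T k1)) \<and>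
    \<Phi> (pr (pr n y0) (T k0)) \<and> \<Phi> (pr (pr n y1) (T k1)))" for j
  have "S x (\<lambda>j f. A j)" unfolding A_def Let_def
    by (intro S_conj S_ddec S_Dsubst[OF \<Phi>] cintro dfn.C_comp[OF DT])
  moreover have "\<exists>w. A (pr w i)" for i
  proof -
    obtain a b where ab: "ext (T a) (T (p1 i))" "ext (T b) (T (p1 i))" "inc (T a) (T b)"
      using T unfolding cond_def by blast
    obtain k0 y0 where 0: "ext (T k0) (T a)" "\<Phi> (pr (pr (p2 i) y0) (T k0))" using ex by blast
    obtain k1 y1 where 1: "ext (T k1) (T b)" "\<Phi> (pr (pr (p2 i) y1) (T k1))" using ex by blast
    have "A (pr (pr (pr k0 k1) (pr y0 y1)) i)" unfolding A_def Let_def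
      using 0 1 ab inc_ext[OF ab(3) 0(1) 1(1)] ext_trans by simp
    then show ?thesis ..
  qed
  ultimately obtain u where u: "Dfun u" "\<And>i. A (pr (u i) i)" by (rule uniformization) blast
  \<comment> \<open>A state packs the depth, the index in \<open>T\<close> of the node, and the
    value \<open>y\<close> chosen there. Parity tells which of the two children supplied by
    \<open>u\<close> is meant.\<close>
  define g where "g m s = (let w = u (pr (p1 (p2 s)) (p1 s)) in pr (Suc (p1 s))
    (if even m then pr (p1 (p1 w)) (p1 (p2 w)) else pr (p2 (p1 w)) (p2 (p2 w))))" for m s :: nat
  define t where "t = half_rec 0 g"
  have t: "t 0 = 0" "\<And>m. t (Suc m) = g m (t (m div 2))" by (simp_all add: t_def)
  have "dfn.C2 g" unfolding dfn.C2_def g_def Let_def by (intro cintro dfn.C_comp[OF u(1)])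
  then have Dt: "Dfun t" by (rule dfn.C_half_rec[where h = t and b = 0]) (rule t)+
  define T' where "T' m = T (p1 (p2 (t m)))" for m
  define dep where "dep m = p1 (t m)" for m
  define Y where "Y m = p2 (p2 (t m))" for m
  have dep0: "dep 0 = 0" by (simp add: dep_def t(1))
  have depS: "dep (Suc m) = Suc (dep (m div 2))" for m by (simp add: dep_def t(2) g_def Let_def)
  have Au: "A (pr (u (pr (p1 (p2 (t m))) (dep m))) (pr (p1 (p2 (t m))) (dep m)))" for m by (rule u(2))
  have step: "ext (T' (Suc (2 * m))) (T' m) \<and> ext (T' (Suc (Suc (2 * m)))) (T' m) \<and>
    inc (T' (Suc (2 * m))) (T' (Suc (Suc (2 * m)))) \<and>
    \<Phi> (pr (pr (dep m) (Y (Suc (2 * m)))) (T' (Suc (2 * m)))) \<and>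
    \<Phi> (pr (pr (dep m) (Y (Suc (Suc (2 * m))))) (T' (Suc (Suc (2 * m)))))" for m
    using Au[of m] unfolding A_def Let_def by (simp add: T'_def Y_def t(2) g_def Let_def dep_def)
  have stepS: "ext (T' (Suc j)) (T' (j div 2)) \<and> \<Phi> (pr (pr (dep (j div 2)) (Y (Suc j))) (T' (Suc j)))" for j
  proof (cases "even j")
    case True
    then have "j = 2 * (j div 2)" by simp
    then show ?thesis using step[of "j div 2"] by metis
  next
    case False
    then have "Suc j = Suc (Suc (2 * (j div 2)))" by (simp add: odd_two_times_div_two_succ)
    then show ?thesis using step[of "j div 2"] by metis
  qed
  \<comment> \<open>In level order the nodes of depth at most \<open>n\<close> have the numbers up
    to \<open>2 ^ Suc n - 2\<close>; this is the source of the bound \<open>2 ^ (n + 2)\<close> in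
    \<open>h\<close>.\<close>
  have dep_bound: "k + 2 \<le> 2 ^ Suc (dep k)" for k
  proof (induction k rule: less_induct)
    case (less k)
    show ?case
    proof (cases k)
      case (Suc j)
      have "j div 2 + 2 \<le> 2 ^ Suc (dep (j div 2))" by (rule less.IH) (simp add: Suc)
      moreover have "Suc j + 2 \<le> 2 * (j div 2 + 2)" by presburger
      ultimately show ?thesis by (simp add: Suc depS)
    qed (simp add: dep0)
  qed
  have anc: "n \<le> dep k \<Longrightarrow> \<exists>k'. dep k' = n \<and> ext (T' k) (T' k')" for n k
  proof (induction k rule: less_induct)
    case (less k)
    show ?case
    proof (cases "n = dep k")
      case False
      with less.prems obtain j where j: "k = Suc j" "n \<le> dep (j div 2)"
        by (cases k) (auto simp: dep0 depS)
      have "j div 2 < k" using j(1) by linarith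
      then obtain k' where "dep k' = n" "ext (T' (j div 2)) (T' k')" using less.IH j(2) by blast
      then show ?thesis using stepS[of j] j(1) ext_trans by blast
    qed auto
  qed
  define h where "h n = rec_nat 0 (\<lambda>k r. r + Y k) (2 ^ (n + 2))" for n
  have rec_sum: "rec_nat 0 (\<lambda>k r. r + Y k) N = sum Y {..<N}" for N by (induction N) auto
  have h: "Dfun h" unfolding h_def Y_def by (intro cintro dfn.C_comp[OF Dt])
  show ?thesis
  proof (rule that[of T' h])
    show "cond T'" unfolding cond_def
    proof (intro conjI allI)
      show "Dfun T'" unfolding T'_def by (intro dfn.C_comp[OF DT] cintro dfn.C_comp[OF Dt])
      show "\<exists>k0 k1. ext (T' k0) (T' k) \<and> ext (T' k1) (T' k) \<and> inc (T' k0) (T' k1)" for k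
        using step[of k] by blast
    qed
    show "range T' \<subseteq> range T" by (auto simp: T'_def)
    fix f n assume f: "body T' f"
    \<comment> \<open>The body only promises long nodes. One longer than all nodes numbered below
      \<open>2 ^ (n + 2)\<close> has a larger number, hence depth above \<open>n\<close>, and its
      ancestor at depth \<open>n + 1\<close> also lies on \<open>f\<close>.\<close>
    obtain k where k: "Suc (\<Sum>k<2 ^ (n + 2). sl (T' k)) \<le> sl (T' k)" "pfx (T' k) f"
      using f unfolding body_def by blast
    have "\<not> k < 2 ^ (n + 2)"
    proof
      assume "k < 2 ^ (n + 2)"
      then have "sl (T' k) \<le> (\<Sum>k<2 ^ (n + 2). sl (T' k))" by (intro member_le_sum) auto
      then show False using k(1) by simp
    qed
    moreover have "Suc n \<le> dep k \<or> (2::nat) ^ Suc (dep k) \<le> 2 ^ (n + 2)"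
      by (cases "Suc n \<le> dep k") (auto intro!: power_increasing simp del: power_Suc)
    ultimately have "Suc n \<le> dep k" using dep_bound[of k] by linarith
    then obtain k' where k': "dep k' = Suc n" "ext (T' k) (T' k')" using anc by blast
    then obtain j where j: "k' = Suc j" "dep (j div 2) = n" by (cases k') (auto simp: dep0 depS)
    have "k' < 2 ^ (n + 2)" using dep_bound[of k'] k'(1) by simp
    then have "Y k' \<le> h n" unfolding h_def rec_sum by (intro member_le_sum) auto
    moreover have "\<Phi> (pr (pr n (Y k')) (T' k'))" using stepS[of j] j by simp
    moreover have "pfx (T' k') f" using k(2) k'(2) by (rule pfx_ext)
    ultimately show "\<exists>y\<le>h n. \<exists>p. pfx p f \<and> \<Phi> (pr (pr n y) p)" by blast
  qed (rule h)
qed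

text \<open>Keeping the indices and sending nodes outside the cone to its stem avoids a
  renumbering.\<close>

lemma cond_cone:
  assumes "cond T" shows "cond (\<lambda>m. if ext (T m) (T k) then T m else T k)" (is "cond ?T'")
  unfolding cond_def
proof (intro conjI allI)
  have T: "Dfun T" using assms by (simp add: cond_def)
  show "Dfun ?T'" by (intro cintro T)
  fix m
  obtain m' where m': "?T' m = T m'" "ext (T m') (T k)" by (cases "ext (T m) (T k)") auto
  obtain k0 k1 where "ext (T k0) (T m')" "ext (T k1) (T m')" "inc (T k0) (T k1)"
    using assms unfolding cond_def by blast
  then have "ext (?T' k0) (?T' m) \<and> ext (?T' k1) (?T' m) \<and> inc (?T' k0) (?T' k1)"
    using m' ext_trans by (simp del: if_split)
  then show "\<exists>k0 k1. ext (?T' k0) (?T' m) \<and> ext (?T' k1) (?T' m) \<and> inc (?T' k0) (?T' k1)" by blast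
qed

lemma dominating_subtree:
  assumes T: "cond T"
    and dec: "\<And>f c y. body T f \<Longrightarrow> computable c \<Longrightarrow> rk y c \<Longrightarrow> y < x \<Longrightarrow> decided f c"
    and c: "cmp.C2 c" "\<And>i. rk x (c i)"
  obtains T' h where "cond T'" "range T' \<subseteq> range T" "Dfun h"
    "\<And>f g n. body T' f \<Longrightarrow> (\<And>n y. f \<in> bev (c (pr n y)) \<longleftrightarrow> g n = y) \<Longrightarrow> g n \<le> h n"
proof -
  let ?\<Phi> = "\<lambda>j. forces (p2 j) (c (p1 j))"
  have \<Phi>: "S x (\<lambda>j f. ?\<Phi> j)" by (rule S_forces[OF c pos])
  have ci: "computable (c i)" for i
    using cmp.C2_app[OF c(1) cmp.C_const[of i] cmp.C_id] .
  have truth: "f \<in> bev (c i) \<longleftrightarrow> (\<exists>p. pfx p f \<and> forces p (c i))" if "body T f" for f i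
    by (rule truth[OF c(2) ci]) (rule dec[OF that])
  show ?thesis
  proof (cases "\<forall>k n. \<exists>k' y. ext (T k') (T k) \<and> ?\<Phi> (pr (pr n y) (T k'))")
    case True
    then obtain T' h where *: "cond T'" "range T' \<subseteq> range T" "Dfun h"
      "\<And>f n. body T' f \<Longrightarrow> \<exists>y\<le>h n. \<exists>p. pfx p f \<and> ?\<Phi> (pr (pr n y) p)"
      using thin[OF T \<Phi>] by blast
    show ?thesis
    proof (rule that[OF *(1-3)])
      fix f g n assume f: "body T' f" and g: "\<And>n y. f \<in> bev (c (pr n y)) \<longleftrightarrow> g n = y"
      obtain y p where y: "y \<le> h n" "pfx p f" "forces p (c (pr n y))" using *(4)[OF f, of n] by auto
      then have "f \<in> bev (c (pr n y))" using truth[OF body_mono[OF f *(2)]] by blast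
      with g y(1) show "g n \<le> h n" by simp
    qed
  next
    case False
    then obtain k n0 where no: "\<And>k' y. ext (T k') (T k) \<Longrightarrow> \<not> forces (T k') (c (pr n0 y))" by auto
    let ?T' = "\<lambda>m. if ext (T m) (T k) then T m else T k"
    have ran: "range ?T' \<subseteq> range T" by auto
    show ?thesis
    \<comment> \<open>The bound 0 will do: on no branch of this cone is the family the graph of a
      total function, as the value at \<open>n0\<close> is never forced.\<close>
    proof (rule that[OF cond_cone[OF T] ran dfn.C_zero])
      fix f g n assume f: "body ?T' f" and g: "\<And>n y. f \<in> bev (c (pr n y)) \<longleftrightarrow> g n = y"
      have "f \<in> bev (c (pr n0 (g n0)))" using g by simp
      then obtain p where p: "pfx p f" "forces p (c (pr n0 (g n0)))"
        using truth[OF body_mono[OF f ran]] by blast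
      obtain m where m: "sl p \<le> sl (?T' m)" "pfx (?T' m) f" using f unfolding body_def by blast
      have "ext (?T' m) p" by (rule pfx_pfx_ext[OF p(1) m(2,1)])
      from forces_mono[OF c(2) p(2) this] no have False by (auto split: if_splits)
      then show "g n \<le> 0" ..
    qed
  qed
qed

text \<open>Thinning the tree of all sequence numbers, where depth \<open>n + 1\<close> enters the
  \<open>n\<close>-th dense set and no value is to be decided.\<close>

lemma deciding_tree:
  assumes "lim_computable x"
  obtains T where "cond T"
    "\<And>f c y. body T f \<Longrightarrow> computable c \<Longrightarrow> rk y c \<Longrightarrow> y < x \<Longrightarrow> decided f c"
proof -
  obtain D where D: "S x (\<lambda>j f. D j)" "\<And>k p. \<exists>q. ext q p \<and> D (pr k q)"
    "\<And>f c y. (\<And>k. \<exists>p. pfx p f \<and> D (pr k p)) \<Longrightarrow> computable c \<Longrightarrow> rk y c \<Longrightarrow> y < x \<Longrightarrow> decided f c"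
    using deciding_family[OF pos assms] by metis
  have id: "cond (\<lambda>k. k)" unfolding cond_def using ex_inc_exts dfn.C_id by blast
  have "S x (\<lambda>j f. D (pr (p1 (p1 j)) (p2 j)))" by (intro S_comp[OF D(1)] cintro)
  from thin[OF id this] D(2) obtain T h where T: "cond T"
    "\<And>f n. body T f \<Longrightarrow> \<exists>y\<le>h n. \<exists>p. pfx p f \<and> D (pr (p1 (p1 (pr (pr n y) p))) (p2 (pr (pr n y) p)))"
    by (metis (no_types, lifting) p1_pr p2_pr)
  show ?thesis
  proof (rule that[OF T(1)])
    fix f c y assume f: "body T f" and c: "computable c" "rk y c" "y < x"
    have "\<exists>p. pfx p f \<and> D (pr k p)" for k using T(2)[OF f, of k] by auto
    then show "decided f c" using c by (rule D(3))
  qed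
qed

section \<open>Fusion\<close>

text \<open>The trees are picked by choice and depend on the earlier bits of \<open>X\<close>. Two
  sequences share their trees up to the first difference, where they take incompatible nodes, so
  \<open>F\<close> is injective. Each \<open>F X\<close> is a branch of all trees in its sequence,
  so it meets all requirements.\<close>

lemma fusion:
  fixes req :: "nat \<Rightarrow> (nat \<Rightarrow> nat) \<Rightarrow> bool"
  assumes T0: "cond T0"
    and refine: "\<And>e T. cond T \<Longrightarrow> range T \<subseteq> range T0 \<Longrightarrow>
      \<exists>T'. cond T' \<and> range T' \<subseteq> range T \<and> (\<forall>f. body T' f \<longrightarrow> req e f)"
  shows "\<exists>F :: (nat \<Rightarrow> bool) \<Rightarrow> nat \<Rightarrow> nat. inj F \<and> (\<forall>X e. req e (F X))"
proof -
  define P where "P e T q N \<longleftrightarrow> inc (q True) (q False) \<and>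
    (\<forall>b. q b \<in> range T \<and> sl (T 0) < sl (q b) \<and> cond (N b) \<and> range (N b) \<subseteq> range T \<and>
      (\<forall>m. ext (N b m) (q b)) \<and> (\<forall>f. body (N b) f \<longrightarrow> req e f))"
    for e and T :: "nat \<Rightarrow> nat" and q :: "bool \<Rightarrow> nat" and N :: "bool \<Rightarrow> nat \<Rightarrow> nat"
  have ex: "\<exists>q N. P e T q N"
    if T: "cond T" "range T \<subseteq> range T0" for e and T :: "nat \<Rightarrow> nat"
  proof -
    obtain k0 k1 where k: "ext (T k0) (T 0)" "ext (T k1) (T 0)" "inc (T k0) (T k1)"
      using T(1) unfolding cond_def by blast
    define q where "q b = T (if b then k0 else k1)" for b
    \<comment> \<open>Incompatible extensions of \<open>T 0\<close> differ beyond its end, so both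
      are strictly longer; this makes the stems \<open>r X e\<close> grow.\<close>
    have len: "sl (T 0) < sl (q b)" for b
      using k unfolding q_def inc_def ext_def by (auto simp: not_less[symmetric]) (metis not_less_iff_gr_or_eq order_less_trans)+
    have "\<exists>N. cond N \<and> range N \<subseteq> range T \<and> (\<forall>m. ext (N m) (q b)) \<and> (\<forall>f. body N f \<longrightarrow> req e f)" for b
    proof -
      let ?k = "if b then k0 else k1"
      let ?C = "\<lambda>m. if ext (T m) (T ?k) then T m else T ?k"
      have C: "range ?C \<subseteq> range T" by auto
      obtain N where N: "cond N" "range N \<subseteq> range ?C" "\<forall>f. body N f \<longrightarrow> req e f"
        using refine[OF cond_cone[OF T(1)]] C T(2) by (meson order_trans)
      have extC: "ext (?C m) (q b)" for m unfolding q_def by simp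
      have "ext (N m) (q b)" for m
      proof -
        obtain j where "N m = ?C j" using N(2) by blast
        then show ?thesis using extC[of j] by simp
      qed
      moreover have "range N \<subseteq> range T" using N(2) C by (rule order_trans)
      ultimately show ?thesis using N by blast
    qed
    then obtain N where "\<And>b. cond (N b) \<and> range (N b) \<subseteq> range T \<and> (\<forall>m. ext (N b m) (q b)) \<and>
      (\<forall>f. body (N b) f \<longrightarrow> req e f)" by metis
    moreover have "inc (q True) (q False)" "\<And>b. q b \<in> range T" using k(3) by (auto simp: q_def)
    ultimately show ?thesis using len unfolding P_def by blast
  qed
  define w where "w e T = (SOME w. P e T (fst w) (snd w))" for e T
  define q where "q e T = fst (w e T)" for e T
  define N where "N e T = snd (w e T)" for e T
  have qN: "P e T (q e T) (N e T)" if T: "cond T" "range T \<subseteq> range T0" for e T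
    unfolding q_def N_def w_def by (rule someI_ex) (use ex[OF T] in auto)
  define Y where "Y X = rec_nat T0 (\<lambda>e T. N e T (X e))" for X :: "nat \<Rightarrow> bool"
  define r where "r X e = q e (Y X e) (X e)" for X e
  have Y: "Y X 0 = T0" "Y X (Suc e) = N e (Y X e) (X e)" for X e by (simp_all add: Y_def)
  have inv: "cond (Y X e) \<and> range (Y X e) \<subseteq> range T0" for X e
  proof (induction e)
    case (Suc e)
    then show ?case unfolding Y using qN unfolding P_def by (meson order_trans)
  qed (simp add: Y T0)
  have qY: "q e (Y X e) b \<in> range (Y X e)" "sl (Y X e 0) < sl (q e (Y X e) b)"
    "range (N e (Y X e) b) \<subseteq> range (Y X e)" "ext (N e (Y X e) b m) (q e (Y X e) b)"
    "body (N e (Y X e) b) f \<Longrightarrow> req e f" for e X b m f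
    using qN[of "Y X e" e] inv[of X e] unfolding P_def by blast+
  have ranY: "range (Y X (e + d)) \<subseteq> range (Y X e)" for X e d
  proof (induction d)
    case (Suc d)
    have "range (Y X (e + Suc d)) \<subseteq> range (Y X (e + d))" using qY(3) by (simp add: Y)
    then show ?case using Suc by (rule order_trans)
  qed simp
  have r_in: "r X e \<in> range (Y X e)" for X e unfolding r_def by (rule qY)
  have extY: "ext p (r X e)" if "p \<in> range (Y X (Suc e))" for X e p
    using that qY(4) unfolding Y r_def by auto
  have r_ext: "ext (r X (Suc e)) (r X e)" for X e by (rule extY[OF r_in])
  have r_len: "sl (r X e) < sl (r X (Suc e))" for X e
  proof -
    have "sl (r X e) \<le> sl (Y X (Suc e) 0)" using extY[of "Y X (Suc e) 0" X e] by (simp add: ext_def)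
    also have "\<dots> < sl (r X (Suc e))" unfolding r_def[of X "Suc e"] by (rule qY)
    finally show ?thesis .
  qed
  have r_ge: "e \<le> sl (r X e)" for X e
  proof (induction e)
    case (Suc e) then show ?case using r_len[of X e] by simp
  qed simp
  have r_mono: "ext (r X (e + d)) (r X e)" for X e d
  proof (induction d)
    case (Suc d)
    then show ?case using ext_trans[OF r_ext[of X "e + d"]] by simp
  qed simp
  \<comment> \<open>The stem \<open>r X (Suc k)\<close> has length above \<open>k\<close>, so its
    entry \<open>k\<close> is a genuine one.\<close>
  define F where "F X k = sn (r X (Suc k)) k" for X k
  have pfxF: "pfx (r X e) (F X)" for X e unfolding pfx_def
  proof (intro allI impI)
    fix k assume k: "k < sl (r X e)"
    have k': "k < sl (r X (Suc k))" using r_ge[of "Suc k" X] by simp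
    show "F X k = sn (r X e) k"
    proof (cases "e \<le> Suc k")
      case True
      then show ?thesis using r_mono[of X e "Suc k - e"] k by (simp add: F_def ext_def)
    next
      case False
      then show ?thesis using r_mono[of X "Suc k" "e - Suc k"] k' by (simp add: F_def ext_def)
    qed
  qed
  have bodyF: "body (Y X e) (F X)" for X e unfolding body_def
  proof
    fix m
    have "r X (e + m) \<in> range (Y X e)" using r_in ranY by blast
    moreover have "m \<le> sl (r X (e + m))" using r_ge[of "e + m" X] by simp
    ultimately show "\<exists>k. m \<le> sl (Y X e k) \<and> pfx (Y X e k) (F X)" using pfxF by (metis rangeE)
  qed
  have "req e (F X)" for X e using bodyF[of X "Suc e"] unfolding Y by (rule qY)
  moreover have "inj F"
  proof (rule injI, rule ccontr)
    fix X X' assume eq: "F X = F X'" and "X \<noteq> X'"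
    then have ne: "\<exists>e. X e \<noteq> X' e" by auto
    define e where "e = (LEAST e. X e \<noteq> X' e)"
    have e: "X e \<noteq> X' e" unfolding e_def by (rule LeastI_ex[OF ne])
    have "k \<le> e \<Longrightarrow> Y X k = Y X' k" for k
    proof (induction k)
      case (Suc k)
      then have "X k = X' k" using not_less_Least[of k "\<lambda>e. X e \<noteq> X' e"] by (auto simp: e_def)
      with Suc show ?case by (simp add: Y)
    qed (simp add: Y)
    then have "Y X e = Y X' e" by simp
    then have "inc (r X e) (r X' e)"
      using e qN[of "Y X e" e] inv[of X e] inc_sym unfolding r_def P_def
      by (cases "X e"; cases "X' e") auto
    then show False using not_inc_pfx[OF pfxF pfxF, of X e] eq pfxF by (metis not_inc_pfx)
  qed
  ultimately show ?thesis by blast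
qed

text \<open>Requirements are indexed by programs. A program determines at most one family of codes,
  so a single subtree meets its requirement, and countably many requirements cover all
  \<open>\<phi>\<close>.\<close>

lemma perfectly_many:
  assumes "lim_computable x"
  shows "\<exists>F :: (nat \<Rightarrow> bool) \<Rightarrow> nat \<Rightarrow> nat. inj F \<and> (\<forall>X \<phi> g. S x \<phi> \<longrightarrow>
    (\<forall>n y. \<phi> (pr n y) (F X) \<longleftrightarrow> g n = y) \<longrightarrow> (\<exists>h. Dfun h \<and> (\<forall>n. g n \<le> h n)))"
proof -
  obtain T0 where T0: "cond T0"
    "\<And>f c y. body T0 f \<Longrightarrow> computable c \<Longrightarrow> rk y c \<Longrightarrow> y < x \<Longrightarrow> decided f c"
    using deciding_tree[OF assms] by blast
  define is_code where "is_code e c \<longleftrightarrow> cmp.C2 c \<and> (\<forall>i. rk x (c i)) \<and>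
    (\<forall>z y. c (p1 z) (p2 z) = y \<longleftrightarrow> (\<exists>t. Tr e z y t))" for e c
  define req where "req e f \<longleftrightarrow> (\<forall>c. is_code e c \<longrightarrow> (\<exists>h. Dfun h \<and>
    (\<forall>g. (\<forall>n y. f \<in> bev (c (pr n y)) \<longleftrightarrow> g n = y) \<longrightarrow> (\<forall>n. g n \<le> h n))))" for e f
  have step: "\<exists>T'. cond T' \<and> range T' \<subseteq> range T \<and> (\<forall>f. body T' f \<longrightarrow> req e f)"
    if T: "cond T" "range T \<subseteq> range T0" for e T
  proof (cases "\<exists>c. is_code e c")
    case True
    then obtain c where c: "is_code e c" ..
    have uniq: "c' = c" if "is_code e c'" for c'
    proof (intro HOL.ext)
      fix i m
      show "c' i m = c i m" using c that unfolding is_code_def by (metis p1_pr p2_pr)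
    qed
    have c': "cmp.C2 c" "\<And>i. rk x (c i)" using c by (auto simp: is_code_def)
    obtain T' h where "cond T'" "range T' \<subseteq> range T" "Dfun h"
      "\<And>f g n. body T' f \<Longrightarrow> (\<And>n y. f \<in> bev (c (pr n y)) \<longleftrightarrow> g n = y) \<Longrightarrow> g n \<le> h n"
      using dominating_subtree[OF T(1) _ c'] T0(2) body_mono[OF _ T(2)] by (metis (no_types, lifting))
    moreover from this have "\<forall>f. body T' f \<longrightarrow> req e f"
      unfolding req_def using uniq by metis
    ultimately show ?thesis by blast
  next
    case False
    then show ?thesis using T by (auto simp: req_def)
  qed
  have "\<exists>F :: (nat \<Rightarrow> bool) \<Rightarrow> nat \<Rightarrow> nat. inj F \<and> (\<forall>X e. req e (F X))"
    by (rule fusion[of T0 req, OF T0(1)]) (rule step)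
  then obtain F :: "(nat \<Rightarrow> bool) \<Rightarrow> nat \<Rightarrow> nat"
    where F: "inj F" "\<And>X e. req e (F X)" by blast
  have "\<exists>h. Dfun h \<and> (\<forall>n. g n \<le> h n)"
    if \<phi>: "S x \<phi>" and g: "\<forall>n y. \<phi> (pr n y) (F X) \<longleftrightarrow> g n = y" for X \<phi> g
  proof -
    obtain c where c: "cmp.C2 c" "\<And>i. rk x (c i)" "\<And>i f. f \<in> bev (c i) \<longleftrightarrow> \<phi> i f"
      using \<phi> unfolding S_def SR_def by blast
    obtain e where "\<forall>z y. c (p1 z) (p2 z) = y \<longleftrightarrow> (\<exists>t. Tr e z y t)"
      using Tr_enumerates[OF c(1)[unfolded cmp.C2_def]] by blast
    then have "is_code e c" using c by (simp add: is_code_def)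
    with F(2)[of e X, unfolded req_def] obtain h where h: "Dfun h"
      "\<forall>g. (\<forall>n y. F X \<in> bev (c (pr n y)) \<longleftrightarrow> g n = y) \<longrightarrow> (\<forall>n. g n \<le> h n)"
      by (elim allE[of _ c] impE exE conjE)
    have "\<forall>n. g n \<le> h n" using h(2)[unfolded c(3)] g by (elim allE[of _ g] impE)
    with h(1) show ?thesis by blast
  qed
  then show ?thesis using F(1) by blast
qed

end

section \<open>The ordinal \<open>1 + \<alpha>\<close>\<close>

lemma one_plus_iff:
  "(u, v) \<in> one_plus \<alpha> \<longleftrightarrow> (u = 0 \<and> (v = 0 \<or> v - 1 \<in> Field \<alpha>)) \<or>
    (u \<noteq> 0 \<and> v \<noteq> 0 \<and> (u - 1, v - 1) \<in> \<alpha>)"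
  by (cases u; cases v) (auto simp: one_plus_def)

lemma Field_one_plus: "Field (one_plus \<alpha>) = insert 0 (Suc ` Field \<alpha>)"
proof (rule set_eqI)
  fix z
  have "z \<in> Field (one_plus \<alpha>) \<longleftrightarrow> (\<exists>w. (z, w) \<in> one_plus \<alpha> \<or> (w, z) \<in> one_plus \<alpha>)"
    by (auto simp: Field_def)
  also have "\<dots> \<longleftrightarrow> z \<in> insert 0 (Suc ` Field \<alpha>)"
    by (cases z) (auto simp: one_plus_iff Field_def)
  finally show "z \<in> Field (one_plus \<alpha>) \<longleftrightarrow> z \<in> insert 0 (Suc ` Field \<alpha>)" .
qed

lemma Well_order_one_plus: assumes "Well_order \<alpha>" shows "Well_order (one_plus \<alpha>)"
proof -
  have \<alpha>: "Refl \<alpha>" "trans \<alpha>" "antisym \<alpha>" "Total \<alpha>" "Linear_order \<alpha>"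
    using assms by (auto simp: well_order_on_def linear_order_on_def partial_order_on_def preorder_on_def)
  have fld: "(a, b) \<in> \<alpha> \<Longrightarrow> a \<in> Field \<alpha> \<and> b \<in> Field \<alpha>" for a b by (auto simp: Field_def)
  have "Refl (one_plus \<alpha>)"
    using \<alpha>(1) by (auto simp: refl_on_def one_plus_iff Field_one_plus)
  moreover have "trans (one_plus \<alpha>)"
    using \<alpha>(2) fld unfolding trans_def one_plus_iff by blast
  moreover have "antisym (one_plus \<alpha>)"
    unfolding antisym_def one_plus_iff
  proof (intro allI impI)
    fix u v
    assume "u = 0 \<and> (v = 0 \<or> v - 1 \<in> Field \<alpha>) \<or> u \<noteq> 0 \<and> v \<noteq> 0 \<and> (u - 1, v - 1) \<in> \<alpha>"
      "v = 0 \<and> (u = 0 \<or> u - 1 \<in> Field \<alpha>) \<or> v \<noteq> 0 \<and> u \<noteq> 0 \<and> (v - 1, u - 1) \<in> \<alpha>"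
    then show "u = v" using antisymD[OF \<alpha>(3), of "u - 1" "v - 1"] by auto
  qed
  moreover have "Total (one_plus \<alpha>)"
    using \<alpha>(4) unfolding total_on_def Field_one_plus one_plus_iff by auto
  ultimately have lin: "Linear_order (one_plus \<alpha>)"
    by (auto simp: linear_order_on_def partial_order_on_def preorder_on_def intro: FieldI1 FieldI2)
  have "\<exists>a\<in>A. \<forall>b\<in>A. (a, b) \<in> one_plus \<alpha>" if A: "A \<subseteq> Field (one_plus \<alpha>)" "A \<noteq> {}" for A
  proof (cases "0 \<in> A")
    case True
    then show ?thesis using A(1) by (intro bexI[of _ 0]) (auto simp: one_plus_iff Field_one_plus)
  next
    case False
    then have "{a. Suc a \<in> A} \<subseteq> Field \<alpha>" "{a. Suc a \<in> A} \<noteq> {}"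
      using A by (auto simp: Field_one_plus)
    then obtain a where a: "Suc a \<in> A" "\<forall>b. Suc b \<in> A \<longrightarrow> (a, b) \<in> \<alpha>"
      using assms Linear_order_Well_order_iff[OF \<alpha>(5)] by (metis mem_Collect_eq)
    have "(Suc a, b) \<in> one_plus \<alpha>" if "b \<in> A" for b
      using that False a(2) by (cases b) (auto simp: one_plus_iff)
    then show ?thesis using a(1) by blast
  qed
  then show ?thesis using Linear_order_Well_order_iff[OF lin] by blast
qed

lemma abs_cord_empty_le: "abs_cord {} \<le> x"
  using less_abs_cord_iff[of "{}" x] well_order_on_empty by (auto simp: Field_def not_less[symmetric])

text \<open>This is 1 + \<beta> \<le> \<beta> + 1 without the right-hand sum. The segment of
  \<open>one_plus \<beta>\<close> below \<open>Suc a\<close> is \<open>one_plus\<close> of the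
  segment of \<beta> below \<open>a\<close>, which feeds the induction.\<close>

lemma less_one_plus:
  assumes "Well_order \<beta>" "w < abs_cord (one_plus \<beta>)" shows "w \<le> abs_cord \<beta>"
  using assms
proof (induction "abs_cord \<beta>" arbitrary: \<beta> w rule: less_induct)
  case less
  obtain b where b: "b \<in> Field (one_plus \<beta>)"
    "w = abs_cord (Restr (one_plus \<beta>) (underS (one_plus \<beta>) b))"
    using less.prems less_abs_cord_iff[OF Well_order_one_plus] by blast
  show ?case
  proof (cases b)
    case 0
    have "underS (one_plus \<beta>) 0 = {}" by (auto simp: underS_def one_plus_iff)
    then show ?thesis using b 0 abs_cord_empty_le by simp
  next
    case (Suc a)
    then have a: "a \<in> Field \<beta>" using b(1) by (auto simp: Field_one_plus)
    let ?\<gamma> = "Restr \<beta> (underS \<beta> a)"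
    have refl: "c \<in> Field \<beta> \<Longrightarrow> (c, c) \<in> \<beta>" for c
      using less.prems(1) by (auto simp: well_order_on_def linear_order_on_def partial_order_on_def
          preorder_on_def refl_on_def)
    have fld: "Field ?\<gamma> = underS \<beta> a"
      using refl by (auto simp: Field_def underS_def)
    have "Restr (one_plus \<beta>) (underS (one_plus \<beta>) b) = one_plus ?\<gamma>"
    proof (rule set_eqI, clarify)
      fix u v
      show "(u, v) \<in> Restr (one_plus \<beta>) (underS (one_plus \<beta>) b) \<longleftrightarrow> (u, v) \<in> one_plus ?\<gamma>"
        using a unfolding one_plus_iff[of u v ?\<gamma>] fld
        by (cases u; cases v) (auto simp: one_plus_iff underS_def Suc Field_def)
    qed
    then have w: "w = abs_cord (one_plus ?\<gamma>)" using b by simp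
    have \<gamma>: "Well_order ?\<gamma>" using less.prems(1) by (rule Well_order_Restr)
    have lt: "abs_cord ?\<gamma> < abs_cord \<beta>" using a less_abs_cord_iff[OF less.prems(1)] by blast
    show ?thesis
    proof (rule ccontr)
      assume "\<not> w \<le> abs_cord \<beta>"
      then have "abs_cord \<beta> \<le> abs_cord ?\<gamma>" using less.hyps[OF lt \<gamma>] w by simp
      then show False using lt by simp
    qed
  qed
qed

lemma ord1_le_one_plus: assumes "Well_order \<alpha>" shows "ord1 \<le> abs_cord (one_plus \<alpha>)"
proof -
  have "0 \<in> Field (one_plus \<alpha>)" by (simp add: Field_one_plus)
  then show ?thesis using less_abs_cord_iff[OF Well_order_one_plus[OF assms]] ord1_le by blast
qed

text \<open>The hypothesis presents ordinals up to \<alpha>, while 1 + \<alpha> may be larger. But a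
  limit above \<alpha> has an element strictly between, which \<open>less_one_plus\<close> excludes
  below 1 + \<alpha>.\<close>

lemma lim_computable_one_plus:
  assumes "computable_ordinal \<alpha>" shows "lim_computable (abs_cord (one_plus \<alpha>))"
  unfolding lim_computable_def
proof (intro allI impI)
  fix \<mu> assume \<mu>: "\<mu> \<le> abs_cord (one_plus \<alpha>)" "is_lim \<mu>"
  have \<alpha>: "Well_order \<alpha>" using assms by (simp add: computable_ordinal_def)
  have "\<mu> \<le> abs_cord \<alpha>"
  proof (rule ccontr)
    assume "\<not> \<mu> \<le> abs_cord \<alpha>"
    then obtain z where "z < \<mu>" "abs_cord \<alpha> < z" using \<mu>(2) unfolding is_lim_def by (meson leI)
    then show False using less_one_plus[OF \<alpha>, of z] \<mu>(1) by (meson leD order_less_le_trans)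
  qed
  moreover obtain \<beta> where \<beta>: "Well_order \<beta>" "\<mu> = abs_cord \<beta>" using abs_cord_surj by blast
  ultimately have "\<beta> \<le>o \<alpha>" using \<alpha> by (simp add: abs_cord_le_iff)
  then obtain R where R: "computable_rel R" "R =o \<beta>" using assms unfolding computable_ordinal_def by blast
  then have "Well_order R" "abs_cord R = \<mu>" using \<beta> ordIso_Well_order[OF R(2)] by (auto simp: abs_cord_eq_iff)
  with R(1) show "\<exists>R. computable_rel R \<and> Well_order R \<and> abs_cord R = \<mu>" by blast
qed

section \<open>Translation to the spaces of the statement\<close>

abbreviation "nat_nat \<equiv> prod_basis nat_basis nat_basis"
abbreviation "baire_nat \<equiv> prod_basis baire_basis nat_basis"
abbreviation "baire_nat_nat \<equiv> prod_basis baire_basis nat_nat"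

lemma S_of_Sigma0:
  assumes "Well_order \<alpha>" "Sigma0 N \<alpha> Q"
    and "computable u" "cmp.dec (\<lambda>z. a (p1 z) (p2 z))"
    and "\<And>i f s. \<xi> i f \<in> N s \<longleftrightarrow> a i s \<and> pfx (u s) f"
  shows "S (abs_cord \<alpha>) (\<lambda>i f. \<xi> i f \<in> Q)"
proof -
  obtain c where c: "computable c" "rk (abs_cord \<alpha>) c" "evs N c = Q"
    using assms(2) unfolding Sigma0_iff[OF assms(1)] by blast
  have "cmp.C2 (\<lambda>_. c)" unfolding cmp.C2_def by (intro cmp.C_comp[OF c(1)] cintro)
  from SR_of_codes[OF this c(2) assms(3-5)] show ?thesis by (simp add: S_def c(3))
qed

lemma Sigma0_of_S:
  assumes "Well_order \<alpha>" "ord1 \<le> abs_cord \<alpha>" "S (abs_cord \<alpha>) \<phi>"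
    and "cmp.C2 v" "cmp.dec (\<lambda>z. a (p1 z) (p2 z))" "\<And>i. a i 0"
    and "\<And>i s z. z \<in> N (v i s) \<and> a i s \<longleftrightarrow> \<pi> z = i \<and> pfx s (F z)"
  shows "Sigma0 N \<alpha> {z. \<phi> (\<pi> z) (F z)}"
  using code_of_S[OF assms(2-7)] unfolding Sigma0_iff[OF assms(1)] by blast

lemma Sigma0_baire_nat:
  assumes "Well_order \<alpha>" "Sigma0 baire_nat \<alpha> Q"
  shows "S (abs_cord \<alpha>) (\<lambda>i f. (f, i) \<in> Q)"
proof (rule S_of_Sigma0[OF assms, where u = p1 and a = "\<lambda>i s. i = p2 s"])
  show "computable p1" "cmp.dec (\<lambda>z. p1 z = p2 (p2 z))" by (intro cintro)+
  show "(f, i) \<in> baire_nat s \<longleftrightarrow> i = p2 s \<and> pfx (p1 s) f" for f i s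
    by (auto simp: prod_basis_def prod_decode_eq_p nat_basis_def baire_basis_iff)
qed

lemma Sigma0_baire_nat_nat:
  assumes "Well_order \<alpha>" "Sigma0 baire_nat_nat \<alpha> Q"
  shows "S (abs_cord \<alpha>) (\<lambda>i f. (f, p1 i, p2 i) \<in> Q)"
proof (rule S_of_Sigma0[OF assms, where u = p1 and a = "\<lambda>i s. i = p2 s"])
  show "computable p1" "cmp.dec (\<lambda>z. p1 z = p2 (p2 z))" by (intro cintro)+
  have *: "i = p2 s \<longleftrightarrow> p1 i = p1 (p2 s) \<and> p2 i = p2 (p2 s)" for i s by (metis pr_p1_p2)
  show "(f, p1 i, p2 i) \<in> baire_nat_nat s \<longleftrightarrow>
    i = p2 s \<and> pfx (p1 s) f" for f i s
    by (subst *) (auto simp: prod_basis_def prod_decode_eq_p nat_basis_def baire_basis_iff)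
qed

locale one_plus_rank =
  fixes \<alpha> :: "nat rel"
  assumes \<alpha>: "computable_ordinal \<alpha>"
begin

lemma wo: "Well_order \<alpha>" "Well_order (one_plus \<alpha>)"
  using \<alpha> Well_order_one_plus by (auto simp: computable_ordinal_def)

definition X :: cord where "X = abs_cord (one_plus \<alpha>)"

lemma X_pos: "ord1 \<le> X"
  unfolding X_def by (rule ord1_le_one_plus[OF wo(1)])

sublocale pos_rank X by unfold_locales (rule X_pos)

section \<open>Delta sets in the spaces of the statement, from uniform families\<close>

lemma Delta0_of_S:
  assumes "S X \<phi>" "S X (\<lambda>i f. \<not> \<phi> i f)"
    and v: "cmp.C2 v" "cmp.dec (\<lambda>z. a (p1 z) (p2 z))" "\<And>i. a i 0"
      "\<And>i s z. z \<in> N (v i s) \<and> a i s \<longleftrightarrow> \<pi> z = i \<and> pfx s (F z)"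
  shows "Delta0 N (one_plus \<alpha>) {z. \<phi> (\<pi> z) (F z)}"
proof -
  note * = Sigma0_of_S[OF wo(2) X_pos[unfolded X_def] _ v, folded X_def]
  have "UNIV - {z. \<phi> (\<pi> z) (F z)} = {z. \<not> \<phi> (\<pi> z) (F z)}" by auto
  then show ?thesis unfolding Delta0_def Pi0_def using *[OF assms(1)] *[OF assms(2)] by simp
qed

lemma Delta0_baire_nat:
  assumes "S X \<phi>" "S X (\<lambda>i f. \<not> \<phi> i f)"
  shows "Delta0 baire_nat (one_plus \<alpha>) {z. \<phi> (snd z) (fst z)}"
proof (rule Delta0_of_S[OF assms, where v = "\<lambda>i s. pr s i" and a = "\<lambda>i s. True"])
  show "cmp.C2 (\<lambda>i s. pr s i)" "cmp.dec (\<lambda>z. True)" unfolding cmp.C2_def by (intro cintro)+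
qed (auto simp: prod_basis_def prod_decode_eq_p nat_basis_def baire_basis_iff)

lemma Delta0_baire_nat_nat:
  assumes "S X \<phi>" "S X (\<lambda>i f. \<not> \<phi> i f)"
  shows "Delta0 baire_nat_nat (one_plus \<alpha>)
    {z. \<phi> (pr (fst (snd z)) (snd (snd z))) (fst z)}"
proof (rule Delta0_of_S[OF assms, where v = "\<lambda>i s. pr s i" and a = "\<lambda>i s. True"])
  show "cmp.C2 (\<lambda>i s. pr s i)" "cmp.dec (\<lambda>z. True)" unfolding cmp.C2_def by (intro cintro)+
qed (auto simp: prod_basis_def prod_decode_eq_p nat_basis_def baire_basis_iff)

lemma Delta0_graph_iff:
  "Delta0 nat_nat (one_plus \<alpha>) (fun_graph h) \<longleftrightarrow> Dfun h"
proof
  assume h: "Dfun h"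
  have 1: "S X (\<lambda>i f. p2 i = h (p1 i))" using h unfolding Dfun_def .
  have 2: "S X (\<lambda>i f. p2 i \<noteq> h (p1 i))"
    by (intro S_ddec cintro dfn.C_comp[OF h])
  have "Delta0 nat_nat (one_plus \<alpha>)
    {z. p2 (pr (fst z) (snd z)) = h (p1 (pr (fst z) (snd z)))}"
  \<comment> \<open>This space has no real coordinate; the zero function stands in for it, and
    \<open>a\<close> accepts exactly its stems.\<close>
  proof (rule Delta0_of_S[OF 1 2, where v = "\<lambda>i s. i" and F = "\<lambda>_ _. 0"
        and \<pi> = "\<lambda>z. pr (fst z) (snd z)" and a = "\<lambda>i s. \<forall>k<sl s. 0 = sn s k"])
    show "cmp.C2 (\<lambda>i s. i)" "cmp.dec (\<lambda>z. \<forall>k<sl (p2 z). 0 = sn (p2 z) k)"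
      unfolding cmp.C2_def by (intro cintro)+
    have "z \<in> nat_nat i \<longleftrightarrow> pr (fst z) (snd z) = i" for z i
      unfolding prod_basis_def prod_decode_eq_p nat_basis_def
      by (cases z) (metis SigmaE2 SigmaI fst_conv p1_pr p2_pr pr_p1_p2 singletonD singletonI snd_conv)
    then show "z \<in> nat_nat i \<and> (\<forall>k<sl s. 0 = sn s k) \<longleftrightarrow>
      pr (fst z) (snd z) = i \<and> pfx s (\<lambda>_. 0)" for i s z
      by (simp add: pfx_def)
  qed simp_all
  then show "Delta0 nat_nat (one_plus \<alpha>) (fun_graph h)"
    by (rule back_subst[of "Delta0 _ _"]) (auto simp: fun_graph_def)
next
  assume "Delta0 nat_nat (one_plus \<alpha>) (fun_graph h)"
  then have "Sigma0 nat_nat (one_plus \<alpha>) (fun_graph h)" by (simp add: Delta0_def)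
  then have "S X (\<lambda>i f. (p1 i, p2 i) \<in> fun_graph h)" unfolding X_def
  proof (rule S_of_Sigma0[OF wo(2), where u = "\<lambda>_. 0" and a = "\<lambda>i s. i = s"])
    show "computable (\<lambda>_. 0)" "cmp.dec (\<lambda>z. p1 z = p2 z)" by (intro cintro)+
    have *: "i = s \<longleftrightarrow> p1 i = p1 s \<and> p2 i = p2 s" for i s by (metis pr_p1_p2)
    show "(p1 i, p2 i) \<in> nat_nat s \<longleftrightarrow> i = s \<and> pfx 0 f" for i s f
      by (subst *) (auto simp: prod_basis_def prod_decode_eq_p nat_basis_def)
  qed
  then show "Dfun h" unfolding Dfun_def by (simp add: fun_graph_def)
qed

lemma many_dominated: "\<exists>F :: (nat \<Rightarrow> bool) \<Rightarrow> nat \<Rightarrow> nat. inj F \<and> (\<forall>Y. Delta0_dominated (one_plus \<alpha>) (F Y))"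
proof -
  have "lim_computable X" unfolding X_def by (rule lim_computable_one_plus[OF \<alpha>])
  from perfectly_many[OF this] obtain F :: "(nat \<Rightarrow> bool) \<Rightarrow> nat \<Rightarrow> nat" where F: "inj F"
    "\<And>Y \<phi> g. S X \<phi> \<Longrightarrow> (\<And>n y. \<phi> (pr n y) (F Y) \<longleftrightarrow> g n = y) \<Longrightarrow> \<exists>h. Dfun h \<and> (\<forall>n. g n \<le> h n)"
    by blast
  have "Delta0_dominated (one_plus \<alpha>) (F Y)" for Y
    unfolding Delta0_dominated_def Delta0_graph_iff
  proof (intro allI impI)
    fix g assume "Delta0_rel nat_nat (one_plus \<alpha>) (F Y) (fun_graph g)"
    then obtain Q where Q: "Sigma0 baire_nat_nat (one_plus \<alpha>) Q"
      "fun_graph g = real_section Q (F Y)" unfolding Delta0_rel_def Sigma0_rel_def by blast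
    show "\<exists>h. Dfun h \<and> (\<forall>n. g n \<le> h n)"
    proof (rule F(2)[where Y = Y and g = g, OF Sigma0_baire_nat_nat[OF wo(2) Q(1), folded X_def]])
      fix n y
      have "(F Y, n, y) \<in> Q \<longleftrightarrow> (n, y) \<in> fun_graph g" unfolding Q(2) by (simp add: real_section_def)
      then show "(F Y, p1 (pr n y), p2 (pr n y)) \<in> Q \<longleftrightarrow> g n = y" by (auto simp: fun_graph_def)
    qed
  qed
  then show ?thesis using F(1) by blast
qed

text \<open>Write both the set and its complement as unions of \<open>\<Delta>\<close> sets. The first index at which an
  argument shows up in one of them is a function in the class of \<open>f\<close>; bounding the search for it by
  a function \<open>h\<close> that does not depend on \<open>f\<close> turns the union into a \<open>\<Delta>\<close> set.\<close>

lemma dominated_imp_strongly_relativizes: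
  assumes f: "Delta0_dominated (one_plus \<alpha>) f"
  shows "strongly_relativizes_Delta0_at_nat (one_plus \<alpha>) f"
  unfolding strongly_relativizes_Delta0_at_nat_def
proof (intro allI impI)
  fix P assume "Delta0_rel nat_basis (one_plus \<alpha>) f P"
  then obtain Q1 Q2 where Q1: "Sigma0 baire_nat (one_plus \<alpha>) Q1" "P = real_section Q1 f"
    and Q2: "Sigma0 baire_nat (one_plus \<alpha>) (UNIV - Q2)" "P = real_section Q2 f"
    unfolding Delta0_rel_def Sigma0_rel_def Pi0_rel_def Pi0_def by blast
  note S1 = Sigma0_baire_nat[OF wo(2) Q1(1), folded X_def]
  note S2 = Sigma0_baire_nat[OF wo(2) Q2(1), folded X_def]
  obtain A where A: "S X A" "S X (\<lambda>i f. \<not> A i f)" "\<And>i f. (f, i) \<in> Q1 \<longleftrightarrow> (\<exists>n. A (pr n i) f)"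
    using S1 by (rule S_normal) blast
  obtain B where B: "S X B" "S X (\<lambda>i f. \<not> B i f)" "\<And>i f. (f, i) \<in> UNIV - Q2 \<longleftrightarrow> (\<exists>n. B (pr n i) f)"
    using S2 by (rule S_normal) blast
  define E where "E m k f \<longleftrightarrow> A (pr k m) f \<or> B (pr k m) f" for m k f
  define G where "G j f \<longleftrightarrow> E (p1 j) (p2 j) f \<and> (\<forall>l<p2 j. \<not> E (p1 j) l f)" for j f
  have SE: "S X (\<lambda>i f. E (a i) (b i) f)" "S X (\<lambda>i f. \<not> E (a i) (b i) f)"
    if "computable a" "computable b" for a b
    unfolding E_def de_Morgan_disj
    by (intro sintro S_comp[OF A(1)] S_comp[OF B(1)] S_comp[OF A(2)] S_comp[OF B(2)] cintro that)+
  have "S X G" unfolding G_def[abs_def] by (intro sintro SE cintro)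
  moreover have "S X (\<lambda>i f. \<not> G i f)" unfolding G_def de_Morgan_conj not_all not_imp not_not
    by (intro S_disj S_bex SE cintro)
  ultimately have G: "Delta0 baire_nat_nat (one_plus \<alpha>)
    {z. G (pr (fst (snd z)) (snd (snd z))) (fst z)}" (is "Delta0 _ _ ?G") by (rule Delta0_baire_nat_nat)
  have PA: "m \<in> P \<longleftrightarrow> (\<exists>n. A (pr n m) f)" for m
    using A(3)[of f m] Q1(2) by (simp add: real_section_def)
  have PB: "m \<notin> P \<longleftrightarrow> (\<exists>n. B (pr n m) f)" for m
    using B(3)[of f m] Q2(2) by (simp add: real_section_def)
  have ex: "\<exists>k. E m k f" for m using PA PB unfolding E_def by blast
  define g where "g m = (LEAST k. E m k f)" for m
  have "fun_graph g = real_section ?G f"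
  proof -
    have "G (pr m k) f \<longleftrightarrow> k = g m" for m k
    proof
      assume "G (pr m k) f"
      then show "k = g m" unfolding g_def G_def
        by (intro Least_equality[symmetric]) (auto simp: not_less[symmetric])
    next
      assume "k = g m"
      then show "G (pr m k) f" unfolding G_def g_def using LeastI_ex[OF ex] not_less_Least by auto
    qed
    then show ?thesis by (auto simp: fun_graph_def real_section_def)
  qed
  then have "Delta0_rel nat_nat (one_plus \<alpha>) f (fun_graph g)"
    using G unfolding Delta0_rel_def Sigma0_rel_def Pi0_rel_def Delta0_def by blast
  then obtain h where h: "Dfun h" "\<And>n. g n \<le> h n"
    using f unfolding Delta0_dominated_def Delta0_graph_iff by blast
  have "S X (\<lambda>m f. \<exists>k<Suc (h m). A (pr k m) f)"
    by (rule S_val[where \<phi> = "\<lambda>v m f. \<exists>k<Suc v. A (pr k m) f", OF h(1) cmp.C_id])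
      (intro S_bex S_comp[OF A(1)] cintro)
  moreover have "S X (\<lambda>m f. \<not> (\<exists>k<Suc (h m). A (pr k m) f))" unfolding not_ex de_Morgan_conj imp_conv_disj[symmetric]
    by (rule S_val[where \<phi> = "\<lambda>v m f. \<forall>k<Suc v. \<not> A (pr k m) f", OF h(1) cmp.C_id])
      (intro S_ball S_comp[OF A(2)] cintro)
  ultimately have "Delta0 baire_nat (one_plus \<alpha>)
    {z. \<exists>k<Suc (h (snd z)). A (pr k (snd z)) (fst z)}" (is "Delta0 _ _ ?Q") by (rule Delta0_baire_nat)
  moreover have "P = real_section ?Q f"
  proof -
    have "m \<in> P \<longleftrightarrow> (\<exists>k<Suc (h m). A (pr k m) f)" for m
    proof
      assume m: "m \<in> P"
      have "E m (g m) f" unfolding g_def by (rule LeastI_ex[OF ex])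
      then have "A (pr (g m) m) f" using m PB unfolding E_def by blast
      then show "\<exists>k<Suc (h m). A (pr k m) f" using h(2)[of m] by (auto simp: less_Suc_eq_le)
    qed (use PA in blast)
    then show ?thesis by (auto simp: real_section_def)
  qed
  ultimately show "\<exists>Q. Delta0 baire_nat (one_plus \<alpha>) Q \<and> P = real_section Q f" by blast
qed

end

section \<open>Continuum many reals\<close>

text \<open>Schroeder-Bernstein with the sets of natural numbers in between: functions embed through
  their graphs, sets embed through \<open>F\<close> applied to characteristic functions.\<close>

lemma eqpoll_reals_of_inj:
  fixes F :: "(nat \<Rightarrow> bool) \<Rightarrow> nat \<Rightarrow> nat"
  assumes "inj F" "range F \<subseteq> A"
  shows "A \<approx> (UNIV :: real set)"
proof -
  have "inj (\<lambda>f :: nat \<Rightarrow> nat. {pr n (f n) | n. True})"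
  proof (rule injI)
    fix f g :: "nat \<Rightarrow> nat" assume eq: "{pr n (f n) | n. True} = {pr n (g n) | n. True}"
    show "f = g"
    proof
      fix n
      have "pr n (f n) \<in> {pr n (g n) | n. True}" unfolding eq[symmetric] by blast
      then show "f n = g n" by auto
    qed
  qed
  then have "A \<lesssim> (UNIV :: nat set set)" unfolding lepoll_def by (meson inj_on_subset subset_UNIV)
  moreover have "(UNIV :: nat set set) \<lesssim> A"
  proof -
    have "inj (\<lambda>Y :: nat set. F (\<lambda>n. n \<in> Y))"
    proof (rule injI)
      fix Y Z :: "nat set" assume "F (\<lambda>n. n \<in> Y) = F (\<lambda>n. n \<in> Z)"
      then have "(\<lambda>n. n \<in> Y) = (\<lambda>n. n \<in> Z)" by (rule injD[OF assms(1)])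
      then show "Y = Z" by (auto dest: fun_cong)
    qed
    moreover have "range (\<lambda>Y :: nat set. F (\<lambda>n. n \<in> Y)) \<subseteq> A" using assms(2) by auto
    ultimately show ?thesis unfolding lepoll_def by blast
  qed
  ultimately have "A \<approx> (UNIV :: nat set set)" by (rule lepoll_antisym)
  then show ?thesis using nat_sets_eqpoll_reals by (rule eqpoll_trans)
qed

theorem theorem32:
  fixes \<alpha> :: "nat rel"
  assumes "computable_ordinal \<alpha>"
  shows "{f. Delta0_dominated (one_plus \<alpha>) f} \<approx> (UNIV :: real set) \<and>
    {f. strongly_relativizes_Delta0_at_nat (one_plus \<alpha>) f} \<approx> (UNIV :: real set)"
proof -
  interpret one_plus_rank \<alpha> by unfold_locales (rule assms)
  obtain F :: "(nat \<Rightarrow> bool) \<Rightarrow> nat \<Rightarrow> nat"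
    where F: "inj F" "\<And>Y. Delta0_dominated (one_plus \<alpha>) (F Y)"
    using many_dominated by blast
  show ?thesis
    by (intro conjI eqpoll_reals_of_inj[OF F(1)])
      (use F(2) dominated_imp_strongly_relativizes in auto)
qed

end
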